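(* Let $n\ge 2$, and let $k\ge0$, $n\ge a\ge b\ge0$, $l\ge0$, $n\ge d\ge0$ be integers. Then $$\mathrm{Hom}_{\mathbf{Sp}(1)\times\mathbf{Sp}(n)}\big(\mathrm{Sym}^kH\otimes\Lambda^{a,b}_{\mathrm{top}}E,\;\mathbf{S}\otimes\mathcal{R}^{l,d}\big)\neq\{0\}$$ (i.e. $\mathcal{R}^{l,d}$ is an admissible twist for $\mathrm{Sym}^kH\otimes\Lambda^{a,b}_{\mathrm{top}}E$) if and only if $k+a+b\equiv n+l+d \pmod 2$ and $$b\le d,\qquad |k-l|+|a-d|\le n-b,\qquad |n-a+b-d|\le k+l.$$
   Context: $H\cong\mathbb{C}^2$ and $E\cong\mathbb{C}^{2n}$ are the standard representations of $\mathbf{Sp}(1)$ and $\mathbf{Sp}(n)$ (complex vector spaces with symplectic form $\sigma$ and compatible quaternionic structure). $\mathrm{Sym}^kH$ is the $k$-th symmetric power (irreducible of dimension $k+1$). For $0\le d\le n$, $\Lambda^d_\circ E$ is the kernel of contraction with $\sigma$, $\Lambda^dE\to\Lambda^{d-2}E$. For $n\ge a\ge b\ge0$, $\Lambda^{a,b}_{\mathrm{top}}E$ is the irreducible $\mathbf{Sp}(n)$-representation of highest weight occurring in $\Lambda^a_\circ E\otimes\Lambda^b_\circ E$ (the common kernel of the diagonal contraction with $\sigma$ and of the Plücker differential $\sum_\mu e_\mu\wedge\otimes\, de_\mu\lrcorner$). $\mathcal{R}^{l,d}:=\mathrm{Sym}^lH\otimes\Lambda^d_\circ E$. $\mathbf{S}:=\bigoplus_{r=0}^n\mathrm{Sym}^rH\otimes\Lambda^{n-r}_\circ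 E$ is the spinor representation of $\mathfrak{so}(4n)$ restricted to $\mathbf{Sp}(1)\times\mathbf{Sp}(n)$. *)

theory Defs
  imports Complex_Main
begin

text \<open>Concrete model. A (mixed) tensor is a function of two index lists:
  the first list indexes factors of H = C^2 (indices < 2), the second list
  indexes factors of E = C^(2n) (indices < 2n). Subspaces such as
  Sym^k H (x) Lambda^{a,b}_top E are realised inside these tensor spaces by
  the usual linear conditions (symmetry, antisymmetry, vanishing of
  contractions), and Sp(1) x Sp(n) acts by the tensor power action.\<close>

type_synonym tensor = "nat list \<Rightarrow> nat list \<Rightarrow> complex"
type_synonym cmat = "nat \<Rightarrow> nat \<Rightarrow> complex"

definition idx :: "nat \<Rightarrow> nat \<Rightarrow> nat list set" where
  "idx N m = {xs. length xs = m \<and> (\<forall>x\<in>set xs. x < N)}"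

definition sympl :: "nat \<Rightarrow> cmat" where
  "sympl m i j = (if i < m \<and> j = i + m then 1 else if j < m \<and> i = j + m then -1 else 0)"

definition cpt_sp :: "nat \<Rightarrow> cmat set" where
  "cpt_sp m = {g. (\<forall>i j. (2*m \<le> i \<or> 2*m \<le> j) \<longrightarrow> g i j = 0)
     \<and> (\<forall>i<2*m. \<forall>j<2*m. (\<Sum>p<2*m. \<Sum>q<2*m. g p i * sympl m p q * g q j) = sympl m i j)
     \<and> (\<forall>i<2*m. \<forall>j<2*m. (\<Sum>p<2*m. cnj (g p i) * g p j) = (if i = j then 1 else 0))}"

definition act :: "nat \<Rightarrow> cmat \<Rightarrow> cmat \<Rightarrow> tensor \<Rightarrow> tensor" where
  "act n h g f = (\<lambda>hs es. \<Sum>hs'\<in>idx 2 (length hs). \<Sum>es'\<in>idx (2*n) (length es).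
      (\<Prod>r<length hs. h (hs!r) (hs'!r)) * (\<Prod>r<length es. g (es!r) (es'!r)) * f hs' es')"

definition supp_in :: "nat \<Rightarrow> nat \<Rightarrow> nat \<Rightarrow> tensor \<Rightarrow> bool" where
  "supp_in n p q f \<longleftrightarrow> (\<forall>hs es. f hs es \<noteq> 0 \<longrightarrow> hs \<in> idx 2 p \<and> es \<in> idx (2*n) q)"

definition swp :: "nat \<Rightarrow> nat \<Rightarrow> 'a list \<Rightarrow> 'a list" where
  "swp i j xs = xs[i := xs!j, j := xs!i]"

definition symH :: "nat \<Rightarrow> nat \<Rightarrow> tensor \<Rightarrow> bool" where
  "symH s m f \<longleftrightarrow> (\<forall>hs es i j. s \<le> i \<longrightarrow> i < j \<longrightarrow> j < s + m \<longrightarrow> f (swp i j hs) es = f hs es)"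

definition altE :: "nat \<Rightarrow> nat \<Rightarrow> tensor \<Rightarrow> bool" where
  "altE s m f \<longleftrightarrow> (\<forall>hs es i j. s \<le> i \<longrightarrow> i < j \<longrightarrow> j < s + m \<longrightarrow> f hs (swp i j es) = - f hs es)"

definition trlE :: "nat \<Rightarrow> nat \<Rightarrow> nat \<Rightarrow> tensor \<Rightarrow> bool" where
  "trlE n s m f \<longleftrightarrow> (2 \<le> m \<longrightarrow> (\<forall>hs es.
     (\<Sum>\<mu><2*n. \<Sum>\<nu><2*n. sympl n \<mu> \<nu> * f hs (take s es @ \<mu> # \<nu> # drop s es)) = 0))"

definition primE :: "nat \<Rightarrow> nat \<Rightarrow> nat \<Rightarrow> tensor \<Rightarrow> bool" where
  "primE n s m f \<longleftrightarrow> altE s m f \<and> trlE n s m f"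

definition diagE :: "nat \<Rightarrow> nat \<Rightarrow> nat \<Rightarrow> tensor \<Rightarrow> bool" where
  "diagE n a b f \<longleftrightarrow> (1 \<le> a \<and> 1 \<le> b \<longrightarrow> (\<forall>hs es.
     (\<Sum>\<mu><2*n. \<Sum>\<nu><2*n. sympl n \<mu> \<nu> * f hs (\<mu> # take (a - 1) es @ \<nu> # drop (a - 1) es)) = 0))"

text \<open>Pluecker differential sum_mu e_mu wedge (x) e^mu contraction,
  Lambda^a (x) Lambda^b -> Lambda^(a+1) (x) Lambda^(b-1), vanishes.\<close>
definition pluckE :: "nat \<Rightarrow> nat \<Rightarrow> tensor \<Rightarrow> bool" where
  "pluckE a b f \<longleftrightarrow> (1 \<le> b \<longrightarrow> (\<forall>hs is js. length is = Suc a \<longrightarrow>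
     (\<Sum>p\<le>a. (-1)^p * f hs (take p is @ drop (Suc p) is @ (is!p) # js)) = 0))"

definition Vsp :: "nat \<Rightarrow> nat \<Rightarrow> nat \<Rightarrow> nat \<Rightarrow> tensor set" where
  "Vsp n k a b = {f. supp_in n k (a + b) f \<and> symH 0 k f
      \<and> primE n 0 a f \<and> primE n a b f \<and> diagE n a b f \<and> pluckE a b f}"

definition Wsummand :: "nat \<Rightarrow> nat \<Rightarrow> nat \<Rightarrow> nat \<Rightarrow> tensor set" where
  "Wsummand n r l d = {f. supp_in n (r + l) (n - r + d) f \<and> symH 0 r f \<and> symH r l f
      \<and> primE n 0 (n - r) f \<and> primE n (n - r) d f}"

text \<open>S (x) R^{l,d}, with S = (+)_{r=0}^n Sym^r H (x) Lambda^(n-r)_o E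
  (the summands have disjoint supports, so the direct sum is the sum).\<close>
definition Wsp :: "nat \<Rightarrow> nat \<Rightarrow> nat \<Rightarrow> tensor set" where
  "Wsp n l d = {f. \<exists>w. (\<forall>r\<le>n. w r \<in> Wsummand n r l d) \<and> f = (\<lambda>hs es. \<Sum>r\<le>n. w r hs es)}"

definition hom_nonzero :: "nat \<Rightarrow> tensor set \<Rightarrow> tensor set \<Rightarrow> bool" where
  "hom_nonzero n V W \<longleftrightarrow> (\<exists>F :: tensor \<Rightarrow> tensor.
      (\<forall>x\<in>V. \<forall>y\<in>V. F (\<lambda>hs es. x hs es + y hs es) = (\<lambda>hs es. F x hs es + F y hs es))
    \<and> (\<forall>c. \<forall>x\<in>V. F (\<lambda>hs es. c * x hs es) = (\<lambda>hs es. c * F x hs es))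
    \<and> F ` V \<subseteq> W
    \<and> (\<forall>h\<in>cpt_sp 1. \<forall>g\<in>cpt_sp n. \<forall>v\<in>V. F (act n h g v) = act n h g (F v))
    \<and> (\<exists>v\<in>V. F v \<noteq> (\<lambda>hs es. 0)))"

end

theory Submission
  imports Defs "Jordan_Normal_Form.Determinant"
begin

text \<open>Write \<open>c = n - r\<close> for the degree of the exterior factor next to \<open>Sym\<^sup>r H\<close>. The summand \<open>r\<close> of the target
  contains the source iff the Clebsch-Gordan conditions \<open>|k - l| \<le> r \<le> k + l\<close> hold for the \<open>H\<close>-part and
  \<open>a + b \<le> c + d\<close>, \<open>|c - d| \<le> a - b\<close>, \<open>a - b + c + d \<le> 2n\<close> for the \<open>E\<close>-part, together with the parity
  conditions; eliminating \<open>r\<close> gives the theorem.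

  Existence: insert symplectic forms and project orthogonally onto the summand. The result is nonzero because
  it pairs nontrivially with a decomposable vector \<open>e\<^sub>I \<otimes> e\<^sub>J\<close> with \<open>I\<close> and \<open>J\<close> isotropic.

  Necessity: the image contains a highest weight vector. Its leading coefficient along the highest weight
  vector of the second exterior factor is a primitive form killed by the raising operators of a Levi subgroup;
  inspecting its support shows that the weight is \<open>(2, \<dots>, 2, 1, \<dots>, 1, 0, \<dots>, 0)\<close> with \<open>b'\<close> twos and
  \<open>a' - b'\<close> ones, and gives the inequalities for \<open>a', b'\<close>. Since this is also a weight of the source, on
  which the Casimir operator is a scalar, comparing Casimir eigenvalues forces \<open>a' = a\<close> and \<open>b' = b\<close>.\<close>

section \<open>Tensors and the group action in index form\<close>

text \<open>Put \<open>c = n - r\<close>. The E-conditions then read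
  \<open>|n - a + b - d| <= r <= n - b - |a - d|\<close>, and the Clebsch-Gordan conditions
  \<open>|k - l| <= r <= k + l\<close>. Given \<open>b <= a <= n\<close> and \<open>d <= n\<close>,
  the first interval is nonempty exactly when \<open>b <= d\<close>, and the other two inequalities
  of the theorem say that the two intervals meet. The parity condition makes both lower ends
  congruent mod 2, so the larger of them is itself an admissible \<open>r\<close>.

  The obstacle in the necessity direction is that a homomorphism is just a linear map commuting with
  two compact groups, with no continuity at hand. On tensors of bounded degree, Lie algebra elements
  are therefore written as finite combinations of group elements, which such a map respects.
  Irreducibility of the source is replaced by two facts: its Casimir operator is a scalar, and its
  weights of the shape in question satisfy \<open>b' <= b\<close> and
  \<open>a' + b' <= a + b\<close>. Under these bounds equal Casimir eigenvalues force equal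
  weights.\<close>

type_synonym tens = "nat list \<Rightarrow> complex"

definition wprod :: "cmat \<Rightarrow> nat list \<Rightarrow> nat list \<Rightarrow> complex" where
  "wprod g xs ys = (\<Prod>r<length xs. g (xs!r) (ys!r))"

definition gact :: "nat \<Rightarrow> cmat \<Rightarrow> tens \<Rightarrow> tens" where
  "gact N g f xs = (\<Sum>ys\<in>idx N (length xs). wprod g xs ys * f ys)"

definition supported :: "nat \<Rightarrow> nat \<Rightarrow> tens \<Rightarrow> bool" where
  "supported N m f \<longleftrightarrow> (\<forall>xs. f xs \<noteq> 0 \<longrightarrow> xs \<in> idx N m)"

lemma idx_iff: "xs \<in> idx N m \<longleftrightarrow> length xs = m \<and> (\<forall>i<m. xs!i < N)"
  unfolding idx_def by (auto simp: all_set_conv_all_nth)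

lemma length_idx: "xs \<in> idx N m \<Longrightarrow> length xs = m"
  by (simp add: idx_def)

lemma finite_idx [simp]: "finite (idx N m)"
proof -
  have "idx N m = {xs. set xs \<subseteq> {..<N} \<and> length xs = m}"
    unfolding idx_def by auto
  then show ?thesis
    by (simp add: finite_lists_length_eq)
qed

lemma idx_0 [simp]: "idx N 0 = {[]}"
  unfolding idx_def by auto

lemma idx_update: "xs \<in> idx N m \<Longrightarrow> q < N \<Longrightarrow> xs[r := q] \<in> idx N m"
  unfolding idx_iff by (cases "r < length xs") (auto simp: nth_list_update)

lemma sum_idx_Suc: "(\<Sum>xs\<in>idx N (Suc m). f xs) = (\<Sum>x<N. \<Sum>xs\<in>idx N m. f (x # xs))"
proof -
  have "idx N (Suc m) = (\<lambda>(x, xs). x # xs) ` ({..<N} \<times> idx N m)"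
    unfolding idx_def by (auto simp: length_Suc_conv image_iff)
  moreover have "inj_on (\<lambda>(x, xs). x # xs) ({..<N} \<times> idx N m)"
    by (auto simp: inj_on_def)
  ultimately show ?thesis
    by (simp add: sum.reindex sum.cartesian_product case_prod_beta')
qed

lemma sum_idx_append:
  "(\<Sum>xs\<in>idx N (p + q). f xs) = (\<Sum>xs\<in>idx N p. \<Sum>ys\<in>idx N q. f (xs @ ys))"
  by (induction p arbitrary: f) (simp_all add: sum_idx_Suc)

lemma wprod_Cons [simp]: "wprod g (x # xs) (y # ys) = g x y * wprod g xs ys"
  unfolding wprod_def by (simp only: length_Cons prod.lessThan_Suc_shift) simp

lemma wprod_Nil [simp]: "wprod g [] ys = 1"
  by (simp add: wprod_def)

lemma wprod_append:
  "length xs = length xs' \<Longrightarrow> wprod g (xs @ ys) (xs' @ ys') = wprod g xs xs' * wprod g ys ys'"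
  by (induction xs xs' rule: list_induct2) simp_all

lemma gact_Cons: "gact N g f (x # xs) = (\<Sum>y<N. g x y * gact N g (\<lambda>ys. f (y # ys)) xs)"
  unfolding gact_def by (simp add: sum_idx_Suc sum_distrib_left mult.assoc)

lemma gact_append:
  "gact N g f (xs @ ys) = gact N g (\<lambda>xs'. gact N g (\<lambda>ys'. f (xs' @ ys')) ys) xs"
proof -
  have "wprod g (xs @ ys) (xs' @ ys') * f (xs' @ ys')
      = wprod g xs xs' * (wprod g ys ys' * f (xs' @ ys'))"
    if "xs' \<in> idx N (length xs)" for xs' ys'
    using that by (simp add: wprod_append length_idx)
  then show ?thesis
    unfolding gact_def length_append sum_idx_append sum_distrib_left
    by (intro sum.cong refl)
qed

lemma gact_sum: "gact N g (\<lambda>xs. \<Sum>i\<in>A. f i xs) xs = (\<Sum>i\<in>A. gact N g (f i) xs)"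
  unfolding gact_def by (subst sum.swap) (simp add: sum_distrib_left)

lemma gact_scale: "gact N g (\<lambda>xs. c * f xs) xs = c * gact N g f xs"
  unfolding gact_def by (simp add: sum_distrib_left mult.left_commute)

lemma act_eq: "act n h g f hs es = gact 2 h (\<lambda>hs'. gact (2*n) g (f hs') es) hs"
  unfolding act_def gact_def wprod_def
  by (simp add: sum_distrib_left mult.assoc)

lemma act_eq': "act n h g f hs es = gact (2*n) g (\<lambda>es'. gact 2 h (\<lambda>hs'. f hs' es') hs) es"
  unfolding act_eq gact_def sum_distrib_left by (subst sum.swap) (simp add: mult_ac)

text \<open>The same matrix acts in every slot, so permuting the slots commutes with the action:
  substitute the bijection \<open>?\<rho>\<close> of the index lists in the sum.\<close>

lemma gact_rearrange:
  assumes d: "distinct is" and s: "set is = {..<length xs}"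
  shows "gact N g (\<lambda>ys. f (map ((!) ys) is)) xs = gact N g f (map ((!) xs) is)"
proof -
  let ?m = "length xs"
  let ?\<rho> = "\<lambda>ys. map ((!) ys) is" 
  have len: "length is = ?m"
    using distinct_card[OF d] s by simp
  have bij: "bij_betw ((!) is) {..<?m} {..<?m}"
    using s len by (intro bij_betw_nth[OF d]) simp_all
  have inj: "inj_on ?\<rho> (idx N ?m)"
  proof (rule inj_onI)
    fix ys zs assume *: "ys \<in> idx N ?m" "zs \<in> idx N ?m" "?\<rho> ys = ?\<rho> zs"
    show "ys = zs"
    proof (rule nth_equalityI)
      show "length ys = length zs" using * by (simp add: idx_def)
      fix i assume "i < length ys"
      then have "i \<in> set is" using * s by (simp add: idx_def)
      then show "ys!i = zs!i" using *(3) by (simp add: map_eq_conv)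
    qed
  qed
  have sub: "?\<rho> ` idx N ?m \<subseteq> idx N ?m"
  proof
    fix zs assume "zs \<in> ?\<rho> ` idx N ?m"
    then obtain ys where ys: "ys \<in> idx N ?m" "zs = ?\<rho> ys" by blast
    then show "zs \<in> idx N ?m"
      using s len by (auto simp: idx_def)
  qed
  have im: "?\<rho> ` idx N ?m = idx N ?m"
    by (rule endo_inj_surj[OF finite_idx sub inj])
  have w: "wprod g (?\<rho> xs) (?\<rho> ys) = wprod g xs ys" if "ys \<in> idx N ?m" for ys
  proof -
    have "wprod g (?\<rho> xs) (?\<rho> ys) = (\<Prod>r<?m. g (xs ! (is!r)) (ys ! (is!r)))"
      unfolding wprod_def by (rule prod.cong) (simp_all add: len)
    also have "\<dots> = (\<Prod>r<?m. g (xs ! r) (ys ! r))"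
      by (rule prod.reindex_bij_betw[OF bij, of "\<lambda>r. g (xs ! r) (ys ! r)"])
    finally show ?thesis by (simp add: wprod_def)
  qed
  have "gact N g f (?\<rho> xs) = (\<Sum>ys\<in>?\<rho> ` idx N ?m. wprod g (?\<rho> xs) ys * f ys)"
    unfolding gact_def im by (simp add: len)
  also have "\<dots> = (\<Sum>ys\<in>idx N ?m. wprod g xs ys * f (?\<rho> ys))"
    by (simp add: sum.reindex[OF inj] w)
  finally show ?thesis by (simp add: gact_def)
qed

section \<open>Exchanging two slots\<close>

lemma length_swp [simp]: "length (swp i j xs) = length xs"
  by (simp add: swp_def)

lemma nth_swp:
  "i < length xs \<Longrightarrow> j < length xs \<Longrightarrow> k < length xs \<Longrightarrow>
    swp i j xs ! k = (if k = i then xs!j else if k = j then xs!i else xs!k)"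
  by (auto simp: swp_def nth_list_update)

lemma swp_eq_map:
  assumes "i < length xs" "j < length xs"
  shows "swp i j xs = map ((!) xs) (swp i j [0..<length xs])"
  by (rule nth_equalityI) (use assms in \<open>auto simp: nth_swp\<close>)

lemma swp_swp: "i < length xs \<Longrightarrow> j < length xs \<Longrightarrow> swp i j (swp i j xs) = xs"
  by (rule nth_equalityI) (auto simp: nth_swp)

lemma mset_swp: "i < length xs \<Longrightarrow> j < length xs \<Longrightarrow> mset (swp i j xs) = mset xs"
  by (cases "i = j") (auto simp: swp_def mset_swap)

lemma set_swp: "i < length xs \<Longrightarrow> j < length xs \<Longrightarrow> set (swp i j xs) = set xs"
  using mset_swp mset_eq_setD by blast

lemma distinct_swp: "i < length xs \<Longrightarrow> j < length xs \<Longrightarrow> distinct (swp i j xs) = distinct xs"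
  using mset_swp mset_eq_imp_distinct_iff by blast

lemma gact_swp:
  assumes "i < length xs" "j < length xs"
  shows "gact N g f (swp i j xs) = gact N g (\<lambda>ys. f (swp i j ys)) xs"
proof -
  let ?is = "swp i j [0..<length xs]"
  have "gact N g f (swp i j xs) = gact N g (\<lambda>ys. f (map ((!) ys) ?is)) xs"
    using gact_rearrange[of ?is xs N g f] assms
    by (simp add: swp_eq_map[OF assms, symmetric] distinct_swp set_swp atLeast0LessThan)
  also have "\<dots> = gact N g (\<lambda>ys. f (swp i j ys)) xs"
    unfolding gact_def
  proof (rule sum.cong[OF refl])
    fix ys assume "ys \<in> idx N (length xs)"
    then have "swp i j ys = map ((!) ys) ?is"
      using swp_eq_map[of i ys j] assms by (simp add: length_idx)
    then show "wprod g xs ys * f (map ((!) ys) ?is) = wprod g xs ys * f (swp i j ys)"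
      by simp
  qed
  finally show ?thesis .
qed

text \<open>Exchanging the entry \<open>xs!r\<close> with the free value \<open>q\<close> is an
  involution on pairs; it turns the left side into a sum whose terms do not depend on
  \<open>q\<close>.\<close>

lemma sum_idx_update:
  assumes "r < m"
  shows "(\<Sum>xs\<in>idx N m. \<Sum>q<N. h (xs[r := q])) = of_nat N * (\<Sum>xs\<in>idx N m. h xs :: complex)"
proof -
  let ?t = "\<lambda>(xs, q). (xs[r := q], xs!r)"
  have "(\<Sum>xs\<in>idx N m. \<Sum>q<N. h (xs[r := q])) = (\<Sum>(xs, q)\<in>idx N m \<times> {..<N}. h (xs[r := q]))"
    by (simp add: sum.cartesian_product)
  also have "\<dots> = (\<Sum>(xs, q)\<in>idx N m \<times> {..<N}. h xs)"
    by (rule sum.reindex_bij_witness[of _ ?t ?t])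
      (use assms in \<open>auto simp: idx_update\<close>, auto simp: idx_iff)
  also have "\<dots> = of_nat N * (\<Sum>xs\<in>idx N m. h xs)"
    by (simp add: sum.cartesian_product[symmetric] sum_distrib_left)
  finally show ?thesis .
qed

text \<open>The argument keeps its full length and its entries at \<open>r\<close> and
  \<open>s\<close> are overwritten, so that contractions in different pairs of slots can be compared
  without shifting positions.\<close>

definition contraction :: "nat \<Rightarrow> nat \<Rightarrow> nat \<Rightarrow> tens \<Rightarrow> tens" where
  "contraction n r s f xs = (\<Sum>\<mu><2*n. \<Sum>\<nu><2*n. sympl n \<mu> \<nu> * f (xs[r := \<mu>, s := \<nu>]))"

lemma wprod_update2:
  assumes "r < length xs" "s < length xs" "r \<noteq> s"
  shows "wprod g (xs[r := x, s := y]) ys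
    = g x (ys!r) * g y (ys!s) * (\<Prod>t\<in>{..<length xs} - {r, s}. g (xs!t) (ys!t))"
proof -
  let ?F = "\<lambda>t. g (xs[r := x, s := y] ! t) (ys!t)"
  have "wprod g (xs[r := x, s := y]) ys = (\<Prod>t\<in>{..<length xs}. ?F t)"
    by (simp add: wprod_def)
  also have "\<dots> = ?F r * prod ?F ({..<length xs} - {r})"
    using assms by (simp add: prod.remove)
  also have "prod ?F ({..<length xs} - {r}) = ?F s * prod ?F ({..<length xs} - {r} - {s})"
    using assms by (subst prod.remove[of _ s]) auto
  also have "prod ?F ({..<length xs} - {r} - {s}) = (\<Prod>t\<in>{..<length xs} - {r, s}. g (xs!t) (ys!t))"
    by (rule prod.cong) auto
  finally show ?thesis using assms by (simp add: nth_list_update mult.assoc)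
qed

lemma contraction_gact:
  assumes g: "g \<in> cpt_sp n" and rs: "r < length xs" "s < length xs" "r \<noteq> s"
    and tr: "\<And>ys. ys \<in> idx (2*n) (length xs) \<Longrightarrow> contraction n r s f ys = 0"
  shows "contraction n r s (gact (2*n) g f) xs = 0"
\<comment> \<open>The averaging argument below cancels the factor \<open>2*n\<close> twice.\<close>
proof (cases "n = 0")
  case True
  then show ?thesis by (simp add: contraction_def)
next
  case False
  let ?N = "2*n" and ?m = "length xs"
  define Q where "Q ys = (\<Prod>t\<in>{..<?m} - {r, s}. g (xs!t) (ys!t))" for ys
  have inv: "(\<Sum>\<mu><?N. \<Sum>\<nu><?N. sympl n \<mu> \<nu> * (g \<mu> i * g \<nu> j)) = sympl n i j"
    if "i < ?N" "j < ?N" for i j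
    using g that unfolding cpt_sp_def by (auto simp: mult_ac)
  have "contraction n r s (gact ?N g f) xs
    = (\<Sum>\<mu><?N. \<Sum>\<nu><?N. \<Sum>ys\<in>idx ?N ?m. sympl n \<mu> \<nu> * (g \<mu> (ys!r) * g \<nu> (ys!s)) * (Q ys * f ys))"
    unfolding contraction_def gact_def using rs
    by (simp add: wprod_update2 Q_def sum_distrib_left mult_ac)
  also have "\<dots> = (\<Sum>ys\<in>idx ?N ?m. \<Sum>\<mu><?N. \<Sum>\<nu><?N. sympl n \<mu> \<nu> * (g \<mu> (ys!r) * g \<nu> (ys!s)) * (Q ys * f ys))"
    by (subst (2) sum.swap, subst sum.swap) simp
  also have "\<dots> = (\<Sum>ys\<in>idx ?N ?m. sympl n (ys!r) (ys!s) * (Q ys * f ys))"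
  proof (rule sum.cong[OF refl])
    fix ys assume "ys \<in> idx ?N ?m"
    then have "ys!r < ?N" "ys!s < ?N" using rs by (auto simp: idx_iff)
    then show "(\<Sum>\<mu><?N. \<Sum>\<nu><?N. sympl n \<mu> \<nu> * (g \<mu> (ys!r) * g \<nu> (ys!s)) * (Q ys * f ys))
      = sympl n (ys!r) (ys!s) * (Q ys * f ys)"
      by (simp only: sum_distrib_right[symmetric] inv)
  qed
  finally have eq: "contraction n r s (gact ?N g f) xs
      = (\<Sum>ys\<in>idx ?N ?m. sympl n (ys!r) (ys!s) * (Q ys * f ys))" (is "_ = sum ?h _") .
  \<comment> \<open>Averaging over the two contracted slots turns the sum into traces of f.\<close>
  have "of_nat ?N * (of_nat ?N * sum ?h (idx ?N ?m))
      = (\<Sum>ys\<in>idx ?N ?m. \<Sum>x<?N. \<Sum>y<?N. ?h (ys[r := x, s := y]))"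
    using sum_idx_update[of s ?m ?h ?N] rs
      sum_idx_update[of r ?m "\<lambda>ys. \<Sum>y<?N. ?h (ys[s := y])" ?N]
    by simp
  also have "\<dots> = (\<Sum>ys\<in>idx ?N ?m. Q ys * contraction n r s f ys)"
  proof (rule sum.cong[OF refl])
    fix ys assume ys: "ys \<in> idx ?N ?m"
    have Q: "Q (ys[r := x, s := y]) = Q ys" for x y
      unfolding Q_def by (rule prod.cong) auto
    show "(\<Sum>x<?N. \<Sum>y<?N. ?h (ys[r := x, s := y])) = Q ys * contraction n r s f ys"
      using rs ys unfolding contraction_def
      by (simp add: Q length_idx nth_list_update sum_distrib_left mult_ac)
  qed
  also have "\<dots> = 0" by (simp add: tr)
  finally show ?thesis using eq False by simp
qed

definition alt1 :: "nat \<Rightarrow> nat \<Rightarrow> tens \<Rightarrow> bool" where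
  "alt1 s m f \<longleftrightarrow> (\<forall>xs i j. s \<le> i \<longrightarrow> i < j \<longrightarrow> j < s + m \<longrightarrow> f (swp i j xs) = - f xs)"

definition sym1 :: "nat \<Rightarrow> nat \<Rightarrow> tens \<Rightarrow> bool" where
  "sym1 s m f \<longleftrightarrow> (\<forall>xs i j. s \<le> i \<longrightarrow> i < j \<longrightarrow> j < s + m \<longrightarrow> f (swp i j xs) = f xs)"

lemma altE_iff: "altE s m f \<longleftrightarrow> (\<forall>hs. alt1 s m (f hs))"
  unfolding altE_def alt1_def by blast

lemma symH_iff: "symH s m f \<longleftrightarrow> (\<forall>es. sym1 s m (\<lambda>hs. f hs es))"
  unfolding symH_def sym1_def by blast

lemma supp_in_iff:
  "supp_in n p q f \<longleftrightarrow> (\<forall>hs. supported (2*n) q (f hs)) \<and> (\<forall>es. supported 2 p (\<lambda>hs. f hs es))"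
  unfolding supp_in_def supported_def by blast

lemma supported_zero: "supported N m f \<Longrightarrow> length xs \<noteq> m \<Longrightarrow> f xs = 0"
  unfolding supported_def idx_def by auto

lemma gact_wrong_length: "supported N m f \<Longrightarrow> length xs \<noteq> m \<Longrightarrow> gact N g f xs = 0"
  unfolding gact_def by (rule sum.neutral) (auto simp: length_idx supported_zero)

lemma cpt_sp_zero: "g \<in> cpt_sp n \<Longrightarrow> 2*n \<le> i \<Longrightarrow> g i j = 0"
  unfolding cpt_sp_def by blast

lemma supported_gact:
  assumes "g \<in> cpt_sp n" "supported (2*n) m f"
  shows "supported (2*n) m (gact (2*n) g f)"
  unfolding supported_def
proof (intro allI impI)
  fix xs assume nz: "gact (2*n) g f xs \<noteq> 0"
  have len: "length xs = m"
    using gact_wrong_length[OF assms(2)] nz by blast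
  have "xs!i < 2*n" if "i < m" for i
  proof (rule ccontr)
    assume "\<not> xs!i < 2*n"
    then have "g (xs!i) y = 0" for y
      using cpt_sp_zero[OF assms(1)] by simp
    then have "wprod g xs ys = 0" for ys
      unfolding wprod_def using that len by (intro prod_zero) auto
    then show False using nz by (simp add: gact_def)
  qed
  then show "xs \<in> idx (2*n) m" using len by (simp add: idx_iff)
qed

text \<open>\<open>swp\<close> is a transposition only for positions inside the list, so lists of
  the wrong length are treated apart; there both sides vanish because of the support.\<close>

lemma alt1_gact:
  assumes "alt1 s m f" "supported N M f" "s + m \<le> M"
  shows "alt1 s m (gact N g f)"
  unfolding alt1_def
proof (intro allI impI)
  fix xs i j assume ij: "s \<le> i" "i < j" "j < s + m"
  show "gact N g f (swp i j xs) = - gact N g f xs"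
  proof (cases "length xs = M")
    case True
    have "gact N g f (swp i j xs) = gact N g (\<lambda>ys. - f ys) xs"
      using ij assms True by (simp add: gact_swp alt1_def)
    then show ?thesis using gact_scale[of N g "-1" f xs] by simp
  qed (use assms(2) in \<open>simp add: gact_wrong_length\<close>)
qed

lemma sym1_gact:
  assumes "sym1 s m f" "supported N M f" "s + m \<le> M"
  shows "sym1 s m (gact N g f)"
  unfolding sym1_def
proof (intro allI impI)
  fix xs i j assume ij: "s \<le> i" "i < j" "j < s + m"
  show "gact N g f (swp i j xs) = gact N g f xs"
  proof (cases "length xs = M")
    case True
    then show ?thesis
      using ij assms True by (simp add: gact_swp sym1_def)
  qed (use assms(2) in \<open>simp add: gact_wrong_length\<close>)
qed

section \<open>The representation spaces as invariant subspaces\<close>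

definition traceless :: "nat \<Rightarrow> nat \<Rightarrow> nat \<Rightarrow> nat \<Rightarrow> tens \<Rightarrow> bool" where
  "traceless n m r s f \<longleftrightarrow> (\<forall>xs. length xs = m \<longrightarrow> contraction n r s f xs = 0)"

text \<open>The exchange (Garnir) form of the Pluecker relation. It involves only exchanges of
  slots, which commute with the group and are what the Casimir operator produces.\<close>

definition plucker :: "nat \<Rightarrow> nat \<Rightarrow> tens \<Rightarrow> bool" where
  "plucker m a f \<longleftrightarrow> (\<forall>xs. length xs = m \<longrightarrow> f xs = (\<Sum>p<a. f (swp p a xs)))"

definition sym_blocks :: "nat \<Rightarrow> nat \<Rightarrow> tens \<Rightarrow> bool" where
  "sym_blocks r l f \<longleftrightarrow> supported 2 (r + l) f \<and> sym1 0 r f \<and> sym1 r l f"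

definition prim_blocks :: "nat \<Rightarrow> nat \<Rightarrow> nat \<Rightarrow> tens \<Rightarrow> bool" where
  "prim_blocks n c d f \<longleftrightarrow> supported (2*n) (c + d) f \<and> alt1 0 c f \<and> alt1 c d f
    \<and> (2 \<le> c \<longrightarrow> traceless n (c + d) 0 1 f) \<and> (2 \<le> d \<longrightarrow> traceless n (c + d) c (Suc c) f)"

definition top_blocks :: "nat \<Rightarrow> nat \<Rightarrow> nat \<Rightarrow> tens \<Rightarrow> bool" where
  "top_blocks n a b f \<longleftrightarrow> prim_blocks n a b f \<and> (1 \<le> a \<and> 1 \<le> b \<longrightarrow> traceless n (a + b) 0 a f)
    \<and> (1 \<le> b \<longrightarrow> plucker (a + b) a f)"

text \<open>This is the tensor product of the two subspaces: for subspaces \<open>A\<close> of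
  \<open>X\<close> and \<open>B\<close> of \<open>Y\<close>, finite-dimensional,
  \<open>A \<otimes> B\<close> is the intersection of \<open>A \<otimes> Y\<close> and
  \<open>X \<otimes> B\<close>, so each condition can be imposed separately.\<close>

definition tensor_space :: "(tens \<Rightarrow> bool) \<Rightarrow> (tens \<Rightarrow> bool) \<Rightarrow> tensor set" where
  "tensor_space PH PE = {f. (\<forall>hs. PE (f hs)) \<and> (\<forall>es. PH (\<lambda>hs. f hs es))}"

lemma insert2_update:
  "s \<le> length xs \<Longrightarrow> (take s xs @ x # y # drop s xs)[s := \<mu>, Suc s := \<nu>] = take s xs @ \<mu> # \<nu> # drop s xs"
  by (simp add: list_update_append)

text \<open>\<open>trlE\<close> inserts the contracted indices into a list that is two entries
  shorter, \<open>traceless\<close> overwrites entries of a full list. Lists of the wrong length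
  have to be covered as well; on them the support condition makes every term vanish.\<close>

lemma trlE_iff:
  assumes sup: "supp_in n p q f" and le: "s + m \<le> q"
  shows "trlE n s m f \<longleftrightarrow> (2 \<le> m \<longrightarrow> (\<forall>hs. traceless n q s (Suc s) (f hs)))"
proof (cases "2 \<le> m")
  case True
  have "(\<Sum>\<mu><2*n. \<Sum>\<nu><2*n. sympl n \<mu> \<nu> * f hs (take s es @ \<mu> # \<nu> # drop s es)) = 0"
    if tr: "\<forall>hs. traceless n q s (Suc s) (f hs)" for hs es
  proof (cases "length es + 2 = q")
    case True
    with \<open>2 \<le> m\<close> le have "s \<le> length es" by simp
    then show ?thesis
      using tr[rule_format, of hs] True insert2_update[of s es 0 0]
      unfolding traceless_def contraction_def
      by (auto dest!: spec[of _ "take s es @ 0 # 0 # drop s es"])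
  next
    case False
    then have "f hs (take s es @ \<mu> # \<nu> # drop s es) = 0" for \<mu> \<nu>
      using supported_zero[of "2*n" q "f hs"] sup unfolding supp_in_iff by auto
    then show ?thesis by simp
  qed
  moreover have "contraction n s (Suc s) (f hs) xs = 0"
    if tr: "\<And>hs es. (\<Sum>\<mu><2*n. \<Sum>\<nu><2*n. sympl n \<mu> \<nu> * f hs (take s es @ \<mu> # \<nu> # drop s es)) = 0"
      and len: "length xs = q" for hs xs
  proof -
    define es where "es = take s xs @ drop (Suc (Suc s)) xs"
    have s: "Suc s < length xs" using le len True by simp
    have "xs = take s xs @ xs!s # xs!(Suc s) # drop (Suc (Suc s)) xs"
      using s by (simp add: Cons_nth_drop_Suc)
    moreover have "take s es = take s xs" "drop s es = drop (Suc (Suc s)) xs" "s \<le> length es"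
      using s by (simp_all add: es_def)
    ultimately have "xs[s := \<mu>, Suc s := \<nu>] = take s es @ \<mu> # \<nu> # drop s es" for \<mu> \<nu>
      using insert2_update[of s es "xs!s" "xs!Suc s" \<mu> \<nu>] by simp
    then show ?thesis using tr by (simp add: contraction_def)
  qed
  ultimately show ?thesis
    using True unfolding trlE_def traceless_def by blast
qed (simp add: trlE_def)

lemma insert_diag_update:
  "s \<le> length xs \<Longrightarrow> (x # take s xs @ y # drop s xs)[0 := \<mu>, Suc s := \<nu>] = \<mu> # take s xs @ \<nu> # drop s xs"
  by (simp add: list_update_append)

lemma diagE_iff:
  assumes sup: "supp_in n p (a + b) f"
  shows "diagE n a b f \<longleftrightarrow> (1 \<le> a \<and> 1 \<le> b \<longrightarrow> (\<forall>hs. traceless n (a + b) 0 a (f hs)))"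
proof (cases "1 \<le> a \<and> 1 \<le> b")
  case True
  then obtain s where a: "a = Suc s" by (cases a) auto
  have "(\<Sum>\<mu><2*n. \<Sum>\<nu><2*n. sympl n \<mu> \<nu> * f hs (\<mu> # take s es @ \<nu> # drop s es)) = 0"
    if tr: "\<forall>hs. traceless n (a + b) 0 a (f hs)" for hs es
  proof (cases "length es + 2 = a + b")
    case len: True
    with True a have "s \<le> length es" by simp
    then show ?thesis
      using tr[rule_format, of hs] len insert_diag_update[of s es 0 0]
      unfolding traceless_def contraction_def a
      by (auto dest!: spec[of _ "0 # take s es @ 0 # drop s es"])
  next
    case False
    then have "f hs (\<mu> # take s es @ \<nu> # drop s es) = 0" for \<mu> \<nu>
      using supported_zero[of "2*n" "a + b" "f hs"] sup unfolding supp_in_iff by auto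
    then show ?thesis by simp
  qed
  moreover have "contraction n 0 a (f hs) xs = 0"
    if tr: "\<And>hs es. (\<Sum>\<mu><2*n. \<Sum>\<nu><2*n. sympl n \<mu> \<nu> * f hs (\<mu> # take s es @ \<nu> # drop s es)) = 0"
      and len: "length xs = a + b" for hs xs
  proof -
    define es where "es = take s (tl xs) @ drop (Suc s) (tl xs)"
    have s: "s < length (tl xs)" "xs \<noteq> []" using len True a by auto
    have "xs = hd xs # take s (tl xs) @ tl xs ! s # drop (Suc s) (tl xs)"
      using s by (simp add: id_take_nth_drop[symmetric])
    moreover have "take s es = take s (tl xs)" "drop s es = drop (Suc s) (tl xs)" "s \<le> length es"
      using s by (simp_all add: es_def)
    ultimately have "xs[0 := \<mu>, Suc s := \<nu>] = \<mu> # take s es @ \<nu> # drop s es" for \<mu> \<nu>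
      using insert_diag_update[of s es "hd xs" "tl xs ! s" \<mu> \<nu>] by simp
    then show ?thesis using tr by (simp add: contraction_def a)
  qed
  ultimately show ?thesis
    using True unfolding diagE_def traceless_def a by auto
qed (auto simp: diagE_def)

lemma swp_adjacent: "swp (length A) (Suc (length A)) (A @ x # y # R) = A @ y # x # R"
  by (simp add: swp_def list_update_append nth_append)

lemma alt1_move:
  assumes "alt1 0 a f" "length A + Suc (length B) \<le> a"
  shows "f (A @ x # B @ C) = (-1) ^ length B * f (A @ B @ x # C)"
  using assms(2)
proof (induction B arbitrary: A)
  case (Cons y B)
  have "f (A @ x # y # B @ C) = - f (A @ y # x # B @ C)"
    using assms(1) Cons.prems unfolding alt1_def
    by (subst swp_adjacent[symmetric]) auto
  also have "f (A @ y # x # B @ C) = (-1) ^ length B * f (A @ y # B @ x # C)"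
    using Cons.IH[of "A @ [y]"] Cons.prems by simp
  finally show ?case by simp
qed simp

lemma swp_far: "swp (length A) (Suc (length A + length B)) (A @ x # B @ y # C) = A @ y # B @ x # C"
  by (simp add: swp_def list_update_append nth_append)

text \<open>After the exchange, \<open>is!a\<close> stands at position \<open>p\<close>. Moving it
  back past the \<open>a - Suc p\<close> entries in between gives the list on the left, with sign
  \<open>(-1) ^ (a - Suc p)\<close>; together with \<open>(-1) ^ p\<close> this is
  \<open>- (-1) ^ a\<close>.\<close>

lemma plucker_term:
  assumes alt: "alt1 0 a f" and len: "length is = Suc a" and p: "p < a"
  shows "(-1) ^ p * f (take p is @ drop (Suc p) is @ is!p # js) = - ((-1) ^ a * f (swp p a (is @ js)))"
proof -
  define P Q where "P = take p is" and "Q = take (a - Suc p) (drop (Suc p) is)"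
  have "drop (Suc p) is = Q @ [is!a]"
  proof -
    have "drop (a - Suc p) (drop (Suc p) is) = drop a is"
      using p by simp
    also have "\<dots> = [is!a]"
      using len by (simp add: Cons_nth_drop_Suc[symmetric])
    finally show ?thesis
      unfolding Q_def by (metis append_take_drop_id)
  qed
  then have is_eq: "is = P @ is!p # Q @ [is!a]"
    using p len id_take_nth_drop[of p "is"] by (simp add: P_def)
  have lens: "length P = p" "length Q = a - Suc p"
    using p len by (auto simp: P_def Q_def)
  then have sw: "swp p a (is @ js) = P @ is!a # Q @ is!p # js"
    using swp_far[of P Q "is!p" "is!a" js] is_eq p by (metis Suc_diff_Suc add_Suc_right append.assoc append_Cons append_Nil le_add_diff_inverse less_imp_le_nat)
  have "f (swp p a (is @ js)) = (-1) ^ length Q * f (P @ Q @ is!a # is!p # js)"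
    unfolding sw using alt lens p by (intro alt1_move) auto
  also have "P @ Q @ is!a # is!p # js = take p is @ drop (Suc p) is @ is!p # js"
    using \<open>drop (Suc p) is = Q @ [is!a]\<close> by (simp add: P_def)
  finally have sw': "f (swp p a (is @ js))
      = (-1) ^ (a - Suc p) * f (take p is @ drop (Suc p) is @ is!p # js)"
    by (simp add: lens)
  have sgn: "(-1 :: complex) ^ a = - ((-1) ^ (a - Suc p) * (-1) ^ p)"
  proof -
    have "a = Suc (a - Suc p + p)" using p by simp
    then show ?thesis by (metis power_Suc power_add mult_minus1)
  qed
  have "E * E = 1 \<Longrightarrow> P' * X = - (- (E * P') * (E * X))" for E P' X :: complex
    by (metis (no_types, opaque_lifting) minus_minus minus_mult_left mult.assoc mult.left_commute mult_1)
  moreover have "(-1 :: complex) ^ (a - Suc p) * (-1) ^ (a - Suc p) = 1"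
    by (simp flip: power_mult_distrib)
  ultimately show ?thesis
    unfolding sgn sw' by blast
qed

lemma pluckE_iff:
  assumes sup: "supp_in n k (a + b) f" and alt: "altE 0 a f"
  shows "pluckE a b f \<longleftrightarrow> (1 \<le> b \<longrightarrow> (\<forall>hs. plucker (a + b) a (f hs)))"
proof (cases "1 \<le> b")
  case True
  have eq: "(\<Sum>p\<le>a. (-1)^p * f hs (take p is @ drop (Suc p) is @ (is!p) # js))
      = (-1)^a * (f hs (is @ js) - (\<Sum>p<a. f hs (swp p a (is @ js))))"
    if "length is = Suc a" for hs "is" js
  proof -
    \<comment> \<open>The term \<open>p = a\<close> removes the last entry of \<open>is\<close> and
      puts it back in place, so it is \<open>f\<close> itself up to sign.\<close>
    have last: "take a is @ drop (Suc a) is @ is!a # js = is @ js"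
      using that arg_cong[OF id_take_nth_drop[of a "is"], of "\<lambda>xs. xs @ js"] by simp
    have "(\<Sum>p<a. (-1)^p * f hs (take p is @ drop (Suc p) is @ (is!p) # js))
        = (\<Sum>p<a. - ((-1) ^ a * f hs (swp p a (is @ js))))"
      using plucker_term[of a "f hs" "is"] alt that by (intro sum.cong) (auto simp: altE_iff)
    then show ?thesis
      by (simp only: lessThan_Suc_atMost[symmetric] sum.lessThan_Suc last)
        (simp add: sum_negf sum_distrib_left right_diff_distrib)
  qed
  have "pluckE a b f \<longleftrightarrow> (\<forall>hs is js. length is = Suc a \<longrightarrow> f hs (is @ js) = (\<Sum>p<a. f hs (swp p a (is @ js))))"
    using True unfolding pluckE_def by (auto simp: eq)
  also have "\<dots> \<longleftrightarrow> (\<forall>hs. plucker (a + b) a (f hs))"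
  proof
    assume *: "\<forall>hs is js. length is = Suc a \<longrightarrow> f hs (is @ js) = (\<Sum>p<a. f hs (swp p a (is @ js)))"
    show "\<forall>hs. plucker (a + b) a (f hs)"
      unfolding plucker_def
    proof (intro allI impI)
      fix hs xs assume "length (xs :: nat list) = a + b"
      then show "f hs xs = (\<Sum>p<a. f hs (swp p a xs))"
        using *[rule_format, of "take (Suc a) xs" hs "drop (Suc a) xs"] True by simp
    qed
  next
    assume *: "\<forall>hs. plucker (a + b) a (f hs)"
    show "\<forall>hs is js. length is = Suc a \<longrightarrow> f hs (is @ js) = (\<Sum>p<a. f hs (swp p a (is @ js)))"
    proof (intro allI impI)
      fix hs "is" js
      show "f hs (is @ js) = (\<Sum>p<a. f hs (swp p a (is @ js)))"
      proof (cases "length (is @ js) = a + b")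
        case True
        then show ?thesis using * unfolding plucker_def by blast
      next
        case False
        then have "f hs zs = 0" if "length zs = length (is @ js)" for zs
          using supported_zero[of "2*n" "a + b" "f hs"] sup that unfolding supp_in_iff by auto
        then show ?thesis by simp
      qed
    qed
  qed
  finally show ?thesis using True by simp
qed (simp add: pluckE_def)

lemma Wsummand_eq:
  assumes "r \<le> n"
  shows "Wsummand n r l d = tensor_space (sym_blocks r l) (prim_blocks n (n - r) d)"
proof -
  have "f \<in> Wsummand n r l d \<longleftrightarrow> f \<in> tensor_space (sym_blocks r l) (prim_blocks n (n - r) d)" for f
    using trlE_iff[of n "r + l" "n - r + d" f 0 "n - r"] trlE_iff[of n "r + l" "n - r + d" f "n - r" d]
    unfolding Wsummand_def tensor_space_def sym_blocks_def prim_blocks_def primE_def altE_iff symH_iff mem_Collect_eq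
    by (auto simp: supp_in_iff)
  then show ?thesis by blast
qed

lemma Vsp_eq: "Vsp n k a b = tensor_space (sym_blocks k 0) (top_blocks n a b)"
proof -
  have "f \<in> Vsp n k a b \<longleftrightarrow> f \<in> tensor_space (sym_blocks k 0) (top_blocks n a b)" for f
    using trlE_iff[of n k "a + b" f 0 a] trlE_iff[of n k "a + b" f a b]
      diagE_iff[of n k a b f] pluckE_iff[of n k a b f]
    unfolding Vsp_def tensor_space_def sym_blocks_def prim_blocks_def top_blocks_def primE_def altE_iff symH_iff mem_Collect_eq
    by (auto simp: supp_in_iff sym1_def)
  then show ?thesis by blast
qed

section \<open>Linear closure and invariance of the subspaces\<close>

definition lin_closed :: "(tens \<Rightarrow> bool) \<Rightarrow> bool" where
  "lin_closed P \<longleftrightarrow> P (\<lambda>xs. 0) \<and> (\<forall>f g. P f \<longrightarrow> P g \<longrightarrow> P (\<lambda>xs. f xs + g xs))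
     \<and> (\<forall>c f. P f \<longrightarrow> P (\<lambda>xs. c * f xs))"

lemma lin_closed_sum:
  "lin_closed P \<Longrightarrow> (\<And>i. i \<in> A \<Longrightarrow> P (f i)) \<Longrightarrow> P (\<lambda>xs. \<Sum>i\<in>A. c i * f i xs)"
  by (induction A rule: infinite_finite_induct) (simp_all add: lin_closed_def)

lemma contraction_add: "contraction n r s (\<lambda>xs. f xs + g xs) xs = contraction n r s f xs + contraction n r s g xs"
  by (simp add: contraction_def distrib_left sum.distrib)

lemma contraction_scale: "contraction n r s (\<lambda>xs. c * f xs) xs = c * contraction n r s f xs"
  by (simp add: contraction_def sum_distrib_left mult.left_commute)

lemma lin_closed_supported: "lin_closed (supported N m)"
  unfolding lin_closed_def supported_def by (auto, metis add.right_neutral)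

lemma lin_closed_alt1: "lin_closed (alt1 s m)"
  unfolding lin_closed_def alt1_def by auto

lemma lin_closed_sym1: "lin_closed (sym1 s m)"
  unfolding lin_closed_def sym1_def by auto

lemma lin_closed_traceless: "lin_closed (traceless n m r s)"
  unfolding lin_closed_def traceless_def by (simp add: contraction_add contraction_scale) (simp add: contraction_def)

lemma lin_closed_plucker: "lin_closed (plucker m a)"
  unfolding lin_closed_def plucker_def by (auto simp: sum.distrib sum_distrib_left)

lemma lin_closed_conj: "lin_closed P \<Longrightarrow> lin_closed Q \<Longrightarrow> lin_closed (\<lambda>f. P f \<and> Q f)"
  unfolding lin_closed_def by auto

lemma lin_closed_imp: "lin_closed P \<Longrightarrow> lin_closed (\<lambda>f. B \<longrightarrow> P f)"
  unfolding lin_closed_def by auto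

lemma lin_closed_sym_blocks: "lin_closed (sym_blocks r l)"
  unfolding sym_blocks_def[abs_def]
  by (intro lin_closed_conj lin_closed_supported lin_closed_sym1)

lemma lin_closed_prim_blocks: "lin_closed (prim_blocks n c d)"
  unfolding prim_blocks_def[abs_def]
  by (intro lin_closed_conj lin_closed_imp lin_closed_supported lin_closed_alt1 lin_closed_traceless)

lemma lin_closed_top_blocks: "lin_closed (top_blocks n a b)"
  unfolding top_blocks_def[abs_def]
  by (intro lin_closed_conj lin_closed_imp lin_closed_prim_blocks lin_closed_traceless lin_closed_plucker)

lemma sym_blocks_gact: "h \<in> cpt_sp 1 \<Longrightarrow> sym_blocks r l f \<Longrightarrow> sym_blocks r l (gact 2 h f)"
  using supported_gact[of h 1 "r + l" f] sym1_gact[of _ _ f 2 "r + l"] by (auto simp: sym_blocks_def)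

lemma traceless_gact:
  assumes "g \<in> cpt_sp n" "traceless n m r s f" "r < m" "s < m" "r \<noteq> s"
  shows "traceless n m r s (gact (2*n) g f)"
  unfolding traceless_def using assms by (auto intro!: contraction_gact simp: traceless_def length_idx)

lemma plucker_gact:
  assumes "plucker m a f" "a < m"
  shows "plucker m a (gact N g f)"
  unfolding plucker_def
proof (intro allI impI)
  fix xs :: "nat list" assume len: "length xs = m"
  have "gact N g f xs = gact N g (\<lambda>ys. \<Sum>p<a. f (swp p a ys)) xs"
    using assms(1) len unfolding gact_def plucker_def by (intro sum.cong) (auto simp: length_idx)
  also have "\<dots> = (\<Sum>p<a. gact N g f (swp p a xs))"
    using assms(2) len by (simp add: gact_sum gact_swp)
  finally show "gact N g f xs = (\<Sum>p<a. gact N g f (swp p a xs))" .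
qed

lemma prim_blocks_gact:
  assumes "g \<in> cpt_sp n" "prim_blocks n c d f"
  shows "prim_blocks n c d (gact (2*n) g f)"
  using assms unfolding prim_blocks_def
  by (auto intro!: supported_gact alt1_gact[where M = "c + d"] traceless_gact)

lemma top_blocks_gact:
  assumes "g \<in> cpt_sp n" "top_blocks n a b f"
  shows "top_blocks n a b (gact (2*n) g f)"
  using assms unfolding top_blocks_def
  by (auto intro!: prim_blocks_gact traceless_gact plucker_gact)

text \<open>For fixed \<open>hs\<close> the transformed tensor is a linear combination of the
  tensors \<open>gact (2*n) g (f hs')\<close>, and symmetrically for fixed \<open>es\<close>. So
  invariance can be checked in each factor alone.\<close>

lemma act_tensor_space:
  assumes PH: "lin_closed PH" "\<And>f. PH f \<Longrightarrow> PH (gact 2 h f)"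
    and PE: "lin_closed PE" "\<And>f. PE f \<Longrightarrow> PE (gact (2*n) g f)"
    and f: "f \<in> tensor_space PH PE"
  shows "act n h g f \<in> tensor_space PH PE"
proof -
  have "PE (act n h g f hs)" for hs
  proof -
    have "act n h g f hs = (\<lambda>es. \<Sum>hs'\<in>idx 2 (length hs). wprod h hs hs' * gact (2*n) g (f hs') es)"
      by (simp add: act_eq fun_eq_iff gact_def[of 2])
    moreover have "PE (gact (2*n) g (f hs'))" for hs'
      using f by (intro PE(2)) (simp add: tensor_space_def)
    ultimately show ?thesis
      by (simp add: lin_closed_sum[OF PE(1)])
  qed
  moreover have "PH (\<lambda>hs. act n h g f hs es)" for es
  proof -
    have "(\<lambda>hs. act n h g f hs es)
      = (\<lambda>hs. \<Sum>es'\<in>idx (2*n) (length es). wprod g es es' * gact 2 h (\<lambda>hs'. f hs' es') hs)"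
      by (simp add: act_eq' fun_eq_iff gact_def[of "2*n"])
    moreover have "PH (gact 2 h (\<lambda>hs'. f hs' es'))" for es'
      using f by (intro PH(2)) (simp add: tensor_space_def)
    ultimately show ?thesis
      by (simp add: lin_closed_sum[OF PH(1)])
  qed
  ultimately show ?thesis by (simp add: tensor_space_def)
qed

lemma tensor_space_add:
  assumes "lin_closed PH" "lin_closed PE" "f \<in> tensor_space PH PE" "g \<in> tensor_space PH PE"
  shows "(\<lambda>hs es. f hs es + g hs es) \<in> tensor_space PH PE"
  using assms unfolding tensor_space_def lin_closed_def by simp

lemma tensor_space_scale:
  assumes "lin_closed PH" "lin_closed PE" "f \<in> tensor_space PH PE"
  shows "(\<lambda>hs es. c * f hs es) \<in> tensor_space PH PE"
  using assms unfolding tensor_space_def lin_closed_def by simp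

lemma tensor_space_zero:
  "lin_closed PH \<Longrightarrow> lin_closed PE \<Longrightarrow> (\<lambda>hs es. 0) \<in> tensor_space PH PE"
  unfolding tensor_space_def lin_closed_def by simp

lemma act_Vsp:
  "h \<in> cpt_sp 1 \<Longrightarrow> g \<in> cpt_sp n \<Longrightarrow> f \<in> Vsp n k a b \<Longrightarrow> act n h g f \<in> Vsp n k a b"
  unfolding Vsp_eq by (intro act_tensor_space lin_closed_sym_blocks lin_closed_top_blocks sym_blocks_gact top_blocks_gact)

section \<open>Adjoints, orthogonal projections and insertion of the symplectic form\<close>

lemma sympl_zero: "2*n \<le> i \<or> 2*n \<le> j \<Longrightarrow> sympl n i j = 0"
  by (auto simp: sympl_def)

lemma cnj_sympl: "cnj (sympl n i j) = sympl n i j"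
  by (simp add: sympl_def)

definition adj :: "cmat \<Rightarrow> cmat" where
  "adj g i j = cnj (g j i)"

text \<open>The definition of \<open>cpt_sp\<close> says that the adjoint is a left inverse; for
  square matrices it is then also a right inverse.\<close>

lemma cpt_sp_right_inverse:
  assumes g: "g \<in> cpt_sp n" and ij: "i < 2*n" "j < 2*n"
  shows "(\<Sum>p<2*n. g i p * cnj (g j p)) = (if i = j then 1 else 0)"
proof -
  define A where "A = mat (2*n) (2*n) (\<lambda>(i, j). g i j)"
  define B where "B = mat (2*n) (2*n) (\<lambda>(i, j). cnj (g j i))"
  have carr: "A \<in> carrier_mat (2*n) (2*n)" "B \<in> carrier_mat (2*n) (2*n)"
    by (simp_all add: A_def B_def)
  have "B * A = 1\<^sub>m (2*n)"
  proof (rule eq_matI)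
    fix i j assume "i < dim_row (1\<^sub>m (2*n))" "j < dim_col (1\<^sub>m (2*n))"
    then have ij: "i < 2*n" "j < 2*n" by simp_all
    then have "(B * A) $$ (i, j) = (\<Sum>p<2*n. cnj (g p i) * g p j)"
      by (simp add: A_def B_def scalar_prod_def atLeast0LessThan)
    also have "\<dots> = (if i = j then 1 else 0)"
      using g ij unfolding cpt_sp_def by blast
    finally show "(B * A) $$ (i, j) = 1\<^sub>m (2*n) $$ (i, j)"
      using ij by simp
  qed (simp_all add: A_def B_def)
  then have "A * B = 1\<^sub>m (2*n)"
    using mat_mult_left_right_inverse carr by blast
  then have "(A * B) $$ (i, j) = (if i = j then 1 else 0)"
    using ij by simp
  moreover have "(A * B) $$ (i, j) = (\<Sum>p<2*n. g i p * cnj (g j p))"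
    using ij by (simp add: A_def B_def scalar_prod_def atLeast0LessThan)
  ultimately show ?thesis by simp
qed

text \<open>Replace the form in the middle by its pullback under \<open>g\<close>, which is the form
  itself; then \<open>g\<close> cancels against its adjoint on both sides by
  \<open>cpt_sp_right_inverse\<close>.\<close>

lemma cpt_sp_adj_sympl:
  assumes g: "g \<in> cpt_sp n" and ij: "i < 2*n" "j < 2*n"
  shows "(\<Sum>p<2*n. \<Sum>q<2*n. cnj (g i p) * sympl n p q * cnj (g j q)) = sympl n i j"
proof -
  let ?I = "{..<2*n}"
  have "(\<Sum>p\<in>?I. \<Sum>q\<in>?I. cnj (g i p) * sympl n p q * cnj (g j q))
    = (\<Sum>p\<in>?I. \<Sum>q\<in>?I. cnj (g i p) * (\<Sum>s\<in>?I. \<Sum>t\<in>?I. g s p * sympl n s t * g t q) * cnj (g j q))"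
    using g unfolding cpt_sp_def by (intro sum.cong refl) auto
  also have "\<dots> = (\<Sum>p\<in>?I. \<Sum>q\<in>?I. \<Sum>s\<in>?I. \<Sum>t\<in>?I. sympl n s t * ((g s p * cnj (g i p)) * (g t q * cnj (g j q))))"
    by (simp add: sum_distrib_left sum_distrib_right mult_ac)
  also have "\<dots> = (\<Sum>s\<in>?I. \<Sum>p\<in>?I. \<Sum>t\<in>?I. \<Sum>q\<in>?I. sympl n s t * ((g s p * cnj (g i p)) * (g t q * cnj (g j q))))"
    by (subst sum.swap, subst (3) sum.swap, subst (2) sum.swap) (rule refl)
  also have "\<dots> = (\<Sum>s\<in>?I. \<Sum>t\<in>?I. \<Sum>p\<in>?I. \<Sum>q\<in>?I. sympl n s t * ((g s p * cnj (g i p)) * (g t q * cnj (g j q))))"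
    by (subst (2) sum.swap) (rule refl)
  also have "\<dots> = (\<Sum>s\<in>?I. \<Sum>t\<in>?I. sympl n s t * ((\<Sum>p\<in>?I. g s p * cnj (g i p)) * (\<Sum>q\<in>?I. g t q * cnj (g j q))))"
    unfolding sum_product by (simp only: sum_distrib_left)
  also have "\<dots> = (\<Sum>s\<in>?I. \<Sum>t\<in>?I. sympl n s t * ((if s = i then 1 else 0) * (if t = j then 1 else 0)))"
    using ij by (intro sum.cong refl) (simp add: cpt_sp_right_inverse[OF g])
  also have "\<dots> = (\<Sum>s\<in>?I. if s = i then sympl n s j else 0)"
    using ij by (intro sum.cong refl) (simp add: if_distrib cong: if_cong)
  also have "\<dots> = sympl n i j"
    using ij by simp
  finally show ?thesis .
qed

lemma adj_cpt_sp:
  assumes "g \<in> cpt_sp n"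
  shows "adj g \<in> cpt_sp n"
  unfolding cpt_sp_def adj_def
  using assms cpt_sp_adj_sympl[OF assms] cpt_sp_right_inverse[OF assms]
  by (auto simp: cpt_sp_def) 

text \<open>Invariance of the symplectic form as an element of \<open>E \<otimes> E\<close> rather
  than as a bilinear form on \<open>E\<close>. This is what makes inserting it an equivariant
  operation.\<close>

lemma cpt_sp_sympl_right:
  assumes "g \<in> cpt_sp n"
  shows "(\<Sum>p<2*n. \<Sum>q<2*n. g i p * g j q * sympl n p q) = sympl n i j"
proof (cases "i < 2*n \<and> j < 2*n")
  case True
  then have "cnj (\<Sum>p<2*n. \<Sum>q<2*n. cnj (g i p) * sympl n p q * cnj (g j q)) = cnj (sympl n i j)"
    using cpt_sp_adj_sympl[OF assms] by simp
  then show ?thesis by (simp add: cnj_sympl mult_ac)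
next
  case False
  then have "2*n \<le> i \<or> 2*n \<le> j" by auto
  then show ?thesis
    using cpt_sp_zero[OF assms] by (auto simp: sympl_zero)
qed

lemma wprod_adj: "length xs = length ys \<Longrightarrow> cnj (wprod (adj g) ys xs) = wprod g xs ys"
  by (simp add: wprod_def adj_def)

text \<open>Since the adjoint of a group element is again in the group, this makes the orthogonal
  projection onto an invariant subspace equivariant.\<close>

lemma act_adjoint:
  "(\<Sum>hs\<in>idx 2 p. \<Sum>es\<in>idx (2*n) q. act n h g f hs es * cnj (x hs es))
   = (\<Sum>hs\<in>idx 2 p. \<Sum>es\<in>idx (2*n) q. f hs es * cnj (act n (adj h) (adj g) x hs es))"
proof -
  let ?K = "\<lambda>hs hs' es es'. wprod h hs hs' * wprod g es es' * f hs' es' * cnj (x hs es)"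
  have "(\<Sum>hs\<in>idx 2 p. \<Sum>es\<in>idx (2*n) q. act n h g f hs es * cnj (x hs es))
     = (\<Sum>hs\<in>idx 2 p. \<Sum>es\<in>idx (2*n) q. \<Sum>hs'\<in>idx 2 p. \<Sum>es'\<in>idx (2*n) q. ?K hs hs' es es')"
    by (intro sum.cong refl)
      (simp add: act_eq gact_def length_idx sum_distrib_left sum_distrib_right mult_ac)
  also have "\<dots> = (\<Sum>hs\<in>idx 2 p. \<Sum>hs'\<in>idx 2 p. \<Sum>es\<in>idx (2*n) q. \<Sum>es'\<in>idx (2*n) q. ?K hs hs' es es')"
    by (subst (2) sum.swap) (rule refl)
  also have "\<dots> = (\<Sum>hs'\<in>idx 2 p. \<Sum>hs\<in>idx 2 p. \<Sum>es'\<in>idx (2*n) q. \<Sum>es\<in>idx (2*n) q. ?K hs hs' es es')"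
    by (subst sum.swap, subst (3) sum.swap) (rule refl)
  also have "\<dots> = (\<Sum>hs'\<in>idx 2 p. \<Sum>es'\<in>idx (2*n) q. \<Sum>hs\<in>idx 2 p. \<Sum>es\<in>idx (2*n) q. ?K hs hs' es es')"
    by (subst (2) sum.swap) (rule refl)
  also have "\<dots> = (\<Sum>hs'\<in>idx 2 p. \<Sum>es'\<in>idx (2*n) q. f hs' es' * cnj (act n (adj h) (adj g) x hs' es'))"
    by (intro sum.cong refl)
      (simp add: act_eq gact_def length_idx sum_distrib_left sum_distrib_right mult_ac wprod_adj)
  finally show ?thesis .
qed

text \<open>Induction on the coordinates. The vectors of \<open>W\<close> that vanish at the new
  coordinate form \<open>W0\<close>, of codimension at most one. If \<open>W\<close> is larger, take
  \<open>u\<close> in \<open>W\<close> outside \<open>W0\<close> and subtract its projection onto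
  \<open>W0\<close>: the result \<open>v\<close> spans the orthogonal complement of
  \<open>W0\<close> in \<open>W\<close>. The projection onto \<open>W\<close> is the one onto
  \<open>W0\<close> plus the component along \<open>v\<close>.\<close>

lemma projection_exists:
  fixes W :: "('a \<Rightarrow> complex) set"
  assumes "finite S"
    and "(\<lambda>s. 0) \<in> W"
    and "\<And>u v. u \<in> W \<Longrightarrow> v \<in> W \<Longrightarrow> (\<lambda>s. u s + v s) \<in> W"
    and "\<And>c u. u \<in> W \<Longrightarrow> (\<lambda>s. c * u s) \<in> W"
    and "\<And>u s. u \<in> W \<Longrightarrow> s \<notin> S \<Longrightarrow> u s = 0"
  shows "\<exists>w\<in>W. \<forall>x\<in>W. (\<Sum>s\<in>S. (f s - w s) * cnj (x s)) = 0"
  using assms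
proof (induction S arbitrary: W f rule: finite_induct)
  case empty
  then show ?case by auto
next
  case (insert s S)
  define W0 where "W0 = {w\<in>W. w s = 0}"
  have IH: "\<exists>w\<in>W0. \<forall>x\<in>W0. (\<Sum>t\<in>insert s S. (f t - w t) * cnj (x t)) = 0" for f
  proof -
    have "\<exists>w\<in>W0. \<forall>x\<in>W0. (\<Sum>t\<in>S. (f t - w t) * cnj (x t)) = 0"
    proof (rule insert.IH)
      show "u t = 0" if "u \<in> W0" "t \<notin> S" for u t
        using that insert.prems(4)[of u t] by (cases "t = s") (auto simp: W0_def)
    qed (use insert.prems in \<open>auto simp: W0_def\<close>)
    then show ?thesis
      using insert.hyps by (auto simp: W0_def)
  qed
  show ?case
  proof (cases "W = W0")
    case True
    then show ?thesis using IH by blast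
  next
    case False
    then obtain u where u: "u \<in> W" "u s \<noteq> 0" by (auto simp: W0_def)
    let ?S = "insert s S"
    define ip where "ip = (\<lambda>(p :: 'a \<Rightarrow> complex) q. \<Sum>t\<in>?S. p t * cnj (q t))"
    have ip_diff: "ip (\<lambda>t. p t - q t) x = ip p x - ip q x" for p q x
      by (simp add: ip_def left_diff_distrib sum_subtractf)
    have ip_scale: "ip (\<lambda>t. c * p t) x = c * ip p x" for c p x
      by (simp add: ip_def sum_distrib_left mult.assoc)
    have ip_add_right: "ip p (\<lambda>t. x t + c * y t) = ip p x + cnj c * ip p y" for p x y c
      by (simp add: ip_def distrib_left sum.distrib sum_distrib_left mult_ac)
    have ip_cnj: "ip p q = cnj (ip q p)" for p q
      by (simp add: ip_def mult.commute)
    have diff: "(\<lambda>t. p t - c * q t) \<in> W" if "p \<in> W" "q \<in> W" for p q c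
      using insert.prems(2)[OF that(1) insert.prems(3)[OF that(2), of "-c"]] by simp
    obtain p where p: "p \<in> W0" "\<And>x. x \<in> W0 \<Longrightarrow> ip (\<lambda>t. u t - p t) x = 0"
      using IH[of u] unfolding ip_def by blast
    define v where "v t = u t - p t" for t
    have v: "v \<in> W" "v s \<noteq> 0"
      using diff[of u p 1] u p(1) by (auto simp: v_def[abs_def] W0_def)
    have v0: "ip v x = 0" if "x \<in> W0" for x
      using p(2)[OF that] by (simp add: v_def[abs_def])
    have "ip v v \<noteq> 0"
    proof
      assume "ip v v = 0"
      then have "(\<Sum>t\<in>?S. (cmod (v t))\<^sup>2) = 0"
        unfolding ip_def complex_norm_square[symmetric]
        by (metis (mono_tags, lifting) of_real_eq_0_iff of_real_sum sum.cong of_real_power)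
      then have "(cmod (v s))\<^sup>2 = 0"
        using insert.hyps by (subst (asm) sum_nonneg_eq_0_iff) auto
      with v(2) show False by simp
    qed
    obtain q where q: "q \<in> W0" "\<And>x. x \<in> W0 \<Longrightarrow> ip (\<lambda>t. f t - q t) x = 0"
      using IH[of f] unfolding ip_def by blast
    define \<alpha> where "\<alpha> = ip f v / ip v v"
    define w where "w t = q t + \<alpha> * v t" for t
    have w: "w \<in> W"
      unfolding w_def[abs_def] using insert.prems(2,3) v(1) q(1) by (auto simp: W0_def)
    have fw: "ip (\<lambda>t. f t - w t) y = ip (\<lambda>t. f t - q t) y - \<alpha> * ip v y" for y
      using ip_diff[of "\<lambda>t. f t - q t" "\<lambda>t. \<alpha> * v t" y] ip_scale[of \<alpha> v y]
      by (simp add: w_def[abs_def] algebra_simps)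
    have "ip (\<lambda>t. f t - w t) x = 0" if x: "x \<in> W" for x
    proof -
      define \<beta> where "\<beta> = x s / v s"
      define x0 where "x0 t = x t - \<beta> * v t" for t
      have x0: "x0 \<in> W0"
        using diff[OF x v(1), of \<beta>] v(2) by (simp add: W0_def flip: x0_def) (simp add: x0_def \<beta>_def)
      have "ip (\<lambda>t. f t - w t) v = ip f v - ip q v - \<alpha> * ip v v"
        by (simp add: fw ip_diff)
      also have "ip q v = 0"
        using v0[OF q(1)] ip_cnj[of q v] by simp
      finally have fv: "ip (\<lambda>t. f t - w t) v = 0"
        using \<open>ip v v \<noteq> 0\<close> by (simp add: \<alpha>_def)
      have "ip (\<lambda>t. f t - w t) x = ip (\<lambda>t. f t - w t) (\<lambda>t. x0 t + \<beta> * v t)"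
        by (simp add: x0_def)
      also have "\<dots> = 0"
        using fv q(2)[OF x0] v0[OF x0] by (simp add: ip_add_right fw)
      finally show ?thesis .
    qed
    then show ?thesis using w unfolding ip_def by blast
  qed
qed

definition tensor_ip :: "nat \<Rightarrow> nat \<Rightarrow> nat \<Rightarrow> tensor \<Rightarrow> tensor \<Rightarrow> complex" where
  "tensor_ip n p q f x = (\<Sum>hs\<in>idx 2 p. \<Sum>es\<in>idx (2*n) q. f hs es * cnj (x hs es))"

lemma tensor_ip_diff: "tensor_ip n p q (\<lambda>hs es. f hs es - g hs es) x = tensor_ip n p q f x - tensor_ip n p q g x"
  by (simp add: tensor_ip_def left_diff_distrib sum_subtractf)

lemma tensor_ip_add: "tensor_ip n p q (\<lambda>hs es. f hs es + g hs es) x = tensor_ip n p q f x + tensor_ip n p q g x"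
  by (simp add: tensor_ip_def distrib_right sum.distrib)

lemma tensor_ip_scale: "tensor_ip n p q (\<lambda>hs es. c * f hs es) x = c * tensor_ip n p q f x"
  by (simp add: tensor_ip_def sum_distrib_left mult.assoc)

lemma tensor_ip_self_zero:
  assumes "supp_in n p q f" "tensor_ip n p q f f = 0"
  shows "f = (\<lambda>hs es. 0)"
proof (intro ext, rule ccontr)
  fix hs es assume nz: "f hs es \<noteq> 0"
  then have mem: "hs \<in> idx 2 p" "es \<in> idx (2*n) q"
    using assms(1) unfolding supp_in_def by blast+
  have "complex_of_real (\<Sum>hs\<in>idx 2 p. \<Sum>es\<in>idx (2*n) q. (cmod (f hs es))\<^sup>2) = 0"
    using assms(2) unfolding tensor_ip_def complex_norm_square[symmetric] by simp
  then have "(\<Sum>hs\<in>idx 2 p. \<Sum>es\<in>idx (2*n) q. (cmod (f hs es))\<^sup>2) = 0"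
    by (simp only: of_real_eq_0_iff)
  then have "(\<Sum>es\<in>idx (2*n) q. (cmod (f hs es))\<^sup>2) = 0"
    using mem(1) by (subst (asm) sum_nonneg_eq_0_iff) (auto intro: sum_nonneg)
  then have "(cmod (f hs es))\<^sup>2 = 0"
    using mem(2) by (subst (asm) sum_nonneg_eq_0_iff) auto
  with nz show False by simp
qed

lemma tensor_projection_exists:
  fixes W :: "tensor set"
  assumes zero: "(\<lambda>hs es. 0) \<in> W"
    and add: "\<And>u v. u \<in> W \<Longrightarrow> v \<in> W \<Longrightarrow> (\<lambda>hs es. u hs es + v hs es) \<in> W"
    and scale: "\<And>c u. u \<in> W \<Longrightarrow> (\<lambda>hs es. c * u hs es) \<in> W"
    and sup: "\<And>u. u \<in> W \<Longrightarrow> supp_in n p q u"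
  shows "\<exists>w\<in>W. \<forall>x\<in>W. tensor_ip n p q (\<lambda>hs es. f hs es - w hs es) x = 0"
proof -
  let ?S = "idx 2 p \<times> idx (2*n) q"
  let ?W = "{u. curry u \<in> W}"
  have "\<exists>w\<in>?W. \<forall>x\<in>?W. (\<Sum>s\<in>?S. (case_prod f s - w s) * cnj (x s)) = 0"
  proof (rule projection_exists)
    show "finite ?S" by simp
    show "(\<lambda>s. 0) \<in> ?W" using zero by (simp add: curry_def)
    show "(\<lambda>s. u s + v s) \<in> ?W" if "u \<in> ?W" "v \<in> ?W" for u v
      using add[of "curry u" "curry v"] that by (simp add: curry_def)
    show "(\<lambda>s. c * u s) \<in> ?W" if "u \<in> ?W" for c u
      using scale[of "curry u" c] that by (simp add: curry_def)
    show "u s = 0" if "u \<in> ?W" "s \<notin> ?S" for u s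
      using sup[of "curry u"] that unfolding supp_in_def by (cases s) (auto simp: curry_def)
  qed
  then obtain w where w: "curry w \<in> W" "\<And>x. x \<in> ?W \<Longrightarrow> (\<Sum>s\<in>?S. (case_prod f s - w s) * cnj (x s)) = 0"
    by blast
  have "tensor_ip n p q (\<lambda>hs es. f hs es - curry w hs es) x = 0" if "x \<in> W" for x
  proof -
    have "(\<Sum>s\<in>?S. (case_prod f s - w s) * cnj (case_prod x s)) = 0"
      using w(2)[of "case_prod x"] that by simp
    then show ?thesis
      by (simp add: tensor_ip_def sum.cartesian_product case_prod_unfold)
  qed
  then show ?thesis using w(1) by blast
qed

section \<open>Inserting copies of the symplectic form\<close>

fun pairs :: "nat \<Rightarrow> nat list \<Rightarrow> complex" where
  "pairs n [] = 1"
| "pairs n [x] = 0"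
| "pairs n (x # y # xs) = sympl n x y * pairs n xs"

lemma gact_pairs:
  assumes "g \<in> cpt_sp n" "length xs = 2*j"
  shows "gact (2*n) g (pairs n) xs = pairs n xs"
  using assms(2)
proof (induction j arbitrary: xs)
  case 0
  then show ?case by (simp add: gact_def)
next
  case (Suc j)
  then obtain x y zs where xs: "xs = x # y # zs" "length zs = 2*j"
    by (cases xs; cases "tl xs") auto
  have "gact (2*n) g (pairs n) xs = (\<Sum>p<2*n. \<Sum>q<2*n. g x p * g y q * sympl n p q * gact (2*n) g (pairs n) zs)"
    by (simp add: xs gact_Cons gact_scale sum_distrib_left mult.assoc)
  also have "\<dots> = sympl n x y * pairs n zs"
    using Suc.IH[OF xs(2)] cpt_sp_sympl_right[OF assms(1), of x y]
    by (simp flip: sum_distrib_right)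
  finally show ?case by (simp add: xs)
qed

text \<open>The transpose of the contraction: the blocks of a list \<open>I\<^sub>1 @ I\<^sub>2 @ J\<^sub>1 @ J\<^sub>2 @ J\<^sub>3\<close> of lengths
  \<open>p, j, b, i, j\<close> are rearranged to \<open>I\<^sub>1 @ J\<^sub>2 @ J\<^sub>1\<close> for the argument, and \<open>I\<^sub>2\<close> is paired with \<open>J\<^sub>3\<close>.\<close>

definition slots_arg :: "nat \<Rightarrow> nat \<Rightarrow> nat \<Rightarrow> nat \<Rightarrow> nat list" where
  "slots_arg p j b i = [0..<p] @ [p+j+b..<p+j+b+i] @ [p+j..<p+j+b]"

definition slots_pair :: "nat \<Rightarrow> nat \<Rightarrow> nat \<Rightarrow> nat \<Rightarrow> nat list" where
  "slots_pair p j b i = concat (map (\<lambda>s. [p + s, p+j+b+i + s]) [0..<j])"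

definition embed1 :: "nat \<Rightarrow> nat \<Rightarrow> nat \<Rightarrow> nat \<Rightarrow> nat \<Rightarrow> tens \<Rightarrow> tens" where
  "embed1 n p j b i f xs = f (map ((!) xs) (slots_arg p j b i)) * pairs n (map ((!) xs) (slots_pair p j b i))"

lemma length_slots_pair: "length (slots_pair p j b i) = 2*j"
  unfolding slots_pair_def by (simp add: length_concat comp_def sum_list_triv)

lemma set_ord: "set (slots_arg p j b i @ slots_pair p j b i) = {..<p+j+b+i+j}"
proof -
  have "x \<in> set (slots_arg p j b i @ slots_pair p j b i)" if "x < p+j+b+i+j" for x
  proof -
    consider "x < p" | "p \<le> x" "x < p+j" | "p+j \<le> x" "x < p+j+b" | "p+j+b \<le> x" "x < p+j+b+i"
      | "p+j+b+i \<le> x" by linarith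
    then show ?thesis
    proof cases
      case 2
      then have "x = p + (x - p)" "x - p < j" by auto
      then show ?thesis unfolding slots_pair_def by fastforce
    next
      case 5
      then have "x = p+j+b+i + (x - (p+j+b+i))" "x - (p+j+b+i) < j" using that by auto
      then show ?thesis unfolding slots_pair_def by fastforce
    qed (auto simp: slots_arg_def)
  qed
  moreover have "x < p+j+b+i+j" if "x \<in> set (slots_arg p j b i @ slots_pair p j b i)" for x
    using that by (auto simp: slots_arg_def slots_pair_def)
  ultimately show ?thesis by blast
qed

lemma distinct_ord: "distinct (slots_arg p j b i @ slots_pair p j b i)"
  by (rule card_distinct) (simp only: set_ord, simp add: length_slots_pair slots_arg_def)

text \<open>After a permutation of the slots the tensor is \<open>f\<close> times a tensor power of
  the symplectic form, and the second factor is fixed by \<open>g\<close>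
  (\<open>gact_pairs\<close>).\<close>

lemma embed1_gact:
  assumes g: "g \<in> cpt_sp n" and len: "length xs = p+j+b+i+j"
  shows "gact (2*n) g (embed1 n p j b i f) xs = embed1 n p j b i (gact (2*n) g f) xs"
proof -
  let ?m = "length (slots_arg p j b i)"
  let ?F = "\<lambda>ys. f (take ?m ys) * pairs n (drop ?m ys)"
  let ?zs = "map ((!) xs) (slots_arg p j b i)" and ?ws = "map ((!) xs) (slots_pair p j b i)"
  have "gact (2*n) g (embed1 n p j b i f) xs = gact (2*n) g (\<lambda>ys. ?F (map ((!) ys) (slots_arg p j b i @ slots_pair p j b i))) xs"
    by (simp add: embed1_def[abs_def])
  also have "\<dots> = gact (2*n) g ?F (?zs @ ?ws)"
    using gact_rearrange[OF distinct_ord[of p j b i], where xs = xs and f = ?F and N = "2*n" and g = g]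
      set_ord[of p j b i] len by simp
  also have "\<dots> = (\<Sum>zs\<in>idx (2*n) ?m. wprod g ?zs zs * (f zs * gact (2*n) g (pairs n) ?ws))"
    unfolding gact_append unfolding gact_def[of _ _ _ ?zs]
    by (intro sum.cong) (auto simp: length_idx gact_scale)
  also have "gact (2*n) g (pairs n) ?ws = pairs n ?ws"
    by (rule gact_pairs[OF g]) (simp add: length_slots_pair)
  finally show ?thesis
    by (simp add: embed1_def gact_def sum_distrib_left mult_ac)
qed

lemma pairs_interleave:
  "pairs n (concat (map (\<lambda>s. [A s, B s]) [0..<j])) = (\<Prod>s<j. sympl n (A s) (B s))"
proof (induction j arbitrary: A B)
  case (Suc j)
  have "[0..<Suc j] = 0 # map Suc [0..<j]"
    by (simp add: map_Suc_upt upt_conv_Cons)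
  then have "concat (map (\<lambda>s. [A s, B s]) [0..<Suc j]) = A 0 # B 0 # concat (map (\<lambda>s. [A (Suc s), B (Suc s)]) [0..<j])"
    by (simp add: comp_def)
  then show ?case using Suc.IH[of "A \<circ> Suc" "B \<circ> Suc"]
    by (simp del: upt_Suc prod.lessThan_Suc add: prod.lessThan_Suc_shift comp_def)
qed simp

lemma map_nth_upt_append:
  "length A = p \<Longrightarrow> length B = q \<Longrightarrow> map ((!) (A @ B @ C)) [p..<p+q] = B"
  by (rule nth_equalityI) (auto simp: nth_append)

lemma embed1_blocks:
  assumes "length I1 = p" "length I2 = j" "length J1 = b" "length J2 = i" "length J3 = j"
  shows "embed1 n p j b i f (I1 @ I2 @ J1 @ J2 @ J3) = f (I1 @ J2 @ J1) * (\<Prod>s<j. sympl n (I2!s) (J3!s))"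
proof -
  let ?xs = "I1 @ I2 @ J1 @ J2 @ J3"
  have "map ((!) ?xs) [0..<p] = I1"
    using map_nth_upt_append[of "[]" 0 I1 p "I2 @ J1 @ J2 @ J3"] assms by simp
  moreover have "map ((!) ?xs) [p+j+b..<p+j+b+i] = J2"
    using map_nth_upt_append[of "I1 @ I2 @ J1" "p+j+b" J2 i J3] assms by simp
  moreover have "map ((!) ?xs) [p+j..<p+j+b] = J1"
    using map_nth_upt_append[of "I1 @ I2" "p+j" J1 b "J2 @ J3"] assms by simp
  moreover have "pairs n (map ((!) ?xs) (slots_pair p j b i)) = (\<Prod>s<j. sympl n (I2!s) (J3!s))"
    using assms unfolding slots_pair_def
    by (simp add: map_concat comp_def pairs_interleave[of n "\<lambda>s. ?xs!(p+s)" "\<lambda>s. ?xs!(p+j+b+i+s)"])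
      (intro prod.cong refl, simp add: nth_append)
  ultimately show ?thesis by (simp add: embed1_def slots_arg_def)
qed

lemma obtain_blocks:
  assumes "length xs = p+j+b+i+j'"
  obtains I1 I2 J1 J2 J3 where "xs = I1 @ I2 @ J1 @ J2 @ J3" "length I1 = p" "length I2 = j"
    "length J1 = b" "length J2 = i" "length J3 = j'"
proof
  show "xs = take p xs @ take j (drop p xs) @ take b (drop (p+j) xs) @ take i (drop (p+j+b) xs) @ drop (p+j+b+i) xs"
    by (metis append_take_drop_id drop_drop add.commute)
qed (use assms in auto)

text \<open>The parameters split the degrees as \<open>a = p + i\<close>, \<open>c = p + j\<close>,
  \<open>d = b + i + j\<close> and \<open>k = x + y\<close>, \<open>r = x + j'\<close>,
  \<open>l = y + j'\<close>. Of the \<open>a\<close> slots \<open>p\<close> stay in the first block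
  and \<open>i\<close> move to the second, while \<open>j\<close> copies of the form connect the two
  blocks; in the H-part \<open>x\<close>, \<open>y\<close> and \<open>j'\<close> play these
  roles.\<close>

definition embed_tensor :: "nat \<Rightarrow> nat \<Rightarrow> nat \<Rightarrow> nat \<Rightarrow> nat \<Rightarrow> nat \<Rightarrow> nat \<Rightarrow> nat \<Rightarrow> tensor \<Rightarrow> tensor" where
  "embed_tensor n x j' y p j b i v hs es = embed1 1 x j' 0 y (\<lambda>hs'. embed1 n p j b i (v hs') es) hs"

lemma embed_tensor_act:
  assumes h: "h \<in> cpt_sp 1" and g: "g \<in> cpt_sp n"
    and len: "length hs = x+j'+y+j'" "length es = p+j+b+i+j"
  shows "act n h g (embed_tensor n x j' y p j b i v) hs es = embed_tensor n x j' y p j b i (act n h g v) hs es"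
proof -
  have *: "gact (2*n) g (embed_tensor n x j' y p j b i v hs') es = embed1 1 x j' 0 y (\<lambda>hs'. embed1 n p j b i (gact (2*n) g (v hs')) es) hs'" for hs'
  proof -
    have "embed_tensor n x j' y p j b i v hs'
      = (\<lambda>es'. pairs 1 (map ((!) hs') (slots_pair x j' 0 y)) * embed1 n p j b i (v (map ((!) hs') (slots_arg x j' 0 y))) es')"
      by (simp add: embed_tensor_def embed1_def[of "Suc 0"] fun_eq_iff)
    then show ?thesis
      using embed1_gact[OF g len(2)] by (simp add: gact_scale) (simp add: embed1_def[of "Suc 0"])
  qed
  have "act n h g (embed_tensor n x j' y p j b i v) hs es
      = gact (2*1) h (embed1 1 x j' 0 y (\<lambda>hs'. embed1 n p j b i (gact (2*n) g (v hs')) es)) hs"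
    by (simp add: act_eq *)
  also have "\<dots> = embed1 1 x j' 0 y (gact (2*1) h (\<lambda>hs'. embed1 n p j b i (gact (2*n) g (v hs')) es)) hs"
    by (rule embed1_gact[OF h]) (use len in simp)
  also have "gact (2*1) h (\<lambda>hs'. embed1 n p j b i (gact (2*n) g (v hs')) es) = (\<lambda>hs. embed1 n p j b i (act n h g v hs) es)"
    by (rule ext, simp add: embed1_def mult.commute[of _ "pairs _ _"] gact_scale)
      (simp add: act_eq)
  finally show ?thesis unfolding embed_tensor_def[of n x j' y p j b i "act n h g v"] .
qed

section \<open>Test vectors and existence of homomorphisms\<close>

definition osgn :: "nat \<Rightarrow> nat \<Rightarrow> complex" where
  "osgn x y = (if x < y then 1 else if x = y then 0 else -1)"

text \<open>The sign of the permutation that sorts the list, and \<open>0\<close> if an entry is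
  repeated. As a product over pairs of positions it is multiplicative under concatenation up to
  \<open>cross_sgn\<close>.\<close>

fun list_sgn :: "nat list \<Rightarrow> complex" where
  "list_sgn [] = 1"
| "list_sgn (x # xs) = prod_list (map (osgn x) xs) * list_sgn xs"

definition cross_sgn :: "nat list \<Rightarrow> nat list \<Rightarrow> complex" where
  "cross_sgn A B = prod_list (map (\<lambda>y. prod_list (map (\<lambda>x. osgn x y) A)) B)"

lemma osgn_swap: "osgn y x = - osgn x y"
  by (simp add: osgn_def)

lemma cross_sgn_Nil [simp]: "cross_sgn [] B = 1"
  by (induction B) (simp_all add: cross_sgn_def)

lemma cross_sgn_Cons_left: "cross_sgn (x # A) B = prod_list (map (osgn x) B) * cross_sgn A B"
  by (induction B) (simp_all add: cross_sgn_def mult_ac)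

lemma list_sgn_append: "list_sgn (A @ B) = list_sgn A * list_sgn B * cross_sgn A B"
  by (induction A) (simp_all add: cross_sgn_Cons_left mult_ac)

lemma prod_list_osgn_swap:
  "prod_list (map (\<lambda>z. osgn z y) B) = (-1) ^ length B * prod_list (map (osgn y) B)"
  by (induction B) (simp_all add: osgn_swap[of _ y])

text \<open>Only the pair formed by \<open>x\<close> and \<open>y\<close> changes its sign. For the
  letters of \<open>B\<close> both orders produce the same factor \<open>(-1) ^ length B\<close>,
  and \<open>A\<close> and \<open>C\<close> meet the same letters before and after.\<close>

lemma list_sgn_exchange: "list_sgn (A @ y # B @ x # C) = - list_sgn (A @ x # B @ y # C)"
proof -
  have "cross_sgn A (y # B @ x # C) = cross_sgn A (x # B @ y # C)"
    by (simp add: cross_sgn_def mult_ac)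
  moreover have "list_sgn (y # B @ x # C) = - list_sgn (x # B @ y # C)"
    by (simp add: list_sgn_append cross_sgn_def prod_list_osgn_swap osgn_swap[of y x] mult_ac)
  ultimately show ?thesis by (simp add: list_sgn_append)
qed

lemma list_sgn_swp:
  assumes "i < j" "j < length xs"
  shows "list_sgn (swp i j xs) = - list_sgn xs"
proof -
  define A B C where "A = take i xs" and "B = take (j - Suc i) (drop (Suc i) xs)" and "C = drop (Suc j) xs"
  have "drop (Suc i) xs = B @ xs!j # C"
  proof -
    have "drop (j - Suc i) (drop (Suc i) xs) = drop j xs"
      using assms by simp
    also have "\<dots> = xs!j # C"
      using assms by (simp add: C_def Cons_nth_drop_Suc)
    finally show ?thesis unfolding B_def by (metis append_take_drop_id)
  qed
  then have xs: "xs = A @ xs!i # B @ xs!j # C"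
    using assms id_take_nth_drop[of i xs] by (simp add: A_def)
  have "length A = i" "Suc (length A + length B) = j"
    using assms by (auto simp: A_def B_def)
  then have "swp i j xs = A @ xs!j # B @ xs!i # C"
    using swp_far[of A B "xs!i" "xs!j" C] xs by metis
  then show ?thesis using list_sgn_exchange[of A "xs!j" B "xs!i" C] xs by metis
qed

lemma list_sgn_nondistinct: "\<not> distinct xs \<Longrightarrow> list_sgn xs = 0"
  by (induction xs) (auto simp: prod_list_zero_iff osgn_def)

lemma list_sgn_square: "distinct xs \<Longrightarrow> list_sgn xs * list_sgn xs = 1"
proof (induction xs)
  case (Cons x xs)
  have "prod_list (map (osgn x) ys) * prod_list (map (osgn x) ys) = 1" if "x \<notin> set ys" for ys
    using that by (induction ys) (auto simp: osgn_def mult_ac)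
  then show ?case using Cons by (simp add: algebra_simps)
qed simp

lemma list_sgn_append_less:
  assumes "\<And>x y. x \<in> set A \<Longrightarrow> y \<in> set B \<Longrightarrow> x < y"
  shows "list_sgn (A @ B) = list_sgn A * list_sgn B"
proof -
  have "prod_list (map (osgn x) ys) = 1" if "\<forall>y\<in>set ys. x < y" for x ys
    using that by (induction ys) (auto simp: osgn_def)
  then have "cross_sgn A B = 1"
    using assms by (induction A) (auto simp: cross_sgn_Cons_left)
  then show ?thesis by (simp add: list_sgn_append)
qed

lemma list_sgn_shift: "list_sgn (map (\<lambda>x. x + n) xs) = list_sgn xs"
proof (induction xs)
  case (Cons x xs)
  have "osgn (x + n) (y + n) = osgn x y" for y by (simp add: osgn_def)
  then show ?case using Cons by (simp add: comp_def)
qed simp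

lemma cnj_list_sgn: "cnj (list_sgn xs) = list_sgn xs"
proof (induction xs)
  case (Cons x xs)
  have "cnj (prod_list (map (osgn x) ys)) = prod_list (map (osgn x) ys)" for ys
    by (induction ys) (auto simp: osgn_def)
  then show ?case using Cons by simp
qed simp

text \<open>The coordinates of the wedge product of the basis vectors indexed by \<open>S\<close> in
  increasing order, without a factorial.\<close>

definition wedge :: "nat set \<Rightarrow> tens" where
  "wedge S xs = (if set xs = S then list_sgn xs else 0)"

definition wedge2 :: "nat \<Rightarrow> nat set \<Rightarrow> nat set \<Rightarrow> tens" where
  "wedge2 c S1 S2 xs = wedge S1 (take c xs) * wedge S2 (drop c xs)"

lemma wedge_nonzero: "wedge S xs \<noteq> 0 \<Longrightarrow> distinct xs \<and> set xs = S \<and> length xs = card S"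
  using list_sgn_nondistinct[of xs] distinct_card[of xs] by (cases "set xs = S"; cases "distinct xs") (auto simp: wedge_def)

lemma wedge_swp:
  assumes "i < j" "j < length xs"
  shows "wedge S (swp i j xs) = - wedge S xs"
  using assms by (simp add: wedge_def list_sgn_swp set_swp)

lemma wedge2_nonzero:
  assumes "wedge2 c S1 S2 xs \<noteq> 0" "card S1 = c" "card S2 = d"
  shows "length xs = c + d" "set (take c xs) = S1" "set (drop c xs) = S2" "distinct (take c xs)" "distinct (drop c xs)"
  using assms wedge_nonzero[of S1 "take c xs"] wedge_nonzero[of S2 "drop c xs"]
  by (auto simp: wedge2_def)

lemma take_swp_low: "i < c \<Longrightarrow> j < c \<Longrightarrow> c \<le> length xs \<Longrightarrow> take c (swp i j xs) = swp i j (take c xs)"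
  by (simp add: swp_def take_update_swap)

lemma drop_swp_low: "i < c \<Longrightarrow> j < c \<Longrightarrow> drop c (swp i j xs) = drop c xs"
  by (simp add: swp_def)

lemma take_swp_high: "c \<le> i \<Longrightarrow> c \<le> j \<Longrightarrow> take c (swp i j xs) = take c xs"
  by (simp add: swp_def)

lemma drop_swp_high:
  assumes "c \<le> i" "c \<le> j" "i < length xs" "j < length xs"
  shows "drop c (swp i j xs) = swp (i - c) (j - c) (drop c xs)"
  by (rule nth_equalityI) (use assms in \<open>auto simp: nth_swp\<close>)

lemma supported_wedge2:
  assumes "card S1 = c" "card S2 = d" "S1 \<subseteq> {..<N}" "S2 \<subseteq> {..<N}"
  shows "supported N (c + d) (wedge2 c S1 S2)"
  unfolding supported_def
proof (intro allI impI)
  fix xs assume "wedge2 c S1 S2 xs \<noteq> 0"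
  from wedge2_nonzero[OF this assms(1,2)] assms(3,4) have len: "length xs = c + d" and sub: "set (take c xs) \<union> set (drop c xs) \<subseteq> {..<N}"
    by simp_all
  have "set xs = set (take c xs) \<union> set (drop c xs)"
    by (metis append_take_drop_id set_append)
  then show "xs \<in> idx N (c + d)" using len sub by (auto simp: idx_def)
qed

lemma alt1_wedge2:
  assumes "card S1 = c" "card S2 = d"
  shows "alt1 0 c (wedge2 c S1 S2)" "alt1 c d (wedge2 c S1 S2)"
proof -
  have z: "wedge2 c S1 S2 xs = 0" if "length xs \<noteq> c + d" for xs
    using wedge2_nonzero(1)[OF _ assms] that by blast
  show "alt1 0 c (wedge2 c S1 S2)"
    unfolding alt1_def
  proof (intro allI impI)
    fix xs i j assume "0 \<le> i" "i < j" "j < 0 + c"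
    then show "wedge2 c S1 S2 (swp i j xs) = - wedge2 c S1 S2 xs"
      using z[of xs] z[of "swp i j xs"]
      by (cases "length xs = c + d")
        (simp add: wedge2_def take_swp_low drop_swp_low wedge_swp, simp only: length_swp, simp)
  qed
  show "alt1 c d (wedge2 c S1 S2)"
    unfolding alt1_def
  proof (intro allI impI)
    fix xs i j assume "c \<le> i" "i < j" "j < c + d"
    then show "wedge2 c S1 S2 (swp i j xs) = - wedge2 c S1 S2 xs"
      using z[of xs] z[of "swp i j xs"]
      by (cases "length xs = c + d")
        (simp add: wedge2_def take_swp_high drop_swp_high wedge_swp, simp only: length_swp, simp)
  qed
qed

lemma traceless_wedge2:
  assumes "card S1 = c" "card S2 = d" "r < c + d" "s < c + d" "r \<noteq> s"
    and iso: "\<And>x y. x \<in> (if r < c then S1 else S2) \<Longrightarrow> y \<in> (if s < c then S1 else S2) \<Longrightarrow> sympl n x y = 0"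
  shows "traceless n (c + d) r s (wedge2 c S1 S2)"
  unfolding traceless_def contraction_def
proof (intro allI impI sum.neutral ballI)
  fix xs :: "nat list" and \<mu> \<nu> assume len: "length xs = c + d"
  let ?ys = "xs[r := \<mu>, s := \<nu>]"
  have mem: "?ys ! t \<in> (if t < c then set (take c ?ys) else set (drop c ?ys))" if "t < c + d" for t
  proof (cases "t < c")
    case True
    then have "?ys ! t = take c ?ys ! t" "t < length (take c ?ys)" using that len by auto
    then show ?thesis using True by (metis nth_mem)
  next
    case False
    then have "?ys ! t = drop c ?ys ! (t - c)" "t - c < length (drop c ?ys)" using that len by auto
    then show ?thesis using False by (metis nth_mem)
  qed
  show "sympl n \<mu> \<nu> * wedge2 c S1 S2 ?ys = 0"
  proof (cases "wedge2 c S1 S2 ?ys = 0")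
    case False
    note nz = wedge2_nonzero[OF False assms(1,2)]
    have "\<mu> \<in> (if r < c then S1 else S2)"
      using mem[OF assms(3)] assms(3,5) len unfolding nz(2,3) by simp
    moreover have "\<nu> \<in> (if s < c then S1 else S2)"
      using mem[OF assms(4)] assms(4) len unfolding nz(2,3) by simp
    ultimately show ?thesis using iso by simp
  qed simp
qed

lemma prim_blocks_wedge2:
  assumes "card S1 = c" "card S2 = d" "S1 \<subseteq> {..<2*n}" "S2 \<subseteq> {..<2*n}"
    and "\<And>x y. x \<in> S1 \<Longrightarrow> y \<in> S1 \<Longrightarrow> sympl n x y = 0"
    and "\<And>x y. x \<in> S2 \<Longrightarrow> y \<in> S2 \<Longrightarrow> sympl n x y = 0"
  shows "prim_blocks n c d (wedge2 c S1 S2)"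
proof -
  have "traceless n (c + d) 0 1 (wedge2 c S1 S2)" if "2 \<le> c"
    by (rule traceless_wedge2[OF assms(1,2)]) (use that assms(5) in auto)
  moreover have "traceless n (c + d) c (Suc c) (wedge2 c S1 S2)" if "2 \<le> d"
    by (rule traceless_wedge2[OF assms(1,2)]) (use that assms(6) in auto)
  ultimately show ?thesis
    unfolding prim_blocks_def using supported_wedge2[OF assms(1-4)] alt1_wedge2[OF assms(1,2)] by blast
qed

text \<open>A nonzero coefficient requires the entry at slot \<open>a\<close> to occur in the first
  block, since the second index set lies in the first. If \<open>xs!a\<close> occurs at
  \<open>q < a\<close>, the exchange with \<open>q\<close> is the identity and every other exchange
  creates a repetition. Otherwise \<open>xs\<close> has coefficient \<open>0\<close>; if some
  exchange with \<open>p\<close> is nonzero, then \<open>xs!p\<close> occurs a second time at some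
  \<open>q\<close>, and exactly the terms \<open>p\<close> and \<open>q\<close> survive and
  cancel.\<close>

lemma plucker_wedge2:
  assumes "Suc b \<le> a"
  shows "plucker (a + Suc b) a (wedge2 a {..<a} {..<Suc b})"
  unfolding plucker_def
proof (intro allI impI)
  let ?f = "wedge2 a {..<a} {..<Suc b}"
  fix xs :: "nat list" assume len: "length xs = a + Suc b"
  have alt: "?f (swp i j xs) = - ?f xs" if "i < j" "j < a" for i j xs
    using alt1_wedge2(1)[of "{..<a}" a "{..<Suc b}" "Suc b"] that unfolding alt1_def by simp
  have zero: "?f ys = 0" if "length ys = a + Suc b" "i < a" "j < a" "i \<noteq> j" "ys!i = ys!j" for ys i j
  proof (rule ccontr)
    assume "?f ys \<noteq> 0"
    then have "distinct (take a ys)"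
      using wedge2_nonzero(4)[of a "{..<a}" "{..<Suc b}" ys "Suc b"] by simp
    then show False
      using that by (auto simp: distinct_conv_nth)
  qed
  have nth: "swp p a xs ! t = (if t = p then xs!a else if t = a then xs!p else xs!t)"
    if "p < a" "t < a + Suc b" for p t
    using that len by (simp add: nth_swp)
  have nz: "\<exists>t<a. ys!t = ys!a" if nz: "?f ys \<noteq> 0" and l: "length ys = a + Suc b" for ys
  proof -
    have s: "set (take a ys) = {..<a}" "set (drop a ys) = {..<Suc b}"
      using wedge2_nonzero(2,3)[of a "{..<a}" "{..<Suc b}" ys "Suc b"] nz by simp_all
    have "ys!a \<in> set (drop a ys)"
      using l by (simp add: Cons_nth_drop_Suc[symmetric])
    then have "ys!a \<in> set (take a ys)"
      using s assms by auto
    then show ?thesis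
      using l by (auto simp: in_set_conv_nth)
  qed
  show "?f xs = (\<Sum>p<a. ?f (swp p a xs))"
  proof (cases "?f xs = 0 \<and> (\<forall>p<a. ?f (swp p a xs) = 0)")
    case True
    then show ?thesis by simp
  next
    case ex: False
    show ?thesis
    proof (cases "\<exists>q<a. xs!q = xs!a")
      case True
      then obtain q where q: "q < a" "xs!q = xs!a" by blast
      have "swp q a xs = xs"
        by (rule nth_equalityI) (use q len nth in auto)
      moreover have "?f (swp p a xs) = 0" if "p < a" "p \<noteq> q" for p
        by (rule zero[of _ p q]) (use that q len nth in auto)
      ultimately have "(\<Sum>p<a. ?f (swp p a xs)) = (\<Sum>p<a. if p = q then ?f xs else 0)"
        by (intro sum.cong) auto
      then show ?thesis using q by simp
    next
      case False
      then have f0: "?f xs = 0" using nz[of xs] len by blast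
      then obtain p where p: "p < a" "?f (swp p a xs) \<noteq> 0" using ex by blast
      then obtain q where "q < a" "swp p a xs ! q = swp p a xs ! a"
        using nz[OF p(2)] len by auto
      then have q: "q < a" "q \<noteq> p" "xs!q = xs!p"
        using nth[OF p(1)] p(1) False by (auto split: if_splits)
      have sw: "swp q a xs = swp p q (swp p a xs)"
        by (rule nth_equalityI) (use p(1) q len in \<open>auto simp: nth_swp\<close>)
      have "?f (swp p q (swp p a xs)) = - ?f (swp p a xs)"
      proof (cases "p < q")
        case True
        then show ?thesis using alt q by simp
      next
        case False
        have "swp p q zs = swp q p zs" if "length zs = a + Suc b" for zs :: "nat list"
          by (rule nth_equalityI) (use p(1) q(1) that in \<open>auto simp: nth_swp\<close>)
        then show ?thesis using alt[of q p] q p(1) False len by simp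
      qed
      then have pq: "?f (swp q a xs) = - ?f (swp p a xs)" by (simp add: sw)
      have "?f (swp t a xs) = 0" if "t < a" "t \<noteq> p" "t \<noteq> q" for t
        by (rule zero[of _ p q]) (use that q p(1) len nth in auto)
      then have "(\<Sum>t<a. ?f (swp t a xs)) = (\<Sum>t\<in>{p, q}. ?f (swp t a xs))"
        by (intro sum.mono_neutral_right) (use p(1) q in auto)
      also have "\<dots> = 0" using pq q(2) by simp
      finally show ?thesis using f0 by simp
    qed
  qed
qed

lemma sympl_low: "x < n \<Longrightarrow> y < n \<Longrightarrow> sympl n x y = 0"
  by (auto simp: sympl_def)

text \<open>This is the highest weight vector of the source; the nonvanishing of the homomorphism is
  tested on it.\<close>

lemma top_blocks_wedge2:
  assumes "b \<le> a" "a \<le> n"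
  shows "top_blocks n a b (wedge2 a {..<a} {..<b})"
proof -
  have iso: "sympl n x y = 0" if "x < a" "y < a" for x y
    using that assms by (simp add: sympl_low)
  have "prim_blocks n a b (wedge2 a {..<a} {..<b})"
    by (rule prim_blocks_wedge2) (use assms iso in auto)
  moreover have "traceless n (a + b) 0 a (wedge2 a {..<a} {..<b})" if "1 \<le> a" "1 \<le> b"
    by (rule traceless_wedge2) (use that assms iso in auto)
  moreover have "plucker (a + b) a (wedge2 a {..<a} {..<b})" if "1 \<le> b"
    using plucker_wedge2[of "b - 1" a] that assms by simp
  ultimately show ?thesis by (simp add: top_blocks_def)
qed

text \<open>\<open>S1\<close> and \<open>S2\<close> are isotropic, and they share with
  \<open>{..<p+i}\<close> exactly the indices that the insertion keeps in each block; the remaining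
  \<open>j\<close> indices of \<open>S1\<close> have their symplectic partners in \<open>S2\<close>.
  A nonzero term therefore determines the index set of every block, every list sign occurs in it
  twice, and it equals \<open>1\<close>. The list \<open>xs0\<close> gives such a term, so the sum
  is a positive integer.\<close>

lemma E_pairing_nonzero:
  fixes n p j b i :: nat
  assumes bp: "b \<le> p" and le: "p + i + j \<le> n"
  defines "S1 \<equiv> {..<p} \<union> {p+i..<p+i+j}"
    and "S2 \<equiv> {..<b} \<union> {p..<p+i} \<union> {p+i+n..<p+i+j+n}"
  shows "(\<Sum>xs\<in>idx (2*n) (p+j+b+i+j).
      embed1 n p j b i (wedge2 (p+i) {..<p+i} {..<b}) xs * cnj (wedge2 (p+j) S1 S2 xs)) \<noteq> 0"
proof -
  define t where "t xs = embed1 n p j b i (wedge2 (p+i) {..<p+i} {..<b}) xs * cnj (wedge2 (p+j) S1 S2 xs)" for xs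
  have t01: "t xs = 1" if len: "length xs = p+j+b+i+j" and nz: "t xs \<noteq> 0" for xs
  proof -
    obtain I1 I2 J1 J2 J3 where xs: "xs = I1 @ I2 @ J1 @ J2 @ J3" 
      and l: "length I1 = p" "length I2 = j" "length J1 = b" "length J2 = i" "length J3 = j"
      using obtain_blocks[OF len] by blast
    have t_eq: "t xs = (wedge {..<p+i} (I1 @ J2) * wedge {..<b} J1) * (\<Prod>s<j. sympl n (I2!s) (J3!s))
        * cnj (wedge S1 (I1 @ I2) * wedge S2 (J1 @ J2 @ J3))"
      unfolding t_def xs embed1_blocks[OF l] using l by (simp add: wedge2_def)
    then have "wedge {..<p+i} (I1 @ J2) \<noteq> 0" "wedge {..<b} J1 \<noteq> 0" "wedge S1 (I1 @ I2) \<noteq> 0" "wedge S2 (J1 @ J2 @ J3) \<noteq> 0"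
      and sp: "\<And>s. s < j \<Longrightarrow> sympl n (I2!s) (J3!s) \<noteq> 0"
      using nz by auto
    note w = this(1-4)[THEN wedge_nonzero]
    have I1: "set I1 = {..<p}"
    proof (rule card_subset_eq)
      have "set I1 \<subseteq> {..<p+i}" "set I1 \<subseteq> S1" using w(1,3) by auto
      then show "set I1 \<subseteq> {..<p}" by (force simp: S1_def)
      show "card (set I1) = card {..<p}" using w(1) l by (simp add: distinct_card)
    qed simp
    have w1: "set I1 \<union> set J2 = {..<p+i}" "set I1 \<inter> set J2 = {}"
      and w3: "set I1 \<union> set I2 = S1" "set I1 \<inter> set I2 = {}"
      using w(1,3) by (simp_all only: set_append distinct_append)
    have "set J2 = {..<p+i} - {..<p}"
      using w1 unfolding I1 by blast
    then have J2: "set J2 = {p..<p+i}" by auto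
    have "set I2 = S1 - {..<p}"
      using w3 unfolding I1 by blast
    moreover have "S1 - {..<p} = {p+i..<p+i+j}"
      by (rule Set.set_eqI) (simp add: S1_def, linarith)
    ultimately have I2: "set I2 = {p+i..<p+i+j}" by simp
    have J1: "set J1 = {..<b}" using w(2) by blast
    have J3: "J3 = map (\<lambda>x. x + n) I2"
    proof (rule nth_equalityI)
      fix s assume "s < length J3"
      then have s: "s < j" using l by simp
      then have "I2!s \<in> set I2" using l by simp
      then have "I2!s < n" using I2 le by simp
      then show "J3!s = map (\<lambda>x. x + n) I2 ! s"
        using sp[OF s] l s by (auto simp: sympl_def split: if_splits)
    qed (use l in simp)
    have "(\<Prod>s<j. sympl n (I2!s) (J3!s)) = 1"
    proof (rule prod.neutral, intro ballI)
      fix s assume s: "s \<in> {..<j}"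
      then have "I2!s \<in> set I2" using l by simp
      then have "I2!s < n" using I2 le by simp
      then show "sympl n (I2!s) (J3!s) = 1" using s l by (simp add: J3 sympl_def)
    qed
    moreover have "list_sgn (I1 @ J2) = list_sgn I1 * list_sgn J2" "list_sgn (I1 @ I2) = list_sgn I1 * list_sgn I2"
      using I1 J2 I2 by (auto intro!: list_sgn_append_less)
    moreover have "list_sgn (J1 @ J2 @ J3) = list_sgn J1 * (list_sgn J2 * list_sgn I2)"
      using J1 J2 I2 bp le by (subst list_sgn_append_less, force simp: J3, subst list_sgn_append_less) (auto simp: J3 list_sgn_shift)
    ultimately have "t xs = (list_sgn I1 * list_sgn I1) * (list_sgn J2 * list_sgn J2) * (list_sgn J1 * list_sgn J1) * (list_sgn I2 * list_sgn I2)"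
      using w unfolding t_eq by (simp add: wedge_def cnj_list_sgn mult_ac)
    also have "\<dots> = 1"
      using w by (simp add: list_sgn_square)
    finally show ?thesis .
  qed
  define xs0 where "xs0 = [0..<p] @ [p+i..<p+i+j] @ [0..<b] @ [p..<p+i] @ [p+i+n..<p+i+j+n]"
  have xs0: "xs0 \<in> idx (2*n) (p+j+b+i+j)"
    using bp le by (auto simp: xs0_def idx_def)
  have wedge: "wedge (set xs) xs \<noteq> 0" if "distinct xs" for xs
    using list_sgn_square[OF that] by (auto simp: wedge_def)
  have sets: "{..<p+i} = set ([0..<p] @ [p..<p+i])" "{..<b} = set [0..<b]"
    "S1 = set ([0..<p] @ [p+i..<p+i+j])" "S2 = set ([0..<b] @ [p..<p+i] @ [p+i+n..<p+i+j+n])"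
    unfolding S1_def S2_def by auto
  have "wedge {..<p+i} ([0..<p] @ [p..<p+i]) \<noteq> 0" "wedge {..<b} [0..<b] \<noteq> 0"
    "wedge S1 ([0..<p] @ [p+i..<p+i+j]) \<noteq> 0" "wedge S2 ([0..<b] @ [p..<p+i] @ [p+i+n..<p+i+j+n]) \<noteq> 0"
    unfolding sets by (rule wedge, use bp le in force)+
  moreover have "(\<Prod>s<j. sympl n ([p+i..<p+i+j]!s) ([p+i+n..<p+i+j+n]!s)) = 1"
    using le by (intro prod.neutral) (auto simp: sympl_def)
  moreover have "t xs0 = wedge2 (p+i) {..<p+i} {..<b} ([0..<p] @ [p..<p+i] @ [0..<b])
      * (\<Prod>s<j. sympl n ([p+i..<p+i+j]!s) ([p+i+n..<p+i+j+n]!s)) * cnj (wedge2 (p+j) S1 S2 xs0)"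
    unfolding t_def xs0_def by (subst embed1_blocks) simp_all
  ultimately have "t xs0 \<noteq> 0"
    by (simp add: wedge2_def xs0_def)
  then have "t xs0 = 1" using t01 xs0 by (simp add: length_idx)
  have "sum t (idx (2*n) (p+j+b+i+j)) = (\<Sum>xs\<in>idx (2*n) (p+j+b+i+j). of_nat (if t xs = 1 then 1 else 0))"
    by (intro sum.cong refl) (metis length_idx of_nat_0 of_nat_1 t01)
  also have "\<dots> = of_nat (\<Sum>xs\<in>idx (2*n) (p+j+b+i+j). if t xs = 1 then 1 else 0)"
    by simp
  also have "\<dots> \<noteq> 0"
    using xs0 \<open>t xs0 = 1\<close> by (simp only: of_nat_eq_0_iff) (auto simp: sum_eq_0_iff)
  finally show ?thesis by (simp add: t_def)
qed

section \<open>Test vectors in the symmetric powers of H\<close>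

definition powH :: "nat \<Rightarrow> tens" where
  "powH k hs = (if hs = replicate k 0 then 1 else 0)"

text \<open>Unnormalised \<open>e_0^(r-j) e_1^j \<otimes> e_0^l\<close>.\<close>

definition monomH :: "nat \<Rightarrow> nat \<Rightarrow> nat \<Rightarrow> tens" where
  "monomH r l j hs = (if hs \<in> idx 2 (r + l) \<and> (\<forall>t. r \<le> t \<longrightarrow> t < r + l \<longrightarrow> hs!t = 0) \<and> count (mset hs) 1 = j then 1 else 0)"

lemma swp_replicate: "i < k \<Longrightarrow> j < k \<Longrightarrow> swp i j (replicate k x) = replicate k x"
  by (rule nth_equalityI) (auto simp: nth_swp)

lemma sym_blocks_powH: "sym_blocks k 0 (powH k)"
proof -
  have "powH k (swp i j hs) = powH k hs" if "i < j" "j < k" for i j hs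
  proof -
    have "swp i j hs = replicate k 0 \<longleftrightarrow> hs = replicate k 0"
    proof
      assume *: "swp i j hs = replicate k 0"
      then have "length hs = k" by (metis length_swp length_replicate)
      then have "hs = swp i j (swp i j hs)" using that by (simp add: swp_swp)
      then show "hs = replicate k 0" using * that by (simp add: swp_replicate)
    qed (use that in \<open>simp add: swp_replicate\<close>)
    then show ?thesis by (simp add: powH_def)
  qed
  then show ?thesis
    unfolding sym_blocks_def by (auto simp: sym1_def supported_def powH_def idx_def)
qed

lemma sym_blocks_monomH: "sym_blocks r l (monomH r l j)"
proof -
  have one: "monomH r l j (swp s t hs) = 1" if "monomH r l j hs = 1" "s < t" "t < r + l" "t < r \<or> r \<le> s" for s t hs
  proof -
    have h: "hs \<in> idx 2 (r + l)" "\<forall>t. r \<le> t \<longrightarrow> t < r + l \<longrightarrow> hs!t = 0" "count (mset hs) 1 = j"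
      using that(1) by (auto simp: monomH_def split: if_splits)
    have len: "length hs = r + l" using h(1) by (simp add: length_idx)
    have "swp s t hs \<in> idx 2 (r + l)"
      using h(1) len that by (simp add: idx_def set_swp)
    moreover have "swp s t hs ! u = 0" if "r \<le> u" "u < r + l" for u
      using h(2) len \<open>s < t\<close> \<open>t < r + l\<close> \<open>t < r \<or> r \<le> s\<close> that by (auto simp: nth_swp)
    ultimately show ?thesis
      using h len that by (simp add: monomH_def mset_swp)
  qed
  have "monomH r l j (swp s t hs) = monomH r l j hs" if "s < t" "t < r + l" "t < r \<or> r \<le> s" for s t hs
  proof (cases "length hs = r + l")
    case True
    then have "swp s t (swp s t hs) = hs" using that by (simp add: swp_swp)
    then have "monomH r l j (swp s t hs) = 1 \<longleftrightarrow> monomH r l j hs = 1"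
      using one[of hs s t] one[of "swp s t hs" s t] that by auto
    then show ?thesis by (auto simp: monomH_def split: if_splits)
  next
    case False
    then show ?thesis by (simp add: monomH_def idx_def)
  qed
  then show ?thesis
    unfolding sym_blocks_def by (auto simp: sym1_def supported_def monomH_def split: if_splits)
qed

text \<open>A single word contributes. \<open>powH\<close> forces zeros in \<open>I1\<close> and
  \<open>J2\<close>, \<open>monomH\<close> forces zeros in the second block, and so the
  \<open>j\<close> ones have to fill \<open>I2\<close>.\<close>

lemma H_pairing_nonzero:
  "(\<Sum>hs\<in>idx 2 (x+j+0+y+j). embed1 1 x j 0 y (powH (x+y)) hs * cnj (monomH (x+j) (y+j) j hs)) \<noteq> 0"
proof -
  define hs0 where "hs0 = replicate x 0 @ replicate j 1 @ [] @ replicate y 0 @ replicate j (0::nat)"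
  define t where "t hs = embed1 1 x j 0 y (powH (x+y)) hs * cnj (monomH (x+j) (y+j) j hs)" for hs
  have "hs = hs0" if len: "length hs = x+j+0+y+j" and nz: "t hs \<noteq> 0" for hs
  proof -
    obtain I1 I2 J1 J2 J3 where hs: "hs = I1 @ I2 @ J1 @ J2 @ J3" 
      and l: "length I1 = x" "length I2 = j" "length J1 = 0" "length J2 = y" "length J3 = j"
      using obtain_blocks[OF len] by blast
    have "powH (x+y) (I1 @ J2 @ J1) \<noteq> 0" "monomH (x+j) (y+j) j hs \<noteq> 0"
      using nz unfolding t_def hs embed1_blocks[OF l] by auto
    then have v: "I1 @ J2 = replicate (x+y) 0" and h: "\<forall>t. x+j \<le> t \<longrightarrow> t < x+j+(y+j) \<longrightarrow> hs!t = 0"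
      and c: "count (mset hs) 1 = j" and i: "hs \<in> idx 2 (x+j+(y+j))"
      using l by (auto simp: powH_def monomH_def split: if_splits)
    have I1: "I1 = replicate x 0" and J2: "J2 = replicate y 0"
      using v l by (auto simp: replicate_add)
    have J3: "J3 = replicate j 0"
    proof (rule nth_equalityI)
      fix s assume "s < length J3"
      then have "s < j" using l by simp
      then show "J3!s = replicate j 0 ! s"
        using h[rule_format, of "x+j+y+s"] l by (simp add: hs nth_append)
    qed (use l in simp)
    have "count (mset I2) 1 = length I2"
      using c l by (simp add: hs I1 J2 J3 count_mset_0_iff)
    then have "\<forall>z\<in>set I2. z = 1"
      unfolding count_mset
    proof (induction I2)
      case (Cons z zs)
      then show ?case using count_le_length[of zs 1] by (auto split: if_splits)
    qed simp
    then have "I2 = replicate j 1" using l by (metis replicate_length_same)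
    then show ?thesis using I1 J2 J3 l by (simp add: hs hs0_def)
  qed
  then have "(\<Sum>hs\<in>idx 2 (x+j+0+y+j). t hs) = (\<Sum>hs\<in>idx 2 (x+j+0+y+j). if hs = hs0 then t hs0 else 0)"
    by (intro sum.cong refl) (metis length_idx)
  also have "\<dots> = t hs0"
  proof -
    have "hs0 \<in> idx 2 (x+j+0+y+j)" by (auto simp: hs0_def idx_def)
    then show ?thesis by simp
  qed
  also have "t hs0 = (\<Prod>s<j. sympl 1 (replicate j 1 ! s) (replicate j 0 ! s))"
  proof -
    have "monomH (x+j) (y+j) j hs0 = 1"
      by (auto simp: monomH_def hs0_def idx_def nth_append count_mset_0_iff)
    moreover have "powH (x+y) (replicate x 0 @ replicate y 0 @ []) = 1"
      by (simp add: powH_def replicate_add)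
    ultimately show ?thesis
      unfolding t_def unfolding hs0_def by (subst embed1_blocks) simp_all
  qed
  also have "\<dots> \<noteq> 0" by (simp add: sympl_def)
  finally show ?thesis by (simp add: t_def)
qed

lemma tensor_space_product:
  assumes "lin_closed PH" "lin_closed PE" "PH u" "PE f"
  shows "(\<lambda>hs es. u hs * f es) \<in> tensor_space PH PE"
proof -
  have "PH (\<lambda>hs. f es * u hs)" for es using assms by (simp add: lin_closed_def)
  then show ?thesis
    using assms unfolding tensor_space_def by (simp add: lin_closed_def mult.commute[of "f _"])
qed

lemma act_diff: "act n h g (\<lambda>hs es. f hs es - f' hs es) hs es = act n h g f hs es - act n h g f' hs es"
  by (simp add: act_def right_diff_distrib sum_subtractf)

lemma sym_blocks_prim_blocks_supp: "w \<in> tensor_space (sym_blocks r l) (prim_blocks n c d) \<Longrightarrow> supp_in n (r + l) (c + d) w"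
  by (auto simp: tensor_space_def sym_blocks_def prim_blocks_def supp_in_iff)

theorem hom_nonzero_sufficient:
  assumes bp: "b \<le> p" and le: "p + i + j \<le> n" and n: "n = x + j' + p + j"
  shows "hom_nonzero n (Vsp n (x + y) (p + i) b) (Wsp n (y + j') (b + i + j))"
proof -
  let ?r = "x + j'" and ?l = "y + j'" and ?c = "p + j" and ?d = "b + i + j"
  let ?V = "Vsp n (x + y) (p + i) b"
  define W where "W = Wsummand n ?r ?l ?d"
  have nr: "n - ?r = ?c" using n by simp
  have W: "W = tensor_space (sym_blocks ?r ?l) (prim_blocks n ?c ?d)"
    unfolding W_def using Wsummand_eq[of ?r n ?l ?d] n nr by simp
  note linW = lin_closed_sym_blocks[of ?r ?l] lin_closed_prim_blocks[of n ?c ?d]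
  have Wzero: "(\<lambda>hs es. 0) \<in> W" unfolding W by (rule tensor_space_zero[OF linW])
  have Wadd: "(\<lambda>hs es. u hs es + v hs es) \<in> W" if "u \<in> W" "v \<in> W" for u v
    using that unfolding W by (rule tensor_space_add[OF linW])
  have Wscale: "(\<lambda>hs es. c * u hs es) \<in> W" if "u \<in> W" for u c
    using that unfolding W by (rule tensor_space_scale[OF linW])
  have Wact: "act n h g w \<in> W" if "h \<in> cpt_sp 1" "g \<in> cpt_sp n" "w \<in> W" for h g w
    using that unfolding W by (intro act_tensor_space linW sym_blocks_gact prim_blocks_gact)
  have Wsupp: "supp_in n (?r + ?l) (?c + ?d) w" if "w \<in> W" for w
    using that unfolding W by (rule sym_blocks_prim_blocks_supp)
  let ?ip = "tensor_ip n (?r + ?l) (?c + ?d)"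
  let ?T = "embed_tensor n x j' y p j b i"
  define orth where "orth f w \<longleftrightarrow> w \<in> W \<and> (\<forall>u\<in>W. ?ip (\<lambda>hs es. f hs es - w hs es) u = 0)" for f w
  have ex: "\<exists>w. orth f w" for f
    using tensor_projection_exists[OF Wzero Wadd Wscale Wsupp, of f] unfolding orth_def by blast
  have uniq: "w = w'" if "orth f w" "orth f w'" for f w w'
  proof -
    let ?z = "\<lambda>hs es. w hs es + (-1) * w' hs es"
    have z: "?z \<in> W" using that Wadd Wscale unfolding orth_def by blast
    have "?ip (\<lambda>hs es. f hs es - w hs es) ?z = 0" "?ip (\<lambda>hs es. f hs es - w' hs es) ?z = 0"
      using that z unfolding orth_def by blast+
    then have "?ip f ?z - ?ip w ?z = 0" "?ip f ?z - ?ip w' ?z = 0"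
      by (simp_all only: tensor_ip_diff)
    moreover have "?ip ?z ?z = ?ip w ?z + (-1) * ?ip w' ?z"
      by (simp only: tensor_ip_add tensor_ip_scale)
    ultimately have "?ip ?z ?z = 0" by simp
    then have "?z = (\<lambda>hs es. 0)" by (rule tensor_ip_self_zero[OF Wsupp[OF z]])
    then show ?thesis by (simp add: fun_eq_iff)
  qed
  define F where "F v = (SOME w. orth (?T v) w)" for v
  have F: "orth (?T v) (F v)" for v
    unfolding F_def by (rule someI_ex[OF ex])
  \<comment> \<open>Linearity and equivariance below all come from uniqueness: it suffices that the
    proposed value is an orthogonal projection of the right tensor.\<close>
  have Feq: "F v = w" if "orth (?T v) w" for v w
    using uniq[OF F that] .
  have FW: "F v \<in> W" for v using F unfolding orth_def by blast
  have Tadd: "?T (\<lambda>hs es. u hs es + v hs es) = (\<lambda>hs es. ?T u hs es + ?T v hs es)" for u v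
    by (simp add: embed_tensor_def embed1_def fun_eq_iff distrib_right)
  have Tscale: "?T (\<lambda>hs es. c * u hs es) = (\<lambda>hs es. c * ?T u hs es)" for c u
    by (simp add: embed_tensor_def embed1_def fun_eq_iff)
  have "F (\<lambda>hs es. u hs es + v hs es) = (\<lambda>hs es. F u hs es + F v hs es)" for u v
  proof (rule Feq)
    have "?ip (\<lambda>hs es. ?T u hs es + ?T v hs es - (F u hs es + F v hs es)) z
      = ?ip (\<lambda>hs es. ?T u hs es - F u hs es) z + ?ip (\<lambda>hs es. ?T v hs es - F v hs es) z" for z
      by (simp add: tensor_ip_add tensor_ip_diff)
    then show "orth (?T (\<lambda>hs es. u hs es + v hs es)) (\<lambda>hs es. F u hs es + F v hs es)"
      using F[of u] F[of v] Wadd unfolding orth_def Tadd by simp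
  qed
  moreover have "F (\<lambda>hs es. c * u hs es) = (\<lambda>hs es. c * F u hs es)" for c u
  proof (rule Feq)
    have "?ip (\<lambda>hs es. c * ?T u hs es - c * F u hs es) z = c * ?ip (\<lambda>hs es. ?T u hs es - F u hs es) z" for z
      by (simp add: tensor_ip_scale tensor_ip_diff right_diff_distrib)
    then show "orth (?T (\<lambda>hs es. c * u hs es)) (\<lambda>hs es. c * F u hs es)"
      using F[of u] Wscale unfolding orth_def Tscale by simp
  qed
  moreover have "F v \<in> Wsp n ?l ?d" for v
  proof -
    define w where "w s = (if s = ?r then F v else (\<lambda>hs es. 0))" for s
    have "w s \<in> Wsummand n s ?l ?d" if "s \<le> n" for s
      using FW[of v] tensor_space_zero[OF lin_closed_sym_blocks lin_closed_prim_blocks] Wsummand_eq[OF that]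
      by (auto simp: w_def W_def)
    moreover have "F v = (\<lambda>hs es. \<Sum>s\<le>n. w s hs es)"
    proof (intro ext)
      fix hs es
      have "(\<Sum>s\<le>n. w s hs es) = (\<Sum>s\<le>n. if s = ?r then F v hs es else 0)"
        by (intro sum.cong) (auto simp: w_def)
      then show "F v hs es = (\<Sum>s\<le>n. w s hs es)" using n by simp
    qed
    ultimately show ?thesis unfolding Wsp_def by blast
  qed
  moreover have "F (act n h g v) = act n h g (F v)" if hg: "h \<in> cpt_sp 1" "g \<in> cpt_sp n" for h g v
  proof (rule Feq)
    have "?ip (\<lambda>hs es. ?T (act n h g v) hs es - act n h g (F v) hs es) z = 0" if z: "z \<in> W" for z
    proof -
      have "?ip (\<lambda>hs es. ?T (act n h g v) hs es - act n h g (F v) hs es) z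
          = ?ip (act n h g (\<lambda>hs es. ?T v hs es - F v hs es)) z"
        unfolding tensor_ip_def
        by (intro sum.cong refl) (simp add: act_diff embed_tensor_act[OF hg] length_idx)
      also have "\<dots> = ?ip (\<lambda>hs es. ?T v hs es - F v hs es) (act n (adj h) (adj g) z)"
        unfolding tensor_ip_def by (rule act_adjoint)
      also have "\<dots> = 0"
        using F[of v] Wact[OF adj_cpt_sp[OF hg(1)] adj_cpt_sp[OF hg(2)] z] unfolding orth_def by blast
      finally show ?thesis .
    qed
    then show "orth (?T (act n h g v)) (act n h g (F v))"
      unfolding orth_def using Wact[OF hg FW] by blast
  qed
  moreover have "\<exists>v\<in>?V. F v \<noteq> (\<lambda>hs es. 0)"
  proof -
    define S1 where "S1 = {..<p} \<union> {p+i..<p+i+j}"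
    define S2 where "S2 = {..<b} \<union> {p..<p+i} \<union> {p+i+n..<p+i+j+n}"
    define fE where "fE = wedge2 (p+i) {..<p+i} {..<b}"
    define v where "v = (\<lambda>hs es. powH (x+y) hs * fE es)"
    define z where "z = (\<lambda>hs es. monomH ?r ?l j' hs * wedge2 ?c S1 S2 es)"
    have v: "v \<in> ?V"
      unfolding v_def fE_def Vsp_eq
      by (intro tensor_space_product lin_closed_sym_blocks lin_closed_top_blocks sym_blocks_powH top_blocks_wedge2) (use bp le in auto)
    have "prim_blocks n ?c ?d (wedge2 ?c S1 S2)"
    proof (rule prim_blocks_wedge2)
      show "card S1 = ?c"
        unfolding S1_def by (subst card_Un_disjoint) auto
      show "card S2 = ?d"
        unfolding S2_def using bp le by (subst card_Un_disjoint, simp_all, force, subst card_Un_disjoint) auto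
    qed (use bp le in \<open>auto simp: S1_def S2_def sympl_def\<close>)
    then have z: "z \<in> W"
      unfolding z_def W by (intro tensor_space_product linW sym_blocks_monomH)
    have "?ip (?T v) z = (\<Sum>hs\<in>idx 2 (x+j'+0+y+j'). \<Sum>es\<in>idx (2*n) (p+j+b+i+j).
        (embed1 1 x j' 0 y (powH (x+y)) hs * cnj (monomH ?r ?l j' hs)) * (embed1 n p j b i fE es * cnj (wedge2 ?c S1 S2 es)))"
    proof -
      have *: "?T v hs es = embed1 1 x j' 0 y (powH (x+y)) hs * embed1 n p j b i fE es" for hs es
        by (simp add: embed_tensor_def embed1_def v_def)
      have "?r + ?l = x+j'+0+y+j'" "?c + ?d = p+j+b+i+j" by simp_all
      then show ?thesis
        unfolding tensor_ip_def z_def * by (simp only: complex_cnj_mult mult_ac)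
    qed
    also have "\<dots> \<noteq> 0"
      unfolding sum_product[symmetric] using H_pairing_nonzero[of x j' y] E_pairing_nonzero[OF bp le]
      unfolding fE_def S1_def S2_def by (simp only: mult_eq_0_iff simp_thms not_False_eq_True)
    finally have nz: "?ip (?T v) z \<noteq> 0" .
    have "F v \<noteq> (\<lambda>hs es. 0)"
    proof
      assume "F v = (\<lambda>hs es. 0)"
      then have "?ip (\<lambda>hs es. ?T v hs es - 0) z = 0"
        using F[of v] z unfolding orth_def by auto
      then show False using nz by simp
    qed
    then show ?thesis using v by blast
  qed
  ultimately show ?thesis
    unfolding hom_nonzero_def by (intro exI[of _ F]) blast
qed

section \<open>From one-parameter subgroups to the Lie algebra\<close>

lemma pderiv_sum: "pderiv (sum f A) = (\<Sum>x\<in>A. pderiv (f x))"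
  by (induction A rule: infinite_finite_induct) (simp_all add: pderiv_add)

text \<open>Lagrange interpolation: \<open>c s\<close> is the derivative at \<open>1\<close> of the
  basis polynomial \<open>L s\<close>. The nodes have angles in \<open>[0, 1]\<close>, where
  \<open>cos\<close> is injective, so they are distinct points of the unit circle.\<close>

lemma derivative_by_interpolation:
  "\<exists>(c :: nat \<Rightarrow> complex) z. (\<forall>s\<le>N. cmod (z s) = 1) \<and>
     (\<forall>p. degree p \<le> N \<longrightarrow> poly (pderiv p) 1 = (\<Sum>s\<le>N. c s * poly p (z s)))"
proof -
  define z where "z s = cis (real s / (real N + 1))" for s
  have inj: "inj_on z {..N}"
  proof (rule inj_onI)
    fix s t assume st: "s \<in> {..N}" "t \<in> {..N}" "z s = z t"
    have b: "0 \<le> real u / (real N + 1)" "real u / (real N + 1) \<le> pi" if "u \<in> {..N}" for u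
    proof -
      have "real u / (real N + 1) \<le> 1" using that by simp
      then show "real u / (real N + 1) \<le> pi" using pi_ge_two by linarith
    qed simp
    have "cos (real s / (real N + 1)) = cos (real t / (real N + 1))"
      using st(3) by (simp add: z_def complex_eq_iff)
    then have "real s / (real N + 1) = real t / (real N + 1)"
      by (rule cos_inj_pi[OF b(1)[OF st(1)] b(2)[OF st(1)] b(1)[OF st(2)] b(2)[OF st(2)]])
    then show "s = t" by (simp add: divide_simps split: if_splits)
  qed
  define L where "L s = (\<Prod>t\<in>{..N} - {s}. smult (1 / (z s - z t)) [:- z t, 1:])" for s
  have degL: "degree (L s) \<le> N" if "s \<le> N" for s
  proof -
    have "degree (L s) \<le> sum (\<lambda>t. degree (smult (1 / (z s - z t)) [:- z t, 1:])) ({..N} - {s})"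
      unfolding L_def by (rule degree_prod_sum_le[unfolded comp_def]) simp
    also have "\<dots> \<le> sum (\<lambda>t. 1) ({..N} - {s})"
      by (intro sum_mono) (auto intro: degree_smult_le[THEN order_trans])
    also have "\<dots> = N" using that by simp
    finally show ?thesis .
  qed
  have L: "poly (L s) (z t) = (if s = t then 1 else 0)" if "s \<le> N" "t \<le> N" for s t
  proof (cases "s = t")
    case True
    have "z s \<noteq> z u" if "u \<in> {..N} - {s}" for u
      using that \<open>s \<le> N\<close> inj_onD[OF inj] by auto
    then show ?thesis
      using True unfolding L_def poly_prod
      by (simp del: One_nat_def) (intro prod.neutral ballI, simp add: diff_divide_distrib[symmetric])
  next
    case False
    then show ?thesis
      using that unfolding L_def poly_prod by (auto intro!: prod_zero)
  qed
  have "poly (pderiv p) 1 = (\<Sum>s\<le>N. poly (pderiv (L s)) 1 * poly p (z s))" if deg: "degree p \<le> N" for p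
  proof -
    have "p = (\<Sum>s\<le>N. smult (poly p (z s)) (L s))"
    proof (rule poly_eqI_degree[of "z ` {..N}"])
      fix x assume "x \<in> z ` {..N}"
      then obtain t where t: "t \<le> N" "x = z t" by auto
      then have "poly (\<Sum>s\<le>N. smult (poly p (z s)) (L s)) x = (\<Sum>s\<le>N. if s = t then poly p (z t) else 0)"
        unfolding poly_sum by (intro sum.cong) (auto simp: L)
      then show "poly p x = poly (\<Sum>s\<le>N. smult (poly p (z s)) (L s)) x" using t by simp
    next
      show "degree p < card (z ` {..N})" using deg by (simp add: card_image[OF inj])
      have "degree (\<Sum>s\<le>N. smult (poly p (z s)) (L s)) \<le> N"
        by (intro degree_sum_le) (auto intro: degree_smult_le[THEN order_trans] degL)
      then show "degree (\<Sum>s\<le>N. smult (poly p (z s)) (L s)) < card (z ` {..N})"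
        by (simp add: card_image[OF inj])
    qed
    then have "poly (pderiv p) 1 = poly (pderiv (\<Sum>s\<le>N. smult (poly p (z s)) (L s))) 1" by simp
    also have "\<dots> = (\<Sum>s\<le>N. poly (pderiv (L s)) 1 * poly p (z s))"
      by (simp add: pderiv_sum pderiv_smult poly_sum mult.commute)
    finally show ?thesis .
  qed
  moreover have "cmod (z s) = 1" for s by (simp add: z_def)
  ultimately show ?thesis by (intro exI[of _ "\<lambda>s. poly (pderiv (L s)) 1"] exI[of _ z]) blast
qed

text \<open>The Lie algebra action: \<open>A\<close> extended to tensors as a derivation.\<close>

definition lact :: "nat \<Rightarrow> cmat \<Rightarrow> tens \<Rightarrow> tens" where
  "lact N A f xs = (\<Sum>r<length xs. \<Sum>q<N. A (xs!r) q * f (xs[r := q]))"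

text \<open>Cut off at \<open>N\<close> because members of \<open>cpt_sp\<close> vanish outside the
  index range.\<close>

definition id_mat :: "nat \<Rightarrow> cmat" where
  "id_mat N i j = (if i = j \<and> i < N then 1 else 0)"

lemma wprod_id_mat:
  assumes "xs \<in> idx N m" "ys \<in> idx N m"
  shows "wprod (id_mat N) xs ys = (if ys = xs then 1 else 0)"
proof (cases "ys = xs")
  case True
  then show ?thesis using assms by (auto simp: wprod_def id_mat_def idx_iff)
next
  case False
  then obtain r where "r < m" "xs!r \<noteq> ys!r"
    using assms by (metis length_idx nth_equalityI)
  then have "id_mat N (xs!r) (ys!r) = 0" "r < length xs"
    using assms by (auto simp: id_mat_def length_idx)
  then show ?thesis using False unfolding wprod_def by (auto intro!: prod_zero)
qed

lemma gact_id_mat: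
  assumes "xs \<in> idx N m"
  shows "gact N (id_mat N) f xs = f xs"
proof -
  have "gact N (id_mat N) f xs = (\<Sum>ys\<in>idx N m. if ys = xs then f xs else 0)"
    unfolding gact_def using assms by (intro sum.cong) (auto simp: length_idx wprod_id_mat)
  then show ?thesis using assms by simp
qed

lemma sum_id_mat_except:
  assumes xs: "xs \<in> idx N m" and r: "r < m"
  shows "(\<Sum>ys\<in>idx N m. (\<Prod>t\<in>{..<m} - {r}. id_mat N (xs!t) (ys!t)) * h ys) = (\<Sum>q<N. h (xs[r := q]))"
proof -
  let ?I = "(\<lambda>q. xs[r := q]) ` {..<N}"
  have len: "length xs = m" using xs by (rule length_idx)
  have inj: "inj_on (\<lambda>q. xs[r := q]) {..<N}"
    using r len by (intro inj_onI) (metis nth_list_update_eq)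
  have one: "(\<Prod>t\<in>{..<m} - {r}. id_mat N (xs!t) (xs[r := q]!t)) = 1" for q
    using xs by (intro prod.neutral) (auto simp: id_mat_def idx_iff)
  have zero: "(\<Prod>t\<in>{..<m} - {r}. id_mat N (xs!t) (ys!t)) = 0" if ys: "ys \<in> idx N m - ?I" for ys
  proof -
    have "\<exists>t\<in>{..<m} - {r}. xs!t \<noteq> ys!t"
    proof (rule ccontr)
      assume "\<not> ?thesis"
      then have "ys = xs[r := ys!r]"
        using ys len r by (intro nth_equalityI) (auto simp: idx_iff nth_list_update)
      moreover have "ys!r < N" using ys r by (auto simp: idx_iff)
      ultimately show False using ys by blast
    qed
    then show ?thesis by (intro prod_zero) (auto simp: id_mat_def)
  qed
  have "(\<Sum>ys\<in>idx N m. (\<Prod>t\<in>{..<m} - {r}. id_mat N (xs!t) (ys!t)) * h ys)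
      = (\<Sum>ys\<in>?I. (\<Prod>t\<in>{..<m} - {r}. id_mat N (xs!t) (ys!t)) * h ys)"
    by (rule sum.mono_neutral_right) (use xs idx_update zero in auto)
  also have "\<dots> = (\<Sum>q<N. h (xs[r := q]))"
    by (simp only: sum.reindex[OF inj] comp_def one mult_1)
  finally show ?thesis .
qed

lemma lact_id_mat:
  assumes "xs \<in> idx N m"
  shows "lact N (id_mat N) f xs = of_nat m * f xs"
proof -
  have "(\<Sum>q<N. id_mat N (xs!r) q * f (xs[r := q])) = f xs" if "r < m" for r
  proof -
    have "(\<Sum>q<N. id_mat N (xs!r) q * f (xs[r := q])) = (\<Sum>q<N. if q = xs!r then f xs else 0)"
      using assms that by (intro sum.cong) (auto simp: id_mat_def idx_iff)
    then show ?thesis using assms that by (simp add: idx_iff)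
  qed
  then show ?thesis using assms by (simp add: lact_def length_idx)
qed

lemma lact_add_mat: "lact N (\<lambda>i j. A i j + B i j) f xs = lact N A f xs + lact N B f xs"
  by (simp add: lact_def distrib_right sum.distrib)

lemma lact_scale_mat: "lact N (\<lambda>i j. c * A i j) f xs = c * lact N A f xs"
  by (simp add: lact_def sum_distrib_left mult.assoc)

lemma supported_lact:
  assumes "\<And>i j. N \<le> i \<Longrightarrow> A i j = 0" "supported N m f"
  shows "supported N m (lact N A f)"
  unfolding supported_def
proof (intro allI impI)
  fix xs assume "lact N A f xs \<noteq> 0"
  then obtain r where r: "r < length xs" "(\<Sum>q<N. A (xs!r) q * f (xs[r := q])) \<noteq> 0"
    unfolding lact_def by (meson sum.neutral lessThan_iff)
  then obtain q where q: "q < N" "A (xs!r) q * f (xs[r := q]) \<noteq> 0"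
    by (meson sum.neutral lessThan_iff)
  then have "xs[r := q] \<in> idx N m" "xs!r < N"
    using assms unfolding supported_def by (auto simp: not_less[symmetric])
  then show "xs \<in> idx N m"
    using idx_update[of "xs[r := q]" N m "xs!r" r] by simp
qed

text \<open>The matrix coefficients along a circle are Laurent polynomials of bounded degree, so their derivative
  at \<open>1\<close> is a fixed finite combination of values. This makes the Lie algebra action available without
  any continuity of the equivariant map.\<close>

lemma one_parameter_derivative:
  fixes A B C :: cmat
  assumes unit: "\<And>i j. i < N \<Longrightarrow> j < N \<Longrightarrow> A i j + B i j + C i j = id_mat N i j"
  shows "\<exists>(c :: nat \<Rightarrow> complex) (z :: nat \<Rightarrow> complex). (\<forall>s\<le>2*M. cmod (z s) = 1) \<and>
    (\<forall>m f xs. m \<le> M \<longrightarrow> xs \<in> idx N m \<longrightarrow>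
      lact N (\<lambda>i j. A i j - C i j) f xs
       = (\<Sum>s\<le>2*M. c s * gact N (\<lambda>i j. z s * A i j + B i j + inverse (z s) * C i j) f xs)
         - of_nat M * f xs)"
proof -
  obtain c z where cz: "\<And>s. s \<le> 2*M \<Longrightarrow> cmod (z s) = 1"
    "\<And>p. degree p \<le> 2*M \<Longrightarrow> poly (pderiv p) 1 = (\<Sum>s\<le>2*M. c s * poly p (z s))"
    using derivative_by_interpolation[of "2*M"] by blast
  have "lact N (\<lambda>i j. A i j - C i j) f xs
       = (\<Sum>s\<le>2*M. c s * z s ^ M * gact N (\<lambda>i j. z s * A i j + B i j + inverse (z s) * C i j) f xs)
         - of_nat M * f xs" if m: "m \<le> M" and xs: "xs \<in> idx N m" for m f xs
  proof -
    define e where "e r ys = [:C (xs!r) (ys!r), B (xs!r) (ys!r), A (xs!r) (ys!r):]" for r and ys :: "nat list"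
    define Q where "Q = (\<Sum>ys\<in>idx N m. smult (f ys) (\<Prod>r<m. e r ys))"
    \<comment> \<open>Multiplying by \<open>w ^ m\<close> clears the negative powers of
      \<open>w\<close>. The extra factor \<open>w ^ (M - m)\<close> makes the exponent
      \<open>M\<close> common to all degrees \<open>m <= M\<close>, so that the same
      \<open>c\<close> and \<open>z\<close> serve for all of them; differentiating
      \<open>w ^ M\<close> at \<open>1\<close> accounts for the term
      \<open>M * f xs\<close>.\<close>
    define P where "P = monom 1 (M - m) * Q"
    have "degree (\<Prod>r<m. e r ys) \<le> 2*m" for ys
    proof -
      have "degree (\<Prod>r<m. e r ys) \<le> (\<Sum>r<m. degree (e r ys))"
        by (rule degree_prod_sum_le[unfolded comp_def]) simp
      also have "\<dots> \<le> (\<Sum>r<m. 2)"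
        by (intro sum_mono) (simp add: e_def)
      finally show ?thesis by simp
    qed
    then have "degree Q \<le> 2*m"
      unfolding Q_def by (intro degree_sum_le) (auto intro: degree_smult_le[THEN order_trans])
    then have "degree P \<le> (M - m) + 2*m"
      unfolding P_def by (intro degree_mult_le[THEN order_trans] add_mono degree_monom_le)
    then have degP: "degree P \<le> 2*M" using m by simp
    have evalP: "poly P w = w ^ M * gact N (\<lambda>i j. w * A i j + B i j + inverse w * C i j) f xs" if "w \<noteq> 0" for w
    proof -
      have "poly (\<Prod>r<m. e r ys) w = w ^ m * wprod (\<lambda>i j. w * A i j + B i j + inverse w * C i j) xs ys" for ys
      proof -
        have "poly (\<Prod>r<m. e r ys) w = (\<Prod>r<m. w * (w * A (xs!r) (ys!r) + B (xs!r) (ys!r) + inverse w * C (xs!r) (ys!r)))"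
          unfolding poly_prod using that by (intro prod.cong) (simp_all add: e_def field_simps)
        then show ?thesis
          using xs by (simp add: prod.distrib wprod_def length_idx)
      qed
      then have "poly Q w = w ^ m * gact N (\<lambda>i j. w * A i j + B i j + inverse w * C i j) f xs"
        using xs by (simp add: Q_def poly_sum gact_def length_idx sum_distrib_left mult_ac)
      then show ?thesis
        using m by (simp add: P_def poly_monom power_add[symmetric] flip: mult.assoc)
    qed
    have one: "poly (e r ys) 1 = id_mat N (xs!r) (ys!r)" if "r < m" "ys \<in> idx N m" for r ys
      using unit[of "xs!r" "ys!r"] xs that by (simp add: e_def idx_iff algebra_simps)
    have poly1: "poly Q 1 = f xs"
    proof -
      have "poly Q 1 = (\<Sum>ys\<in>idx N m. wprod (id_mat N) xs ys * f ys)"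
        unfolding Q_def poly_sum using xs
        by (intro sum.cong refl) (simp add: poly_prod one wprod_def length_idx mult.commute)
      then show ?thesis using gact_id_mat[OF xs, of f] xs by (simp add: gact_def length_idx)
    qed
    have d1: "poly (pderiv (\<Prod>r<m. e r ys)) 1
        = (\<Sum>r<m. (\<Prod>t\<in>{..<m} - {r}. id_mat N (xs!t) (ys!t)) * (B (xs!r) (ys!r) + 2 * A (xs!r) (ys!r)))"
      if "ys \<in> idx N m" for ys
      unfolding pderiv_prod poly_sum poly_mult poly_prod
    proof (intro sum.cong refl arg_cong2[of _ _ _ _ "(*)"] prod.cong)
      show "poly (e t ys) 1 = id_mat N (xs!t) (ys!t)" if "t \<in> {..<m} - {r}" for t r
        using one[of t ys] that \<open>ys \<in> idx N m\<close> by simp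
      show "poly (pderiv (e r ys)) 1 = B (xs!r) (ys!r) + 2 * A (xs!r) (ys!r)" for r
        by (simp add: e_def pderiv_pCons)
    qed
    have "poly (pderiv Q) 1 = (\<Sum>ys\<in>idx N m. \<Sum>r<m. (\<Prod>t\<in>{..<m} - {r}. id_mat N (xs!t) (ys!t))
        * ((B (xs!r) (ys!r) + 2 * A (xs!r) (ys!r)) * f ys))"
      unfolding Q_def pderiv_sum poly_sum
      by (intro sum.cong refl) (simp add: pderiv_smult d1 sum_distrib_left mult_ac)
    also have "\<dots> = (\<Sum>r<m. \<Sum>q<N. (B (xs!r) q + 2 * A (xs!r) q) * f (xs[r := q]))"
    proof (subst sum.swap, intro sum.cong refl)
      fix r assume r: "r \<in> {..<m}"
      show "(\<Sum>ys\<in>idx N m. (\<Prod>t\<in>{..<m} - {r}. id_mat N (xs!t) (ys!t)) * ((B (xs!r) (ys!r) + 2 * A (xs!r) (ys!r)) * f ys))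
        = (\<Sum>q<N. (B (xs!r) q + 2 * A (xs!r) q) * f (xs[r := q]))"
        using sum_id_mat_except[OF xs, of r "\<lambda>ys. (B (xs!r) (ys!r) + 2 * A (xs!r) (ys!r)) * f ys"] r xs
        by (simp add: length_idx)
    qed
    \<comment> \<open>\<open>B + 2 A\<close> is the identity plus \<open>A - C\<close>, because
      \<open>A + B + C\<close> is the identity. The identity contributes \<open>m * f xs\<close>,
      and the factor \<open>w ^ (M - m)\<close> supplies the missing \<open>M - m\<close>.\<close>
    also have "\<dots> = (\<Sum>r<m. \<Sum>q<N. (id_mat N (xs!r) q + (A (xs!r) q - C (xs!r) q)) * f (xs[r := q]))"
    proof (intro sum.cong refl arg_cong2[of _ _ _ _ "(*)"])
      fix r q assume "r \<in> {..<m}" "q \<in> {..<N}"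
      then have "A (xs!r) q + B (xs!r) q + C (xs!r) q = id_mat N (xs!r) q"
        using xs by (intro unit) (auto simp: idx_iff)
      then show "B (xs!r) q + 2 * A (xs!r) q = id_mat N (xs!r) q + (A (xs!r) q - C (xs!r) q)"
        by (simp add: algebra_simps)
    qed
    also have "\<dots> = lact N (\<lambda>i j. id_mat N i j + (A i j - C i j)) f xs"
      using xs by (simp add: lact_def length_idx)
    also have "\<dots> = of_nat m * f xs + lact N (\<lambda>i j. A i j - C i j) f xs"
      by (simp only: lact_add_mat lact_id_mat[OF xs])
    finally have "poly (pderiv P) 1 = of_nat M * f xs + lact N (\<lambda>i j. A i j - C i j) f xs"
      using m by (simp add: P_def pderiv_mult pderiv_monom poly_monom poly1 of_nat_diff algebra_simps)
    moreover have "poly (pderiv P) 1 = (\<Sum>s\<le>2*M. c s * (z s ^ M * gact N (\<lambda>i j. z s * A i j + B i j + inverse (z s) * C i j) f xs))"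
      unfolding cz(2)[OF degP]
    proof (intro sum.cong refl arg_cong2[of _ _ _ _ "(*)"])
      fix s assume "s \<in> {..2*M}"
      then have "z s \<noteq> 0" using cz(1)[of s] by auto
      then show "poly P (z s) = z s ^ M * gact N (\<lambda>i j. z s * A i j + B i j + inverse (z s) * C i j) f xs"
        by (rule evalP)
    qed
    ultimately show ?thesis by (simp add: mult.assoc)
  qed
  then show ?thesis
    using cz(1) by (intro exI[of _ "\<lambda>s. c s * z s ^ M"] exI[of _ z]) auto
qed

section \<open>Circle subgroups that generate the Lie algebra\<close>

definition bar :: "nat \<Rightarrow> nat \<Rightarrow> nat" where
  "bar n i = (if i < n then i + n else i - n)"

definition bar_sgn :: "nat \<Rightarrow> nat \<Rightarrow> complex" where
  "bar_sgn n i = (if i < n then 1 else -1)"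

lemma bar_less [simp]: "i < 2*n \<Longrightarrow> bar n i < 2*n"
  by (auto simp: bar_def)

lemma bar_bar [simp]: "i < 2*n \<Longrightarrow> bar n (bar n i) = i"
  by (auto simp: bar_def)

lemma bar_neq: "i < 2*n \<Longrightarrow> bar n i \<noteq> i"
  by (auto simp: bar_def)

lemma bar_sgn_square [simp]: "bar_sgn n i * bar_sgn n i = 1"
  by (simp add: bar_sgn_def)

lemma bar_sgn_bar: "i < 2*n \<Longrightarrow> bar_sgn n (bar n i) = - bar_sgn n i"
  by (auto simp: bar_sgn_def bar_def)

lemma sympl_bar: "i < 2*n \<Longrightarrow> j < 2*n \<Longrightarrow> sympl n i j = (if j = bar n i then bar_sgn n i else 0)"
  by (auto simp: sympl_def bar_def bar_sgn_def)

definition mono_mat :: "nat \<Rightarrow> (nat \<Rightarrow> nat) \<Rightarrow> (nat \<Rightarrow> complex) \<Rightarrow> cmat" where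
  "mono_mat N \<tau> \<kappa> i j = (if i < N \<and> j = \<tau> i then \<kappa> i else 0)"

text \<open>A skew-Hermitian monomial matrix \<open>K\<close> in the symplectic Lie algebra with \<open>K\<^sup>3 = -K\<close>; it generates the circle
  \<open>1 + s K + (1 - c) K\<^sup>2\<close> with \<open>c\<^sup>2 + s\<^sup>2 = 1\<close>.\<close>

locale skew_monomial =
  fixes n :: nat and \<tau> :: "nat \<Rightarrow> nat" and \<kappa> :: "nat \<Rightarrow> complex"
  assumes tau_less: "\<And>x. x < 2*n \<Longrightarrow> \<tau> x < 2*n"
    and tau_tau: "\<And>x. x < 2*n \<Longrightarrow> \<tau> (\<tau> x) = x"
    and tau_bar: "\<And>x. x < 2*n \<Longrightarrow> \<tau> (bar n x) = bar n (\<tau> x)"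
    and kappa_prod: "\<And>x. x < 2*n \<Longrightarrow> \<kappa> x = 0 \<or> \<kappa> x * \<kappa> (\<tau> x) = -1"
    and kappa_cnj: "\<And>x. x < 2*n \<Longrightarrow> cnj (\<kappa> (\<tau> x)) = - \<kappa> x"
    and kappa_bar: "\<And>x. x < 2*n \<Longrightarrow> \<kappa> (bar n x) = - (bar_sgn n x * bar_sgn n (\<tau> x) * \<kappa> (\<tau> x))"
begin

text \<open>The diagonal of \<open>- K\<^sup>2\<close>, the projection onto the coordinates on which
  \<open>K\<close> acts.\<close>

definition ep :: "nat \<Rightarrow> complex" where
  "ep x = - (\<kappa> x * \<kappa> (\<tau> x))"

lemma ep_cases: "x < 2*n \<Longrightarrow> ep x = 0 \<and> \<kappa> x = 0 \<or> ep x = 1"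
  using kappa_prod[of x] by (auto simp: ep_def)

lemma ep_tau: "x < 2*n \<Longrightarrow> ep (\<tau> x) = ep x"
  by (simp add: ep_def tau_tau mult.commute)

lemma ep_bar: "x < 2*n \<Longrightarrow> ep (bar n x) = ep x"
proof -
  assume x: "x < 2*n"
  have "ep (bar n x) = - (bar_sgn n x * bar_sgn n x) * (bar_sgn n (\<tau> x) * bar_sgn n (\<tau> x)) * (\<kappa> x * \<kappa> (\<tau> x))"
    unfolding ep_def tau_bar[OF x] kappa_bar[OF x] kappa_bar[OF tau_less[OF x]] tau_tau[OF x]
    by (simp add: algebra_simps)
  then show ?thesis by (simp add: ep_def)
qed

lemma ep_real: "x < 2*n \<Longrightarrow> cnj (ep x) = ep x"
  using ep_cases[of x] by auto

definition circ :: "real \<Rightarrow> real \<Rightarrow> cmat" where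
  "circ c s i j = (if i < 2*n \<and> j < 2*n then
     (if i = j then 1 - (1 - of_real c) * ep i else 0) + (if j = \<tau> i then of_real s * \<kappa> i else 0) else 0)"

lemma circ_eq:
  assumes "i < 2*n" "p < 2*n"
  shows "circ c s p i = (if p = i then 1 - (1 - of_real c) * ep i else 0)
    + (if p = \<tau> i then of_real s * \<kappa> (\<tau> i) else 0)"
  using assms tau_tau tau_less unfolding circ_def by auto

lemma sum_two_deltas:
  assumes "i < N" "i' < (N::nat)"
  shows "(\<Sum>p<N. ((if p = i then x else 0) + (if p = i' then y else 0)) * f p) = x * f i + y * (f i' :: complex)"
  using assms by (simp add: distrib_right sum.distrib if_distrib[of "\<lambda>x. x * _"] cong: if_cong)

lemma circ_norm:
  assumes "c\<^sup>2 + s\<^sup>2 = (1::real)" "x < 2*n"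
  shows "(1 - (1 - of_real c) * ep x) * (1 - (1 - of_real c) * ep x) + of_real s * of_real s * ep x = 1"
proof -
  have "complex_of_real c * of_real c + of_real s * of_real s = of_real (c\<^sup>2 + s\<^sup>2)"
    by (simp add: power2_eq_square)
  then have "complex_of_real c * of_real c + of_real s * of_real s = 1"
    using assms(1) by simp
  then show ?thesis using ep_cases[OF assms(2)] by auto
qed

text \<open>A column has at most two nonzero entries (\<open>circ_eq\<close>), so all sums collapse.
  The main terms add up to \<open>1\<close> by \<open>circ_norm\<close>; the mixed terms cancel by
  \<open>kappa_cnj\<close> in the unitary identity and by \<open>kappa_bar\<close> in the symplectic
  one.\<close>

lemma circ_cpt_sp:
  assumes cs: "c\<^sup>2 + s\<^sup>2 = 1"
  shows "circ c s \<in> cpt_sp n"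
proof -
  let ?a = "\<lambda>i. 1 - (1 - complex_of_real c) * ep i"
  have uni: "(\<Sum>p<2*n. cnj (circ c s p i) * circ c s p j) = (if i = j then 1 else 0)"
    if ij: "i < 2*n" "j < 2*n" for i j
  proof -
    have "(\<Sum>p<2*n. cnj (circ c s p i) * circ c s p j)
      = (\<Sum>p<2*n. ((if p = i then ?a i else 0) + (if p = \<tau> i then - (of_real s * \<kappa> i) else 0)) * circ c s p j)"
      using ij kappa_cnj[of i] ep_real[of i]
      by (intro sum.cong refl arg_cong2[of _ _ _ _ "(*)"]) (auto simp: circ_eq)
    also have "\<dots> = ?a i * circ c s i j + - (of_real s * \<kappa> i) * circ c s (\<tau> i) j"
      using ij tau_less by (intro sum_two_deltas) auto
    also have "\<dots> = (if i = j then 1 else 0)"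
    proof (cases "i = j")
      case True
      have "- (of_real s * \<kappa> i) * (of_real s * \<kappa> (\<tau> i)) = of_real s * of_real s * ep i"
        by (simp add: ep_def mult_ac)
      then show ?thesis
        using True ij tau_less[of i] tau_tau[of i] circ_norm[OF cs ij(1)] ep_tau[of i]
        by (cases "\<tau> i = i") (auto simp: circ_def algebra_simps)
    next
      case False
      then show ?thesis
        using ij tau_less[of i] tau_tau[of i] ep_tau[of i] by (auto simp: circ_def)
    qed
    finally show ?thesis .
  qed
  have "(\<Sum>p<2*n. \<Sum>q<2*n. circ c s p i * sympl n p q * circ c s q j) = sympl n i j"
    if ij: "i < 2*n" "j < 2*n" for i j
  proof -
    have "(\<Sum>p<2*n. \<Sum>q<2*n. circ c s p i * sympl n p q * circ c s q j)
      = (\<Sum>p<2*n. circ c s p i * (bar_sgn n p * circ c s (bar n p) j))"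
    proof (intro sum.cong refl)
      fix p assume p: "p \<in> {..<2*n}"
      have "(\<Sum>q<2*n. circ c s p i * sympl n p q * circ c s q j)
        = (\<Sum>q<2*n. if q = bar n p then circ c s p i * (bar_sgn n p * circ c s (bar n p) j) else 0)"
        using p by (intro sum.cong) (auto simp: sympl_bar)
      then show "(\<Sum>q<2*n. circ c s p i * sympl n p q * circ c s q j) = circ c s p i * (bar_sgn n p * circ c s (bar n p) j)"
        using p by simp
    qed
    also have "\<dots> = (\<Sum>p<2*n. ((if p = i then ?a i else 0) + (if p = \<tau> i then of_real s * \<kappa> (\<tau> i) else 0))
        * (bar_sgn n p * circ c s (bar n p) j))"
      using ij by (intro sum.cong refl arg_cong2[of _ _ _ _ "(*)"]) (auto simp: circ_eq)
    also have "\<dots> = ?a i * (bar_sgn n i * circ c s (bar n i) j) + of_real s * \<kappa> (\<tau> i) * (bar_sgn n (\<tau> i) * circ c s (bar n (\<tau> i)) j)"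
      using ij tau_less by (intro sum_two_deltas) auto
    also have "circ c s (bar n i) j = (if j = bar n i then ?a i else 0)
        + (if j = bar n (\<tau> i) then - (of_real s * bar_sgn n i * bar_sgn n (\<tau> i) * \<kappa> (\<tau> i)) else 0)"
    proof -
      have "ep (bar n i) = ep i" using ij ep_bar by simp
      then show ?thesis
        using ij by (auto simp: circ_def tau_bar kappa_bar)
    qed
    also have "circ c s (bar n (\<tau> i)) j = (if j = bar n (\<tau> i) then ?a i else 0)
        + (if j = bar n i then - (of_real s * bar_sgn n i * bar_sgn n (\<tau> i) * \<kappa> i) else 0)"
    proof -
      have "ep (bar n (\<tau> i)) = ep i" using ij ep_bar ep_tau tau_less by simp
      then show ?thesis
        using ij by (auto simp: circ_def tau_bar tau_less tau_tau kappa_bar)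
    qed
    also have "?a i * (bar_sgn n i * ((if j = bar n i then ?a i else 0)
        + (if j = bar n (\<tau> i) then - (of_real s * bar_sgn n i * bar_sgn n (\<tau> i) * \<kappa> (\<tau> i)) else 0)))
        + of_real s * \<kappa> (\<tau> i) * (bar_sgn n (\<tau> i) * ((if j = bar n (\<tau> i) then ?a i else 0)
        + (if j = bar n i then - (of_real s * bar_sgn n i * bar_sgn n (\<tau> i) * \<kappa> i) else 0)))
      = (if j = bar n i then bar_sgn n i * (?a i * ?a i + of_real s * of_real s * ep i * (bar_sgn n (\<tau> i) * bar_sgn n (\<tau> i))) else 0)
        + (if j = bar n (\<tau> i) then ?a i * of_real s * \<kappa> (\<tau> i) * bar_sgn n (\<tau> i) * (1 - bar_sgn n i * bar_sgn n i) else 0)"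
    proof -
      have sq: "bar_sgn n y * (bar_sgn n y * x) = x" for x y by (simp flip: mult.assoc)
      show ?thesis by (simp add: ep_def algebra_simps sq)
    qed
    also have "\<dots> = sympl n i j"
      using ij circ_norm[OF cs ij(1)] by (simp add: sympl_bar)
    finally show ?thesis .
  qed
  then show ?thesis
    using uni unfolding cpt_sp_def by (auto simp: circ_def)
qed

lemma lie_generator:
  "\<exists>(c :: nat \<Rightarrow> complex) g. (\<forall>s\<le>2*M. g s \<in> cpt_sp n) \<and>
    (\<forall>m f xs. m \<le> M \<longrightarrow> supported (2*n) m f \<longrightarrow>
      lact (2*n) (mono_mat (2*n) \<tau> \<kappa>) f xs
       = (\<Sum>s\<le>2*M. c s * gact (2*n) (g s) f xs) - \<i> * of_nat M * f xs)"
proof -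
  let ?N = "2*n"
  \<comment> \<open>\<open>A\<close>, \<open>B\<close> and \<open>C\<close> are the spectral
    projections of \<open>K\<close> for the eigenvalues \<open>\<i>\<close>, \<open>0\<close> and
    \<open>- \<i>\<close>: thus \<open>K = \<i> (A - C)\<close>, and for \<open>w\<close> on the
    unit circle \<open>w A + B + w^(-1) C\<close> is the circle element with cosine
    \<open>Re w\<close> and sine \<open>Im w\<close>.\<close>
  define d where "d i j = (if i < ?N \<and> j < ?N \<and> i = j then ep i / 2 else 0)" for i j
  define k where "k = mono_mat ?N \<tau> \<kappa>"
  define A where "A i j = d i j - \<i> / 2 * k i j" for i j
  define C where "C i j = d i j + \<i> / 2 * k i j" for i j
  define B where "B i j = id_mat ?N i j - 2 * d i j" for i j
  have "A i j + B i j + C i j = id_mat ?N i j" for i j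
    by (simp add: A_def B_def C_def)
  then obtain c z where cz: "\<And>s. s \<le> 2*M \<Longrightarrow> cmod (z s) = 1"
    "\<And>m f xs. m \<le> M \<Longrightarrow> xs \<in> idx ?N m \<Longrightarrow> lact ?N (\<lambda>i j. A i j - C i j) f xs
       = (\<Sum>s\<le>2*M. c s * gact ?N (\<lambda>i j. z s * A i j + B i j + inverse (z s) * C i j) f xs) - of_nat M * f xs"
    using one_parameter_derivative[of ?N A B C M] by blast
  have circ: "(\<lambda>i j. w * A i j + B i j + inverse w * C i j) = circ (Re w) (Im w)" if w: "cmod w = 1" for w
  proof (intro ext)
    fix i j
    have inv: "inverse w = cnj w"
      using w by (simp add: inverse_complex_def complex_eq_iff cmod_def)
    have re: "w + cnj w = 2 * of_real (Re w)" and im: "(cnj w - w) * (\<i> / 2) = of_real (Im w)"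
      by (simp_all add: complex_eq_iff)
    have "w * A i j + B i j + inverse w * C i j = (w + cnj w) * d i j + (cnj w - w) * (\<i> / 2) * k i j + B i j"
      unfolding inv A_def C_def by (simp add: field_simps)
    also have "\<dots> = id_mat ?N i j - 2 * d i j + 2 * of_real (Re w) * d i j + of_real (Im w) * k i j"
      unfolding re im B_def by simp
    also have "\<dots> = circ (Re w) (Im w) i j"
      using tau_less by (auto simp: circ_def d_def k_def mono_mat_def id_mat_def algebra_simps)
    finally show "w * A i j + B i j + inverse w * C i j = circ (Re w) (Im w) i j" .
  qed
  define g where "g s = circ (Re (z s)) (Im (z s))" for s
  have g: "g s \<in> cpt_sp n" if "s \<le> 2*M" for s
    unfolding g_def using cz(1)[OF that] by (intro circ_cpt_sp) (simp add: cmod_def)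
  have "lact ?N k f xs = (\<Sum>s\<le>2*M. (\<i> * c s) * gact ?N (g s) f xs) - \<i> * of_nat M * f xs"
    if m: "m \<le> M" and sup: "supported ?N m f" for m f xs
  proof (cases "xs \<in> idx ?N m")
    case True
    have "k = (\<lambda>i j. \<i> * (A i j - C i j))"
      by (simp add: fun_eq_iff A_def C_def algebra_simps)
    then have "lact ?N k f xs = \<i> * lact ?N (\<lambda>i j. A i j - C i j) f xs"
      by (simp only: lact_scale_mat)
    also have "\<dots> = (\<Sum>s\<le>2*M. (\<i> * c s) * gact ?N (g s) f xs) - \<i> * of_nat M * f xs"
      unfolding cz(2)[OF m True] using cz(1)
      by (simp add: right_diff_distrib sum_distrib_left mult.assoc circ g_def)
    finally show ?thesis .
  next
    case False
    have "supported ?N m (lact ?N k f)"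
      by (rule supported_lact[OF _ sup]) (simp add: k_def mono_mat_def)
    then have "lact ?N k f xs = 0" using False unfolding supported_def by blast
    moreover have "gact ?N (g s) f xs = 0" if "s \<le> 2*M" for s
      using supported_gact[OF g[OF that] sup] False unfolding supported_def by blast
    moreover have "f xs = 0" using sup False unfolding supported_def by blast
    ultimately show ?thesis by simp
  qed
  then show ?thesis
    unfolding k_def using g by (intro exI[of _ "\<lambda>s. \<i> * c s"] exI[of _ g]) blast
qed

end

text \<open>The spanning set \<open>E\<^sub>i\<^sub>j\<close> minus its symplectic adjoint of the complexified Lie algebra.\<close>

definition sp_unit :: "nat \<Rightarrow> nat \<Rightarrow> nat \<Rightarrow> cmat" where
  "sp_unit n i j x y = (if x = i \<and> y = j then 1 else 0)
    - bar_sgn n i * bar_sgn n j * (if x = bar n j \<and> y = bar n i then 1 else 0)"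

text \<open>This and the next two lemmas give three families whose complex span contains every
  \<open>sp_unit\<close>, according to whether \<open>j\<close> is \<open>i\<close>, its partner
  \<open>bar n i\<close>, or neither. In the last two families the phases
  \<open>\<omega> = 1\<close> and \<open>\<omega> = \<i>\<close> are combined to cancel the
  transposed entries.\<close>

lemma skew_monomial_diag:
  assumes "i < 2*n"
  shows "skew_monomial n (\<lambda>x. x) (\<lambda>x. if x = i then \<i> else if x = bar n i then - \<i> else 0)"
proof -
  have "bar n i \<noteq> i" "i \<noteq> bar n i" "bar n (bar n i) = i" using assms bar_neq[of i n] by auto
  moreover have "bar n x = i \<longleftrightarrow> x = bar n i" "bar n x = bar n i \<longleftrightarrow> x = i" if "x < 2*n" for x
    using that assms bar_bar by metis+
  ultimately show ?thesis by unfold_locales auto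
qed

lemma skew_monomial_opposite:
  assumes i: "i < 2*n" and \<omega>: "cmod \<omega> = 1"
  shows "skew_monomial n (\<lambda>x. if x = i then bar n i else if x = bar n i then i else x)
    (\<lambda>x. if x = i then \<omega> else if x = bar n i then - cnj \<omega> else 0)"
proof -
  have "\<omega> * cnj \<omega> = 1" using \<omega> complex_norm_square[of \<omega>] by simp
  moreover have "bar n i \<noteq> i" "bar n i < 2*n" "bar n (bar n i) = i" using i by (simp_all add: bar_neq)
  moreover have "bar n x = i \<longleftrightarrow> x = bar n i" "bar n x = bar n i \<longleftrightarrow> x = i" if "x < 2*n" for x
    using that i bar_bar by metis+
  ultimately show ?thesis
    using i bar_sgn_bar[OF i] by unfold_locales (auto simp: mult.commute)
qed

lemma skew_monomial_rotation:
  assumes ij: "i < 2*n" "j < 2*n" "j \<noteq> i" "j \<noteq> bar n i" and \<omega>: "cmod \<omega> = 1"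
  shows "skew_monomial n
    (\<lambda>x. if x = i then j else if x = j then i else if x = bar n i then bar n j else if x = bar n j then bar n i else x)
    (\<lambda>x. if x = i then \<omega> else if x = j then - cnj \<omega> else if x = bar n i then bar_sgn n i * bar_sgn n j * cnj \<omega>
       else if x = bar n j then - (bar_sgn n i * bar_sgn n j * \<omega>) else 0)"
proof -
  have w: "\<omega> * cnj \<omega> = 1" "cnj \<omega> * \<omega> = 1" using \<omega> complex_norm_square[of \<omega>] by (simp_all add: mult.commute)
  have b: "bar n i \<noteq> i" "bar n j \<noteq> j" "bar n i < 2*n" "bar n j < 2*n" "bar n (bar n i) = i" "bar n (bar n j) = j"
    using ij by (simp_all add: bar_neq)
  have "bar n j \<noteq> i" "bar n i \<noteq> bar n j" using ij b by metis+
  moreover have inj: "bar n x = bar n y \<longleftrightarrow> x = y" if "x < 2*n" "y < 2*n" for x y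
    using that bar_bar by metis
  moreover have "bar n x = i \<longleftrightarrow> x = bar n i" "bar n x = j \<longleftrightarrow> x = bar n j" if "x < 2*n" for x
    using that ij bar_bar by metis+
  moreover have "bar_sgn n i * bar_sgn n j * \<omega> * (bar_sgn n i * bar_sgn n j * cnj \<omega>) = 1"
    "bar_sgn n i * bar_sgn n j * cnj \<omega> * (bar_sgn n i * bar_sgn n j * \<omega>) = 1"
    using w by (auto simp: bar_sgn_def)
  moreover have "cnj (bar_sgn n x) = bar_sgn n x" for x by (simp add: bar_sgn_def)
  moreover have "bar_sgn n (bar n i) = - bar_sgn n i" "bar_sgn n (bar n j) = - bar_sgn n j" using ij bar_sgn_bar by auto
  moreover have "bar_sgn n i * (bar_sgn n i * x) = x" "bar_sgn n j * (bar_sgn n j * x) = x" "bar_sgn n j * (bar_sgn n i * (bar_sgn n i * (bar_sgn n j * x))) = x"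
    for x by (simp_all add: bar_sgn_def)
  ultimately show ?thesis
    using ij b w by unfold_locales (auto simp: mult_ac)
qed

section \<open>The Casimir operator\<close>

definition mat_prod :: "nat \<Rightarrow> cmat \<Rightarrow> cmat \<Rightarrow> cmat" where
  "mat_prod N A B i j = (\<Sum>p<N. A i p * B p j)"

definition cross :: "nat \<Rightarrow> cmat \<Rightarrow> cmat \<Rightarrow> tens \<Rightarrow> tens" where
  "cross N A B f xs = (\<Sum>r<length xs. \<Sum>s\<in>{..<length xs} - {r}. \<Sum>q<N. \<Sum>q'<N.
     A (xs!r) q * B (xs!s) q' * f (xs[r := q, s := q']))"

text \<open>Either both matrices act in the same slot, which gives their product, or in two
  different slots. The second part is symmetric in \<open>A\<close> and \<open>B\<close>
  (\<open>cross_commute\<close>), so commutators on tensors come from commutators of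
  matrices.\<close>

lemma lact_lact: "lact N A (lact N B f) xs = lact N (mat_prod N A B) f xs + cross N A B f xs"
proof -
  let ?m = "length xs"
  have "(\<Sum>q<N. A (xs!r) q * lact N B f (xs[r := q]))
      = (\<Sum>q<N. mat_prod N A B (xs!r) q * f (xs[r := q]))
        + (\<Sum>s\<in>{..<?m} - {r}. \<Sum>q<N. \<Sum>q'<N. A (xs!r) q * B (xs!s) q' * f (xs[r := q, s := q']))"
    if r: "r < ?m" for r
  proof -
    let ?h = "\<lambda>q s. \<Sum>q'<N. B (xs[r := q]!s) q' * f (xs[r := q, s := q'])"
    have "lact N B f (xs[r := q]) = (\<Sum>q'<N. B q q' * f (xs[r := q']))
        + (\<Sum>s\<in>{..<?m} - {r}. \<Sum>q'<N. B (xs!s) q' * f (xs[r := q, s := q']))" for q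
    proof -
      have "lact N B f (xs[r := q]) = ?h q r + sum (?h q) ({..<?m} - {r})"
        unfolding lact_def using r by (subst sum.remove[of _ r]) auto
      moreover have "sum (?h q) ({..<?m} - {r}) = (\<Sum>s\<in>{..<?m} - {r}. \<Sum>q'<N. B (xs!s) q' * f (xs[r := q, s := q']))"
        by (intro sum.cong) auto
      ultimately show ?thesis using r by simp
    qed
    then have "(\<Sum>q<N. A (xs!r) q * lact N B f (xs[r := q]))
      = (\<Sum>q<N. A (xs!r) q * (\<Sum>q'<N. B q q' * f (xs[r := q'])))
        + (\<Sum>q<N. A (xs!r) q * (\<Sum>s\<in>{..<?m} - {r}. \<Sum>q'<N. B (xs!s) q' * f (xs[r := q, s := q'])))"
      by (simp add: distrib_left sum.distrib)
    also have "(\<Sum>q<N. A (xs!r) q * (\<Sum>q'<N. B q q' * f (xs[r := q']))) = (\<Sum>q'<N. mat_prod N A B (xs!r) q' * f (xs[r := q']))"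
      unfolding mat_prod_def sum_distrib_left sum_distrib_right
      by (subst sum.swap) (simp add: mult.assoc)
    also have "(\<Sum>q<N. A (xs!r) q * (\<Sum>s\<in>{..<?m} - {r}. \<Sum>q'<N. B (xs!s) q' * f (xs[r := q, s := q'])))
      = (\<Sum>s\<in>{..<?m} - {r}. \<Sum>q<N. \<Sum>q'<N. A (xs!r) q * B (xs!s) q' * f (xs[r := q, s := q']))"
      unfolding sum_distrib_left by (subst sum.swap) (simp add: mult.assoc)
    finally show ?thesis .
  qed
  then show ?thesis
    unfolding lact_def[of N A "lact N B f"] lact_def[of N "mat_prod N A B"] cross_def
    by (simp add: sum.distrib)
qed

lemma cross_commute: "cross N A B f xs = cross N B A f xs"
proof -
  let ?m = "length xs"
  let ?t = "\<lambda>A B r s. \<Sum>q<N. \<Sum>q'<N. A (xs!r) q * B (xs!s) q' * f (xs[r := q, s := q'])"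
  have eq: "cross N A B f xs = (\<Sum>r<?m. \<Sum>s<?m. if s = r then 0 else ?t A B r s)" for A B
    unfolding cross_def
  proof (rule sum.cong[OF refl])
    fix r
    show "(\<Sum>s\<in>{..<?m} - {r}. ?t A B r s) = (\<Sum>s<?m. if s = r then 0 else ?t A B r s)"
      by (rule sum.mono_neutral_cong_left) auto
  qed
  have "?t A B r s = ?t B A s r" if "r \<noteq> s" for r s
    using that by (subst sum.swap) (auto simp: list_update_swap mult_ac intro!: sum.cong)
  then show ?thesis
    unfolding eq by (subst sum.swap) (auto intro!: sum.cong)
qed

lemma lact_commutator:
  "lact N A (lact N B f) xs = lact N B (lact N A f) xs + lact N (\<lambda>i j. mat_prod N A B i j + (-1) * mat_prod N B A i j) f xs"
  unfolding lact_add_mat lact_scale_mat by (simp add: lact_lact cross_commute[of N A B])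

lemma bar_eq_iff: "i < 2*n \<Longrightarrow> j < 2*n \<Longrightarrow> i = bar n j \<longleftrightarrow> j = bar n i"
  by auto

lemma lact_sp_unit:
  assumes "i < 2*n" "j < 2*n"
  shows "lact (2*n) (sp_unit n i j) f xs = (\<Sum>r<length xs. (if xs!r = i then f (xs[r := j]) else 0)
    - bar_sgn n i * bar_sgn n j * (if xs!r = bar n j then f (xs[r := bar n i]) else 0))"
  unfolding lact_def
proof (intro sum.cong refl)
  fix r
  have "(\<Sum>q<2*n. sp_unit n i j (xs!r) q * f (xs[r := q]))
    = (\<Sum>q<2*n. if q = j then (if xs!r = i then f (xs[r := j]) else 0) else 0)
      - (\<Sum>q<2*n. if q = bar n i then bar_sgn n i * bar_sgn n j * (if xs!r = bar n j then f (xs[r := bar n i]) else 0) else 0)"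
    unfolding sum_subtractf[symmetric] by (intro sum.cong) (auto simp: sp_unit_def algebra_simps)
  then show "(\<Sum>q<2*n. sp_unit n i j (xs!r) q * f (xs[r := q])) = (if xs!r = i then f (xs[r := j]) else 0)
    - bar_sgn n i * bar_sgn n j * (if xs!r = bar n j then f (xs[r := bar n i]) else 0)"
    using assms by simp
qed

definition weight :: "nat \<Rightarrow> nat \<Rightarrow> nat list \<Rightarrow> int" where
  "weight n p xs = (\<Sum>r<length xs. (if xs!r = p then 1 else 0) - (if xs!r = bar n p then 1 else 0))"

lemma lact_sp_unit_diag:
  assumes "i < 2*n"
  shows "lact (2*n) (sp_unit n i i) f xs = of_int (weight n i xs) * f xs"
proof -
  have upd: "xs[r := z] = xs" if "xs!r = z" for r z
    using that list_update_id[of xs r] by simp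
  have "lact (2*n) (sp_unit n i i) f xs
      = (\<Sum>r<length xs. of_int ((if xs!r = i then 1 else 0) - (if xs!r = bar n i then 1 else 0)) * f xs)"
    unfolding lact_sp_unit[OF assms assms] by (intro sum.cong) (auto simp: upd)
  then show ?thesis by (simp add: weight_def sum_distrib_right)
qed

lemma weight_bar: "i < 2*n \<Longrightarrow> weight n (bar n i) xs = - weight n i xs"
  unfolding weight_def sum_negf[symmetric] by (intro sum.cong) auto

lemma sp_unit_sym: "i < 2*n \<Longrightarrow> j < 2*n \<Longrightarrow> sp_unit n (bar n j) (bar n i) x y = - (bar_sgn n i * bar_sgn n j) * sp_unit n i j x y"
proof -
  assume ij: "i < 2*n" "j < 2*n"
  have 1: "bar_sgn n (bar n j) * bar_sgn n (bar n i) = bar_sgn n i * bar_sgn n j" using ij by (simp add: bar_sgn_bar)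
  have 2: "P - c * Q = - c * (Q - c * P)" if "c * c = 1" for P Q c :: complex
    using that by (simp add: right_diff_distrib flip: mult.assoc)
  have "bar_sgn n i * bar_sgn n j * (bar_sgn n i * bar_sgn n j) = 1" by (simp add: bar_sgn_def)
  then show "sp_unit n (bar n j) (bar n i) x y = - (bar_sgn n i * bar_sgn n j) * sp_unit n i j x y"
    unfolding sp_unit_def bar_bar[OF ij(1)] bar_bar[OF ij(2)] 1 by (rule 2)
qed

text \<open>As an operator on \<open>E \<otimes> E\<close> the split Casimir element is twice the
  flip minus twice the operator that contracts with the symplectic form and inserts it
  again.\<close>

lemma sp_unit_kernel:
  assumes "x < 2*n" "q < 2*n" "y < 2*n" "q' < 2*n"
  shows "(\<Sum>i<2*n. \<Sum>j<2*n. sp_unit n i j x q * sp_unit n j i y q')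
    = 2 * ((if q = y \<and> q' = x then 1 else 0) - bar_sgn n x * bar_sgn n q * (if y = bar n x \<and> q' = bar n q then 1 else 0))"
proof -
  let ?G = "\<lambda>i j. sp_unit n j i y q'"
  have "(\<Sum>i<2*n. \<Sum>j<2*n. sp_unit n i j x q * ?G i j)
    = (\<Sum>i<2*n. \<Sum>j<2*n. (if i = x then if j = q then ?G x q else 0 else 0)
       + (if i = bar n q then if j = bar n x then - (bar_sgn n x * bar_sgn n q) * ?G (bar n q) (bar n x) else 0 else 0))"
  proof (intro sum.cong refl)
    fix i j assume "i \<in> {..<2*n}" "j \<in> {..<2*n}"
    then have e: "x = bar n j \<longleftrightarrow> j = bar n x" "q = bar n i \<longleftrightarrow> i = bar n q"
      using bar_eq_iff[of x n j] bar_eq_iff[of q n i] assms by simp_all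
    have c: "bar_sgn n i * bar_sgn n j = bar_sgn n x * bar_sgn n q" if "i = bar n q" "j = bar n x"
      using assms by (simp add: bar_sgn_bar that)
    have "(x = i \<and> q = j) = (i = x \<and> j = q)" "(j = bar n x \<and> i = bar n q) = (i = bar n q \<and> j = bar n x)"
      by blast+
    then have "sp_unit n i j x q = (if i = x \<and> j = q then 1 else 0) - (if i = bar n q \<and> j = bar n x then bar_sgn n x * bar_sgn n q else 0)"
      unfolding sp_unit_def e using c
      by (cases "i = bar n q \<and> j = bar n x") (simp_all only: simp_thms if_True if_False mult_1_right mult_zero_right)
    then show "sp_unit n i j x q * ?G i j = (if i = x then if j = q then ?G x q else 0 else 0)
       + (if i = bar n q then if j = bar n x then - (bar_sgn n x * bar_sgn n q) * ?G (bar n q) (bar n x) else 0 else 0)"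
      by (simp add: left_diff_distrib)
  qed
  also have "\<dots> = ?G x q - bar_sgn n x * bar_sgn n q * ?G (bar n q) (bar n x)"
  proof -
    have "(\<Sum>i<2*n. \<Sum>j<2*n. if i = u then if j = v then c else 0 else 0) = c" if "u < 2*n" "v < 2*n"
      for u v and c :: complex
    proof -
      have "(\<Sum>i<2*n. \<Sum>j<2*n. if i = u then if j = v then c else 0 else 0) = (\<Sum>i<2*n. if i = u then c else 0)"
        using that by (intro sum.cong) auto
      then show ?thesis using that by simp
    qed
    then show ?thesis using assms unfolding sum.distrib by simp
  qed
  also have "?G (bar n q) (bar n x) = - (bar_sgn n q * bar_sgn n x) * ?G x q"
    using assms by (intro sp_unit_sym)
  also have "?G x q - bar_sgn n x * bar_sgn n q * (- (bar_sgn n q * bar_sgn n x) * ?G x q) = 2 * ?G x q"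
    by (simp add: bar_sgn_def)
  also have "?G x q = (if q = y \<and> q' = x then 1 else 0) - bar_sgn n x * bar_sgn n q * (if y = bar n x \<and> q' = bar n q then 1 else 0)"
    by (auto simp: sp_unit_def)
  finally show ?thesis .
qed

text \<open>The quadratic Casimir operator. The factor \<open>1/2\<close> normalises it so that a
  highest weight \<open>\<lambda>\<close> has eigenvalue
  \<open>(\<lambda>, \<lambda> + 2 \<rho>)\<close>, where \<open>\<rho>\<close> has the coordinates
  \<open>n - p\<close> for \<open>p < n\<close>.\<close>

definition casimir :: "nat \<Rightarrow> tens \<Rightarrow> tens" where
  "casimir n f xs = (\<Sum>i<2*n. \<Sum>j<2*n. lact (2*n) (sp_unit n i j) (lact (2*n) (sp_unit n j i) f) xs) / 2"

lemma contraction_bar: "contraction n r s f xs = (\<Sum>q<2*n. bar_sgn n q * f (xs[r := q, s := bar n q]))"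
  unfolding contraction_def
proof (intro sum.cong refl)
  fix \<mu> assume "\<mu> \<in> {..<2*n}"
  then have "(\<Sum>\<nu><2*n. sympl n \<mu> \<nu> * f (xs[r := \<mu>, s := \<nu>]))
      = (\<Sum>\<nu><2*n. if \<nu> = bar n \<mu> then bar_sgn n \<mu> * f (xs[r := \<mu>, s := bar n \<mu>]) else 0)"
    by (intro sum.cong) (auto simp: sympl_bar)
  then show "(\<Sum>\<nu><2*n. sympl n \<mu> \<nu> * f (xs[r := \<mu>, s := \<nu>])) = bar_sgn n \<mu> * f (xs[r := \<mu>, s := bar n \<mu>])"
    using \<open>\<mu> \<in> {..<2*n}\<close> by simp
qed

lemma sum4_rotate:
  "(\<Sum>i\<in>A. \<Sum>j\<in>B. \<Sum>r\<in>C. \<Sum>q\<in>D. h i j r q) = (\<Sum>r\<in>C. \<Sum>q\<in>D. \<Sum>i\<in>A. \<Sum>j\<in>B. h i j r q)"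
proof -
  have "(\<Sum>i\<in>A. \<Sum>j\<in>B. \<Sum>r\<in>C. \<Sum>q\<in>D. h i j r q) = (\<Sum>i\<in>A. \<Sum>r\<in>C. \<Sum>q\<in>D. \<Sum>j\<in>B. h i j r q)"
    by (rule sum.cong[OF refl], subst sum.swap, rule sum.cong[OF refl], rule sum.swap)
  also have "\<dots> = (\<Sum>r\<in>C. \<Sum>q\<in>D. \<Sum>i\<in>A. \<Sum>j\<in>B. h i j r q)"
    by (subst sum.swap, rule sum.cong[OF refl], rule sum.swap)
  finally show ?thesis .
qed

text \<open>Both factors in the same slot give the Casimir eigenvalue \<open>2*n + 1\<close> of
  \<open>E\<close> itself; in two different slots they give a flip and a contraction, by
  \<open>sp_unit_kernel\<close>.\<close>

lemma casimir_eq: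
  assumes xs: "xs \<in> idx (2*n) m"
  shows "casimir n f xs = of_nat ((2*n + 1) * m) * f xs + (\<Sum>r<m. \<Sum>s\<in>{..<m} - {r}. f (swp r s xs)
    - (if xs!s = bar n (xs!r) then bar_sgn n (xs!r) * contraction n r s f xs else 0))"
proof -
  let ?N = "2*n"
  define K where "K x q y q' = (if q = y \<and> q' = x then 1 else 0)
    - bar_sgn n x * bar_sgn n q * (if y = bar n x \<and> q' = bar n q then 1 else 0)" for x q y q'
  have len: "length xs = m" using xs by (rule length_idx)
  have lt: "xs!r < ?N" if "r < m" for r using xs that by (simp add: idx_iff)
  have "2 * casimir n f xs = (\<Sum>i<?N. \<Sum>j<?N. \<Sum>r<m. \<Sum>q<?N. \<Sum>s<m. \<Sum>q'<?N.
      sp_unit n i j (xs!r) q * sp_unit n j i (xs[r := q]!s) q' * f (xs[r := q, s := q']))"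
  proof -
    have "2 * casimir n f xs = (\<Sum>i<?N. \<Sum>j<?N. lact ?N (sp_unit n i j) (lact ?N (sp_unit n j i) f) xs)"
      by (simp add: casimir_def)
    then show ?thesis unfolding lact_def by (simp add: len sum_distrib_left mult.assoc)
  qed
  also have "\<dots> = (\<Sum>r<m. \<Sum>q<?N. \<Sum>i<?N. \<Sum>j<?N. \<Sum>s<m. \<Sum>q'<?N.
      sp_unit n i j (xs!r) q * sp_unit n j i (xs[r := q]!s) q' * f (xs[r := q, s := q']))"
    by (rule sum4_rotate)
  also have "\<dots> = (\<Sum>r<m. \<Sum>q<?N. \<Sum>s<m. \<Sum>q'<?N. \<Sum>i<?N. \<Sum>j<?N.
      sp_unit n i j (xs!r) q * sp_unit n j i (xs[r := q]!s) q' * f (xs[r := q, s := q']))"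
    by (intro sum.cong refl sum4_rotate)
  also have "\<dots> = (\<Sum>r<m. \<Sum>q<?N. \<Sum>s<m. \<Sum>q'<?N. 2 * (K (xs!r) q (xs[r := q]!s) q' * f (xs[r := q, s := q'])))"
  proof (intro sum.cong refl)
    fix r q s q' assume *: "r \<in> {..<m}" "q \<in> {..<?N}" "s \<in> {..<m}" "q' \<in> {..<?N}"
    then have "xs[r := q]!s < ?N" using lt len by (auto simp: nth_list_update)
    then show "(\<Sum>i<?N. \<Sum>j<?N. sp_unit n i j (xs!r) q * sp_unit n j i (xs[r := q]!s) q' * f (xs[r := q, s := q']))
      = 2 * (K (xs!r) q (xs[r := q]!s) q' * f (xs[r := q, s := q']))"
      using * sp_unit_kernel[of "xs!r" n q "xs[r := q]!s" q'] lt by (simp add: K_def flip: sum_distrib_right)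
  qed
  also have "\<dots> = 2 * (\<Sum>r<m. \<Sum>q<?N. \<Sum>s<m. \<Sum>q'<?N. K (xs!r) q (xs[r := q]!s) q' * f (xs[r := q, s := q']))"
    by (simp only: sum_distrib_left)
  also have "(\<Sum>r<m. \<Sum>q<?N. \<Sum>s<m. \<Sum>q'<?N. K (xs!r) q (xs[r := q]!s) q' * f (xs[r := q, s := q']))
    = (\<Sum>r<m. of_nat (2*n + 1) * f xs + (\<Sum>s\<in>{..<m} - {r}. f (swp r s xs)
      - (if xs!s = bar n (xs!r) then bar_sgn n (xs!r) * contraction n r s f xs else 0)))"
  proof (intro sum.cong refl)
    fix r assume "r \<in> {..<m}"
    then have r: "r < m" by simp
    let ?x = "xs!r"
    have inner: "(\<Sum>q'<?N. K ?x q y q' * h q') = (if q = y then h ?x else 0)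
        - (if y = bar n ?x then bar_sgn n ?x * bar_sgn n q * h (bar n q) else 0)" if "q < ?N" for q y h
    proof -
      have "(\<Sum>q'<?N. K ?x q y q' * h q') = (\<Sum>q'<?N. if q' = ?x then if q = y then h ?x else 0 else 0)
        - (\<Sum>q'<?N. if q' = bar n q then if y = bar n ?x then bar_sgn n ?x * bar_sgn n q * h (bar n q) else 0 else 0)"
        unfolding sum_subtractf[symmetric] by (intro sum.cong) (auto simp: K_def algebra_simps)
      then show ?thesis using lt[OF r] that by simp
    qed
    have "(\<Sum>q<?N. \<Sum>s<m. \<Sum>q'<?N. K ?x q (xs[r := q]!s) q' * f (xs[r := q, s := q']))
      = (\<Sum>s<m. \<Sum>q<?N. \<Sum>q'<?N. K ?x q (xs[r := q]!s) q' * f (xs[r := q, s := q']))"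
      by (rule sum.swap)
    also have "\<dots> = (\<Sum>q<?N. \<Sum>q'<?N. K ?x q q q' * f (xs[r := q']))
      + (\<Sum>s\<in>{..<m} - {r}. \<Sum>q<?N. \<Sum>q'<?N. K ?x q (xs!s) q' * f (xs[r := q, s := q']))"
    proof -
      let ?T = "\<lambda>s. \<Sum>q<?N. \<Sum>q'<?N. K ?x q (xs[r := q]!s) q' * f (xs[r := q, s := q'])"
      have 1: "sum ?T {..<m} = ?T r + sum ?T ({..<m} - {r})"
        using r by (intro sum.remove) auto
      have 2: "?T r = (\<Sum>q<?N. \<Sum>q'<?N. K ?x q q q' * f (xs[r := q']))"
        using r len by simp
      have 3: "sum ?T ({..<m} - {r})
          = (\<Sum>s\<in>{..<m} - {r}. \<Sum>q<?N. \<Sum>q'<?N. K ?x q (xs!s) q' * f (xs[r := q, s := q']))"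
        by (rule sum.cong[OF refl]) simp
      show ?thesis unfolding 1 2 3 ..
    qed
    also have "(\<Sum>q<?N. \<Sum>q'<?N. K ?x q q q' * f (xs[r := q'])) = of_nat (2*n + 1) * f xs"
    proof -
      have "(\<Sum>q<?N. \<Sum>q'<?N. K ?x q q q' * f (xs[r := q']))
        = (\<Sum>q<?N. f xs - (if q = bar n ?x then bar_sgn n ?x * bar_sgn n (bar n ?x) * f (xs[r := bar n (bar n ?x)]) else 0))"
        using inner by (intro sum.cong) auto
      also have "\<dots> = of_nat ?N * f xs - bar_sgn n ?x * bar_sgn n (bar n ?x) * f (xs[r := bar n (bar n ?x)])"
        using lt[OF r] by (simp add: sum_subtractf)
      also have "\<dots> = of_nat (2*n + 1) * f xs"
        using lt[OF r] by (simp add: bar_sgn_bar algebra_simps)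
      finally show ?thesis .
    qed
    also have "(\<Sum>s\<in>{..<m} - {r}. \<Sum>q<?N. \<Sum>q'<?N. K ?x q (xs!s) q' * f (xs[r := q, s := q']))
      = (\<Sum>s\<in>{..<m} - {r}. f (swp r s xs) - (if xs!s = bar n ?x then bar_sgn n ?x * contraction n r s f xs else 0))"
    proof (intro sum.cong refl)
      fix s assume s: "s \<in> {..<m} - {r}"
      have "(\<Sum>q<?N. \<Sum>q'<?N. K ?x q (xs!s) q' * f (xs[r := q, s := q']))
        = (\<Sum>q<?N. (if q = xs!s then f (xs[r := xs!s, s := ?x]) else 0)
          - (if xs!s = bar n ?x then bar_sgn n ?x * bar_sgn n q * f (xs[r := q, s := bar n q]) else 0))"
        using inner by (intro sum.cong) auto
      also have "\<dots> = f (swp r s xs) - (\<Sum>q<?N. if xs!s = bar n ?x then bar_sgn n ?x * bar_sgn n q * f (xs[r := q, s := bar n q]) else 0)"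
        using lt[of s] s by (simp add: sum_subtractf swp_def)
      also have "(\<Sum>q<?N. if xs!s = bar n ?x then bar_sgn n ?x * bar_sgn n q * f (xs[r := q, s := bar n q]) else 0)
        = (if xs!s = bar n ?x then bar_sgn n ?x * contraction n r s f xs else 0)"
        by (simp add: contraction_bar sum_distrib_left mult.assoc)
      finally show "(\<Sum>q<?N. \<Sum>q'<?N. K ?x q (xs!s) q' * f (xs[r := q, s := q']))
        = f (swp r s xs) - (if xs!s = bar n ?x then bar_sgn n ?x * contraction n r s f xs else 0)" .
    qed
    finally show "(\<Sum>q<?N. \<Sum>s<m. \<Sum>q'<?N. K ?x q (xs[r := q]!s) q' * f (xs[r := q, s := q']))
      = of_nat (2*n + 1) * f xs + (\<Sum>s\<in>{..<m} - {r}. f (swp r s xs)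
        - (if xs!s = bar n ?x then bar_sgn n ?x * contraction n r s f xs else 0))" .
  qed
  finally have "casimir n f xs = (\<Sum>r<m. of_nat (2*n + 1) * f xs + (\<Sum>s\<in>{..<m} - {r}. f (swp r s xs)
      - (if xs!s = bar n (xs!r) then bar_sgn n (xs!r) * contraction n r s f xs else 0)))"
    by (simp only: mult_cancel_left) simp
  then show ?thesis by (simp add: sum.distrib algebra_simps)
qed

lemma traceless_swap_slots: "traceless n m r s f \<Longrightarrow> r \<noteq> s \<Longrightarrow> traceless n m s r f"
proof -
  have skew: "sympl n x y = - sympl n y x" for x y by (auto simp: sympl_def)
  have "contraction n s r f xs = - contraction n r s f xs" if "r \<noteq> s" for xs
    unfolding contraction_def sum_negf[symmetric]
  proof (subst sum.swap, intro sum.cong refl)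
    fix \<mu> \<nu>
    show "sympl n \<nu> \<mu> * f (xs[s := \<nu>, r := \<mu>]) = - (sympl n \<mu> \<nu> * f (xs[r := \<mu>, s := \<nu>]))"
    proof -
      have "xs[s := \<nu>, r := \<mu>] = xs[r := \<mu>, s := \<nu>]"
        by (rule list_update_swap) (use that in simp)
      then show ?thesis using skew[of \<nu> \<mu>] by simp
    qed
  qed
  then show "traceless n m r s f \<Longrightarrow> r \<noteq> s \<Longrightarrow> traceless n m s r f"
    by (simp add: traceless_def)
qed

text \<open>Exchanging two slots changes \<open>f\<close> only by a sign, so traces in different
  pairs of slots agree up to sign. The definitions impose at most three traces, whereas
  \<open>casimir_eq\<close> contains all of them.\<close>

lemma traceless_transpose:
  assumes alt: "\<And>xs. length xs = m \<Longrightarrow> f (swp i j xs) = - f xs"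
    and ij: "i < m" "j < m" and rs: "r < m" "s < m" "r \<noteq> s"
    and tr: "traceless n m (transpose i j r) (transpose i j s) f"
  shows "traceless n m r s f"
  unfolding traceless_def
proof (intro allI impI)
  fix xs :: "nat list" assume len: "length xs = m"
  let ?\<pi> = "transpose i j"
  have "(swp i j xs)[?\<pi> r := \<mu>, ?\<pi> s := \<nu>] = swp i j (xs[r := \<mu>, s := \<nu>])" for \<mu> \<nu>
    by (rule nth_equalityI)
      (use ij rs len in \<open>auto simp: nth_swp nth_list_update transpose_def split: if_splits\<close>)
  then have "contraction n (?\<pi> r) (?\<pi> s) f (swp i j xs) = - contraction n r s f xs"
    unfolding contraction_def sum_negf[symmetric] using alt len by (intro sum.cong refl) simp
  moreover have "contraction n (?\<pi> r) (?\<pi> s) f (swp i j xs) = 0"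
    using tr len unfolding traceless_def by simp
  ultimately show "contraction n r s f xs = 0" by simp
qed

lemma swp_commute: "swp i j xs = swp j i xs"
  by (cases "i = j") (simp_all add: swp_def list_update_swap)

lemma alt1_swap:
  assumes "alt1 o' k f" "o' \<le> i" "o' \<le> j" "i < o' + k" "j < o' + k" "i \<noteq> j"
  shows "f (swp i j xs) = - f xs"
proof (cases "i < j")
  case False
  then have "f (swp j i xs) = - f xs" using assms unfolding alt1_def by simp
  then show ?thesis by (simp add: swp_commute[of i j])
qed (use assms in \<open>simp add: alt1_def\<close>)

lemma traceless_transpose_alt:
  assumes "alt1 o' k f" "o' + k \<le> m" "o' \<le> i" "o' \<le> j" "i < o' + k" "j < o' + k" "i \<noteq> j"
    and "r < m" "s < m" "r \<noteq> s" "traceless n m (transpose i j r) (transpose i j s) f"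
  shows "traceless n m r s f"
  by (rule traceless_transpose[of m f i j, OF alt1_swap[OF assms(1)]]) (use assms in simp_all)

lemma traceless_block:
  assumes alt: "alt1 o' k f" and m: "o' + k \<le> m" and tr: "2 \<le> k \<Longrightarrow> traceless n m o' (Suc o') f"
    and rs: "o' \<le> r" "o' \<le> s" "r < o' + k" "s < o' + k" "r \<noteq> s"
  shows "traceless n m r s f"
proof -
  have first: "traceless n m o' s f" if "s < o' + k" "o' < s" for s
  proof (cases "s = Suc o'")
    case False
    show ?thesis
      by (rule traceless_transpose_alt[OF alt m, of "Suc o'" s])
        (use that m tr False in \<open>auto simp: transpose_def\<close>)
  qed (use tr that in auto)
  consider "r = o'" | "s = o'" | "r \<noteq> o'" "s \<noteq> o'" by blast
  then show ?thesis
  proof cases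
    case 1
    then show ?thesis using first rs by auto
  next
    case 2
    then show ?thesis using first[of r] rs by (intro traceless_swap_slots[of n m s r]) auto
  next
    case 3
    show ?thesis
      by (rule traceless_transpose_alt[OF alt m, of o' r])
        (use 3 rs m first[of s] in \<open>auto simp: transpose_def\<close>)
  qed
qed

lemma traceless_cross:
  assumes alt: "alt1 0 a f" "alt1 a b f" and tr: "traceless n (a + b) 0 a f" and rs: "r < a" "a \<le> s" "s < a + b"
  shows "traceless n (a + b) r s f"
proof -
  have 1: "traceless n (a + b) r a f"
  proof (cases "r = 0")
    case False
    show ?thesis
      by (rule traceless_transpose_alt[OF alt(1), of _ 0 r])
        (use False rs tr in \<open>auto simp: transpose_def\<close>)
  qed (use tr in simp)
  show ?thesis
  proof (cases "s = a")
    case False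
    show ?thesis
      by (rule traceless_transpose_alt[OF alt(2), of _ a s])
        (use False rs 1 in \<open>auto simp: transpose_def\<close>)
  qed (use 1 in simp)
qed

lemma top_blocks_traceless:
  assumes V: "top_blocks n a b f" and rs: "r < a + b" "s < a + b" "r \<noteq> s"
  shows "traceless n (a + b) r s f"
proof -
  have alt: "alt1 0 a f" "alt1 a b f" and tr: "2 \<le> a \<Longrightarrow> traceless n (a + b) 0 (Suc 0) f"
    "2 \<le> b \<Longrightarrow> traceless n (a + b) a (Suc a) f" "1 \<le> a \<Longrightarrow> 1 \<le> b \<Longrightarrow> traceless n (a + b) 0 a f"
    using V unfolding top_blocks_def prim_blocks_def by auto
  consider "r < a" "s < a" | "a \<le> r" "a \<le> s" | "r < a" "a \<le> s" | "a \<le> r" "s < a" by linarith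
  then show ?thesis
  proof cases
    case 1
    show ?thesis by (rule traceless_block[OF alt(1)]) (use 1 rs tr in auto)
  next
    case 2
    show ?thesis by (rule traceless_block[OF alt(2)]) (use 2 rs tr in auto)
  next
    case 3
    then show ?thesis using rs by (intro traceless_cross[OF alt tr(3)]) auto
  next
    case 4
    then have "traceless n (a + b) s r f" using rs by (intro traceless_cross[OF alt tr(3)]) auto
    then show ?thesis using rs by (intro traceless_swap_slots[of n _ s r]) auto
  qed
qed

lemma top_blocks_plucker:
  assumes V: "top_blocks n a b f" and s: "a \<le> s" "s < a + b" and len: "length xs = a + b"
  shows "(\<Sum>p<a. f (swp p s xs)) = f xs"
proof (cases "s = a")
  case True
  then show ?thesis using V s len unfolding top_blocks_def plucker_def by auto
next
  case False
  have alt: "f (swp a s ys) = - f ys" for ys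
    using V s False unfolding top_blocks_def prim_blocks_def by (intro alt1_swap[of a b]) auto
  have "swp p s xs = swp a s (swp p a (swp a s xs))" if "p < a" for p
    by (rule nth_equalityI) (use that s len False in \<open>auto simp: nth_swp\<close>)
  then have "(\<Sum>p<a. f (swp p s xs)) = (\<Sum>p<a. - f (swp p a (swp a s xs)))"
    by (intro sum.cong refl) (simp add: alt)
  also have "\<dots> = - f (swp a s xs)"
    using V s len unfolding top_blocks_def plucker_def by (simp add: sum_negf)
  finally show ?thesis by (simp add: alt)
qed

lemma sp_unit_zero:
  assumes "i < 2*n" "j < 2*n" "2*n \<le> x"
  shows "sp_unit n i j x y = 0"
proof -
  have "x \<noteq> bar n j" using bar_less[OF assms(2)] assms(3) by linarith
  then show ?thesis using assms by (simp add: sp_unit_def)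
qed

text \<open>Tracelessness leaves only the flips. Flips inside a block give \<open>-1\<close> each,
  in total \<open>- a * (a - 1) - b * (b - 1)\<close>; for each slot of the second block the flips
  with the first block add up to \<open>1\<close> by the Pluecker relation, in both orders, which
  gives \<open>2 * b\<close>. Adding \<open>(2*n + 1) * (a + b)\<close> yields the
  eigenvalue.\<close>

lemma casimir_top_blocks:
  assumes V: "top_blocks n a b f"
  shows "casimir n f xs = of_int (int a * (2 * int n + 2 - int a) + int b * (2 * int n + 4 - int b)) * f xs"
proof (cases "xs \<in> idx (2*n) (a + b)")
  case True
  then have len: "length xs = a + b" by (rule length_idx)
  have alt: "alt1 0 a f" "alt1 a b f" using V unfolding top_blocks_def prim_blocks_def by auto
  let ?m = "a + b"
  have split: "{..<?m} = {..<a} \<union> {a..<?m}" "{..<a} \<inter> {a..<?m} = {}" by auto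
  have "(\<Sum>r<?m. \<Sum>s\<in>{..<?m} - {r}. f (swp r s xs) - (if xs!s = bar n (xs!r) then bar_sgn n (xs!r) * contraction n r s f xs else 0))
    = (\<Sum>r<?m. \<Sum>s\<in>{..<?m} - {r}. f (swp r s xs))"
    using top_blocks_traceless[OF V] len unfolding traceless_def by (intro sum.cong refl) simp
  also have "\<dots> = (\<Sum>r<a. \<Sum>s\<in>{..<?m} - {r}. f (swp r s xs)) + (\<Sum>r=a..<?m. \<Sum>s\<in>{..<?m} - {r}. f (swp r s xs))"
    unfolding split(1) by (rule sum.union_disjoint) auto
  also have "(\<Sum>r<a. \<Sum>s\<in>{..<?m} - {r}. f (swp r s xs)) = (\<Sum>r<a. - of_int (int a - 1) * f xs + (\<Sum>s=a..<?m. f (swp r s xs)))"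
  proof (intro sum.cong refl)
    fix r assume r: "r \<in> {..<a}"
    then have eq: "{..<?m} - {r} = ({..<a} - {r}) \<union> {a..<?m}" by auto
    have "(\<Sum>s\<in>{..<?m} - {r}. f (swp r s xs)) = (\<Sum>s\<in>{..<a} - {r}. f (swp r s xs)) + (\<Sum>s=a..<?m. f (swp r s xs))"
      by (subst eq, rule sum.union_disjoint) auto
    also have "(\<Sum>s\<in>{..<a} - {r}. f (swp r s xs)) = (\<Sum>s\<in>{..<a} - {r}. - f xs)"
      using r by (intro sum.cong refl alt1_swap[OF alt(1)]) auto
    also have "\<dots> = - of_int (int a - 1) * f xs"
      using r by (simp add: of_nat_diff algebra_simps)
    finally show "(\<Sum>s\<in>{..<?m} - {r}. f (swp r s xs)) = - of_int (int a - 1) * f xs + (\<Sum>s=a..<?m. f (swp r s xs))" .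
  qed
  also have "\<dots> = - of_int (int a * (int a - 1)) * f xs + of_nat b * f xs"
  proof -
    have "(\<Sum>r<a. \<Sum>s=a..<?m. f (swp r s xs)) = (\<Sum>s=a..<?m. \<Sum>r<a. f (swp r s xs))"
      by (rule sum.swap)
    also have "\<dots> = (\<Sum>s=a..<?m. f xs)"
      using top_blocks_plucker[OF V _ _ len] by (intro sum.cong) auto
    finally have "(\<Sum>r<a. \<Sum>s=a..<?m. f (swp r s xs)) = of_nat b * f xs" by simp
    then show ?thesis by (simp only: sum.distrib) (simp add: algebra_simps)
  qed
  also have "(\<Sum>r=a..<?m. \<Sum>s\<in>{..<?m} - {r}. f (swp r s xs)) = (\<Sum>r=a..<?m. - of_int (int b - 1) * f xs + f xs)"
  proof (intro sum.cong refl)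
    fix r assume r: "r \<in> {a..<?m}"
    then have eq: "{..<?m} - {r} = ({a..<?m} - {r}) \<union> {..<a}" by auto
    have "(\<Sum>s\<in>{..<?m} - {r}. f (swp r s xs)) = (\<Sum>s\<in>{a..<?m} - {r}. f (swp r s xs)) + (\<Sum>s<a. f (swp r s xs))"
      by (subst eq, rule sum.union_disjoint) auto
    also have "(\<Sum>s<a. f (swp r s xs)) = f xs"
      using top_blocks_plucker[OF V _ _ len, of r] r by (simp add: swp_commute[of r])
    also have "(\<Sum>s\<in>{a..<?m} - {r}. f (swp r s xs)) = (\<Sum>s\<in>{a..<?m} - {r}. - f xs)"
      using r by (intro sum.cong refl alt1_swap[OF alt(2)]) auto
    also have "\<dots> = - of_int (int b - 1) * f xs"
      using r by (simp add: of_nat_diff algebra_simps)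
    finally show "(\<Sum>s\<in>{..<?m} - {r}. f (swp r s xs)) = - of_int (int b - 1) * f xs + f xs" .
  qed
  finally show ?thesis
    unfolding casimir_eq[OF True] by (simp add: algebra_simps)
next
  case False
  have sup: "supported (2*n) (a + b) f" using V unfolding top_blocks_def prim_blocks_def by auto
  have "lact (2*n) (sp_unit n i j) (lact (2*n) (sp_unit n j i) f) xs = 0" if "i < 2*n" "j < 2*n" for i j
  proof -
    have "supported (2*n) (a + b) (lact (2*n) (sp_unit n i j) (lact (2*n) (sp_unit n j i) f))"
      using that by (intro supported_lact sup) (auto intro: sp_unit_zero)
    then show ?thesis using False unfolding supported_def by blast
  qed
  moreover have "f xs = 0" using sup False unfolding supported_def by blast
  ultimately show ?thesis by (simp add: casimir_def)
qed

text \<open>A symmetric tensor has vanishing contractions with the skew form, and every flip gives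
  \<open>+1\<close>; hence the eigenvalue \<open>3 * k + k * (k - 1)\<close>.\<close>

lemma casimir_sym_blocks:
  assumes S: "sym_blocks k 0 f"
  shows "casimir 1 f xs = of_int (int k * (int k + 2)) * f xs"
proof (cases "xs \<in> idx (2*1) k")
  case True
  then have len: "length xs = k" by (rule length_idx)
  have sym: "f (swp r s ys) = f ys" if "r < k" "s < k" "r \<noteq> s" for r s ys
  proof (cases "r < s")
    case False
    then have "f (swp s r ys) = f ys" using S that unfolding sym_blocks_def sym1_def by simp
    then show ?thesis by (simp add: swp_commute[of r s])
  qed (use S that in \<open>simp add: sym_blocks_def sym1_def\<close>)
  have tr: "contraction 1 r s f xs = 0" if "r < k" "s < k" "r \<noteq> s" for r s
  proof -
    have "{..<2*1} = {0, 1::nat}" by auto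
    then have "contraction 1 r s f xs = f (xs[r := 0, s := 1]) - f (xs[r := 1, s := 0])"
      unfolding contraction_bar by (simp add: bar_sgn_def bar_def)
    moreover have "swp r s (xs[r := 0, s := 1]) = xs[r := 1, s := 0]"
      by (rule nth_equalityI) (use that len in \<open>auto simp: nth_swp nth_list_update\<close>)
    ultimately show ?thesis using sym[OF that] by (metis diff_self)
  qed
  have "(\<Sum>r<k. \<Sum>s\<in>{..<k} - {r}. f (swp r s xs) - (if xs!s = bar 1 (xs!r) then bar_sgn 1 (xs!r) * contraction 1 r s f xs else 0))
    = (\<Sum>r<k. \<Sum>s\<in>{..<k} - {r}. f xs)"
    using tr sym by (intro sum.cong refl) auto
  also have "\<dots> = (\<Sum>r<k. of_int (int k - 1) * f xs)"
    by (intro sum.cong refl) (simp add: of_nat_diff)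
  finally show ?thesis
    unfolding casimir_eq[OF True] by (simp add: algebra_simps)
next
  case False
  have sup: "supported (2*1) k f" using S unfolding sym_blocks_def by simp
  have "lact (2*1) (sp_unit 1 i j) (lact (2*1) (sp_unit 1 j i) f) xs = 0" if "i < 2*1" "j < 2*1" for i j
  proof -
    have "supported (2*1) k (lact (2*1) (sp_unit 1 i j) (lact (2*1) (sp_unit 1 j i) f))"
      using that by (intro supported_lact sup) (auto intro: sp_unit_zero)
    then show ?thesis using False unfolding supported_def by blast
  qed
  moreover have "f xs = 0" using sup False unfolding supported_def by blast
  ultimately show ?thesis by (simp add: casimir_def)
qed

text \<open>The height: \<open>sp_unit n i j\<close> is a raising operator iff \<open>eta n j < eta n i\<close>; the order of the
  basis is \<open>0, \<dots>, n - 1, 2n - 1, \<dots>, n\<close> from highest to lowest.\<close>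

definition eta :: "nat \<Rightarrow> nat \<Rightarrow> nat" where
  "eta n i = (if i < n then 2*n - i else i - n)"

definition highest_weight :: "nat \<Rightarrow> tens \<Rightarrow> bool" where
  "highest_weight n f \<longleftrightarrow> (\<forall>i<2*n. \<forall>j<2*n. eta n j < eta n i \<longrightarrow> (\<forall>xs. lact (2*n) (sp_unit n i j) f xs = 0))"

lemma mat_prod_sp_unit:
  assumes "i < 2*n" "j < 2*n"
  shows "mat_prod (2*n) (sp_unit n i j) B x y = (if x = i then B j y else 0)
    - bar_sgn n i * bar_sgn n j * (if x = bar n j then B (bar n i) y else 0)"
proof -
  have "mat_prod (2*n) (sp_unit n i j) B x y = (\<Sum>p<2*n. if p = j then if x = i then B j y else 0 else 0)
    - (\<Sum>p<2*n. if p = bar n i then bar_sgn n i * bar_sgn n j * (if x = bar n j then B (bar n i) y else 0) else 0)"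
    unfolding mat_prod_def sum_subtractf[symmetric] by (intro sum.cong) (auto simp: sp_unit_def algebra_simps)
  then show ?thesis using assms by simp
qed

text \<open>For a long root, \<open>j = bar n i\<close>, the two summands of \<open>sp_unit\<close>
  coincide and double the matrix unit. The commutator is then \<open>4\<close> times the diagonal
  element of \<open>i\<close>; the difference of the diagonal elements supplies only
  \<open>2\<close> of this.\<close>

lemma sp_unit_commutator:
  assumes ij: "i < 2*n" "j < 2*n" "i \<noteq> j"
  shows "mat_prod (2*n) (sp_unit n i j) (sp_unit n j i) x y + (-1) * mat_prod (2*n) (sp_unit n j i) (sp_unit n i j) x y
    = (sp_unit n i i x y + (-1) * sp_unit n j j x y) + (if j = bar n i then 2 else 0) * sp_unit n i i x y"
proof (cases "j = bar n i")
  case True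
  then have j: "bar n j = i" "bar_sgn n j = - bar_sgn n i" using ij by (simp_all add: bar_sgn_bar)
  show ?thesis
    using ij True j by (simp add: mat_prod_sp_unit) (auto simp: sp_unit_def bar_sgn_def bar_neq split: if_splits)
next
  case False
  then have "bar n j \<noteq> i" using ij bar_eq_iff by metis
  moreover have "bar n i \<noteq> bar n j" using ij bar_bar by metis
  ultimately show ?thesis
    using ij False bar_neq[of i n] bar_neq[of j n]
    by (simp add: mat_prod_sp_unit) (auto simp: sp_unit_def bar_sgn_def split: if_splits)
qed


lemma eta_inj: "i < 2*n \<Longrightarrow> j < 2*n \<Longrightarrow> eta n i = eta n j \<Longrightarrow> i = j"
  by (auto simp: eta_def split: if_splits)

lemma card_below_above:
  assumes "p < n"
  shows "card {j. j < 2*n \<and> eta n j < eta n p} = 2*n - 1 - p"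
    and "card {j. j < 2*n \<and> eta n p < eta n j} = p"
    and "card {j. j < 2*n \<and> eta n j < eta n (p + n)} = p"
    and "card {j. j < 2*n \<and> eta n (p + n) < eta n j} = 2*n - 1 - p"
proof -
  have "{j. j < 2*n \<and> eta n j < eta n p} = {p<..<n} \<union> {n..<2*n}"
    "{j. j < 2*n \<and> eta n p < eta n j} = {..<p}"
    "{j. j < 2*n \<and> eta n j < eta n (p + n)} = {n..<n+p}"
    "{j. j < 2*n \<and> eta n (p + n) < eta n j} = {..<n} \<union> {n+p<..<2*n}"
    using assms by (auto simp: eta_def split: if_splits)
  moreover have "card ({p<..<n} \<union> {n..<2*n}) = 2*n - 1 - p"
    using assms by (subst card_Un_disjoint) auto
  moreover have "card ({..<n} \<union> {n+p<..<2*n}) = 2*n - 1 - p"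
    using assms by (subst card_Un_disjoint) auto
  ultimately show "card {j. j < 2*n \<and> eta n j < eta n p} = 2*n - 1 - p"
    "card {j. j < 2*n \<and> eta n p < eta n j} = p"
    "card {j. j < 2*n \<and> eta n j < eta n (p + n)} = p"
    "card {j. j < 2*n \<and> eta n (p + n) < eta n j} = 2*n - 1 - p"
    by simp_all
qed

lemma sum_double:
  fixes g :: "nat \<Rightarrow> int"
  shows "(\<Sum>i<2*n. g i) = (\<Sum>p<n. g p + g (p + n))"
proof -
  have "(\<Sum>i<2*n. g i) = (\<Sum>i<n. g i) + (\<Sum>i=n..<n+n. g i)"
    by (simp add: lessThan_atLeast0 mult_2 sum.atLeastLessThan_concat)
  also have "(\<Sum>i=n..<n+n. g i) = (\<Sum>p<n. g (p + n))"
    using sum.shift_bounds_nat_ivl[of g 0 n n] by (simp add: lessThan_atLeast0)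
  finally show ?thesis by (simp add: sum.distrib)
qed

text \<open>If \<open>sp_unit n i j\<close> is raising, only the commutator of the product survives,
  and it acts by weights; if it is lowering, the inner operator is raising and kills
  \<open>w\<close>. The formula is pointwise, with the weight read off from \<open>xs\<close>, so it
  applies to sums of vectors of different weights.\<close>

lemma casimir_highest_weight:
  assumes "highest_weight n w"
  shows "casimir n w xs = of_int (\<Sum>p<n. (weight n p xs)\<^sup>2 + 2 * (int n - int p) * weight n p xs) * w xs"
proof -
  let ?N = "2*n"
  define W where "W i = weight n i xs" for i
  define t where "t i j = (if i = j then (W i)\<^sup>2 else if eta n j < eta n i then W i - W j + (if j = bar n i then 2 * W i else 0) else 0)" for i j
  have zero: "lact ?N A (\<lambda>xs. 0) ys = 0" for A ys by (simp add: lact_def)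
  have "lact ?N (sp_unit n i j) (lact ?N (sp_unit n j i) w) xs = of_int (t i j) * w xs" if ij: "i < ?N" "j < ?N" for i j
  proof -
    have hw: "lact ?N (sp_unit n i' j') w = (\<lambda>xs. 0)" if "i' < ?N" "j' < ?N" "eta n j' < eta n i'" for i' j'
      using assms that unfolding highest_weight_def by blast
    consider "i = j" | "i \<noteq> j" "eta n j < eta n i" | "i \<noteq> j" "eta n i < eta n j"
      using eta_inj[OF ij] by linarith
    then show ?thesis
    proof cases
      case 1
      have "lact ?N (sp_unit n i i) w = (\<lambda>ys. of_int (weight n i ys) * w ys)" for w
        using lact_sp_unit_diag[OF ij(1)] by blast
      then show ?thesis using 1 by (simp add: t_def W_def power2_eq_square)
    next
      case 2
      have "lact ?N (sp_unit n i j) (lact ?N (sp_unit n j i) w) xs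
        = lact ?N (\<lambda>x y. (sp_unit n i i x y + (-1) * sp_unit n j j x y) + (if j = bar n i then 2 else 0) * sp_unit n i i x y) w xs"
        unfolding lact_commutator[of ?N "sp_unit n i j"] hw[OF ij 2(2)] sp_unit_commutator[OF ij 2(1)] zero by simp
      also have "\<dots> = of_int (t i j) * w xs"
        unfolding lact_add_mat lact_scale_mat lact_sp_unit_diag[OF ij(1)] lact_sp_unit_diag[OF ij(2)]
        using 2 by (simp add: t_def W_def algebra_simps)
      finally show ?thesis .
    next
      case 3
      then show ?thesis using hw[OF ij(2,1)] zero by (simp add: t_def)
    qed
  qed
  then have "2 * casimir n w xs = (\<Sum>i<?N. \<Sum>j<?N. of_int (t i j) * w xs)"
    unfolding casimir_def by simp
  also have "\<dots> = of_int (\<Sum>i<?N. \<Sum>j<?N. t i j) * w xs"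
    by (simp add: sum_distrib_right)
  also have "(\<Sum>i<?N. \<Sum>j<?N. t i j) = 2 * (\<Sum>p<n. (W p)\<^sup>2 + 2 * (int n - int p) * W p)"
  proof -
    let ?P = "\<lambda>i j. eta n j < eta n i"
    have "(\<Sum>i<?N. \<Sum>j<?N. t i j) = (\<Sum>i<?N. \<Sum>j<?N. (if j = i then (W i)\<^sup>2 else 0)
        + (if ?P i j then W i else 0) - (if ?P i j then W j else 0)
        + (if j = bar n i then if ?P i j then 2 * W i else 0 else 0))"
      using bar_neq by (intro sum.cong refl) (auto simp: t_def)
    also have "\<dots> = (\<Sum>i<?N. \<Sum>j<?N. if j = i then (W i)\<^sup>2 else 0) + (\<Sum>i<?N. \<Sum>j<?N. if ?P i j then W i else 0)
        - (\<Sum>i<?N. \<Sum>j<?N. if ?P i j then W j else 0)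
        + (\<Sum>i<?N. \<Sum>j<?N. if j = bar n i then if ?P i j then 2 * W i else 0 else 0)"
      by (simp only: sum.distrib sum_subtractf)
    also have "(\<Sum>i<?N. \<Sum>j<?N. if j = i then (W i)\<^sup>2 else 0) = (\<Sum>i<?N. (W i)\<^sup>2)"
      by (intro sum.cong) auto
    also have "(\<Sum>i<?N. \<Sum>j<?N. if ?P i j then W i else 0) = (\<Sum>i<?N. int (card {j. j < ?N \<and> ?P i j}) * W i)"
      by (intro sum.cong refl) (simp add: sum.If_cases Int_def)
    also have "(\<Sum>i<?N. \<Sum>j<?N. if ?P i j then W j else 0) = (\<Sum>j<?N. int (card {i. i < ?N \<and> ?P i j}) * W j)"
      by (subst sum.swap, intro sum.cong refl) (simp add: sum.If_cases Int_def)
    also have "(\<Sum>i<?N. \<Sum>j<?N. if j = bar n i then if ?P i j then 2 * W i else 0 else 0)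
        = (\<Sum>i<?N. if ?P i (bar n i) then 2 * W i else 0)"
      by (intro sum.cong) auto
    also have "(\<Sum>i<?N. (W i)\<^sup>2) + (\<Sum>i<?N. int (card {j. j < ?N \<and> ?P i j}) * W i)
        - (\<Sum>j<?N. int (card {i. i < ?N \<and> ?P i j}) * W j) + (\<Sum>i<?N. if ?P i (bar n i) then 2 * W i else 0)
      = (\<Sum>i<?N. (W i)\<^sup>2 + int (card {j. j < ?N \<and> ?P i j}) * W i - int (card {j. j < ?N \<and> ?P j i}) * W i
          + (if ?P i (bar n i) then 2 * W i else 0))"
      by (simp only: sum.distrib sum_subtractf)
    also have "\<dots> = (\<Sum>p<n. 2 * ((W p)\<^sup>2 + 2 * (int n - int p) * W p))"
      unfolding sum_double
    proof (intro sum.cong refl)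
      fix p assume "p \<in> {..<n}"
      then have p: "p < n" by simp
      then have "W (p + n) = - W p"
        using weight_bar[of p n xs] by (simp add: W_def bar_def)
      \<comment> \<open>Together \<open>p\<close> and its partner give \<open>W p\<close> the
        coefficient \<open>2 * (2*n - 1 - 2*p)\<close> from the counts and \<open>2\<close> from the
        long root, hence \<open>4 * (n - p)\<close>.\<close>
      moreover have "?P p (bar n p)" "\<not> ?P (p + n) (bar n (p + n))"
        using p by (simp_all add: eta_def bar_def)
      moreover have "int (2*n - 1 - p) = 2 * int n - 1 - int p" using p by simp
      ultimately show "(W p)\<^sup>2 + int (card {j. j < ?N \<and> ?P p j}) * W p - int (card {j. j < ?N \<and> ?P j p}) * W p
          + (if ?P p (bar n p) then 2 * W p else 0)
          + ((W (p + n))\<^sup>2 + int (card {j. j < ?N \<and> ?P (p + n) j}) * W (p + n)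
            - int (card {j. j < ?N \<and> ?P j (p + n)}) * W (p + n)
            + (if ?P (p + n) (bar n (p + n)) then 2 * W (p + n) else 0))
        = 2 * ((W p)\<^sup>2 + 2 * (int n - int p) * W p)"
        by (simp only: card_below_above[OF p] if_True if_False) (simp add: algebra_simps)
    qed
    finally show ?thesis by (simp add: sum_distrib_left)
  qed
  finally have "2 * casimir n w xs = 2 * (of_int (\<Sum>p<n. (W p)\<^sup>2 + 2 * (int n - int p) * W p) * w xs)"
    by simp
  then show ?thesis by (simp only: mult_cancel_left W_def) simp
qed

section \<open>Equivariant maps and highest weight vectors\<close>

lemma id_mat_cpt_sp: "id_mat (2*n) \<in> cpt_sp n"
proof -
  have "(\<Sum>p<2*n. \<Sum>q<2*n. id_mat (2*n) p i * sympl n p q * id_mat (2*n) q j) = sympl n i j" if "i < 2*n" "j < 2*n" for i j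
  proof -
    have "(\<Sum>p<2*n. \<Sum>q<2*n. id_mat (2*n) p i * sympl n p q * id_mat (2*n) q j) = (\<Sum>p<2*n. if p = i then sympl n i j else 0)"
    proof (intro sum.cong refl)
      fix p assume "p \<in> {..<2*n}"
      have "(\<Sum>q<2*n. id_mat (2*n) p i * sympl n p q * id_mat (2*n) q j) = (\<Sum>q<2*n. if q = j then id_mat (2*n) p i * sympl n p j else 0)"
        using that by (intro sum.cong) (auto simp: id_mat_def)
      then show "(\<Sum>q<2*n. id_mat (2*n) p i * sympl n p q * id_mat (2*n) q j) = (if p = i then sympl n i j else 0)"
        using that by (auto simp: id_mat_def)
    qed
    then show ?thesis using that by simp
  qed
  moreover have "(\<Sum>p<2*n. cnj (id_mat (2*n) p i) * id_mat (2*n) p j) = (if i = j then 1 else 0)" if "i < 2*n" "j < 2*n" for i j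
  proof -
    have "(\<Sum>p<2*n. cnj (id_mat (2*n) p i) * id_mat (2*n) p j) = (\<Sum>p<2*n. if p = i then if i = j then 1 else 0 else 0)"
      using that by (intro sum.cong) (auto simp: id_mat_def)
    then show ?thesis using that by simp
  qed
  ultimately show ?thesis unfolding cpt_sp_def by (auto simp: id_mat_def)
qed

lemma gact_id_mat_supported:
  assumes "supported (2*n) m f"
  shows "gact (2*n) (id_mat (2*n)) f = f"
proof
  fix xs
  show "gact (2*n) (id_mat (2*n)) f xs = f xs"
  proof (cases "xs \<in> idx (2*n) m")
    case False
    then show ?thesis
      using assms supported_gact[OF id_mat_cpt_sp assms] unfolding supported_def by metis
  qed (rule gact_id_mat)
qed

lemma act_id_mat_left:
  assumes "supp_in n p q v"
  shows "act n (id_mat 2) g v hs es = gact (2*n) g (v hs) es"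
  using assms gact_id_mat_supported[of 1 p] unfolding supp_in_iff act_eq' by simp

lemma act_id_mat_right:
  assumes "supp_in n p q v"
  shows "act n h (id_mat (2*n)) v hs es = gact 2 h (\<lambda>hs'. v hs' es) hs"
  using assms gact_id_mat_supported[of n q] unfolding supp_in_iff act_eq by simp

definition lieE :: "nat \<Rightarrow> cmat \<Rightarrow> tensor \<Rightarrow> tensor" where
  "lieE n A v = (\<lambda>hs es. lact (2*n) A (v hs) es)"

definition lieH :: "cmat \<Rightarrow> tensor \<Rightarrow> tensor" where
  "lieH A v = (\<lambda>hs es. lact 2 A (\<lambda>hs'. v hs' es) hs)"

lemma sp_unit_diag_eq:
  assumes "i < 2*n"
  shows "sp_unit n i i = (\<lambda>x y. - \<i> * mono_mat (2*n) (\<lambda>x. x) (\<lambda>x. if x = i then \<i> else if x = bar n i then - \<i> else 0) x y)"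
  using assms bar_neq[OF assms] bar_less[OF assms]
  by (intro ext) (auto simp: sp_unit_def mono_mat_def bar_sgn_def)

lemma sp_unit_opposite_eq:
  assumes "i < 2*n"
  defines "K \<equiv> \<lambda>\<omega>. mono_mat (2*n) (\<lambda>x. if x = i then bar n i else if x = bar n i then i else x)
    (\<lambda>x. if x = i then \<omega> else if x = bar n i then - cnj \<omega> else 0)"
  shows "sp_unit n i (bar n i) = (\<lambda>x y. K 1 x y + - \<i> * K \<i> x y)"
proof -
  have "bar_sgn n i * bar_sgn n (bar n i) = -1" using assms by (simp add: bar_sgn_bar)
  then show ?thesis
    using assms(1) bar_neq[OF assms(1)] bar_less[OF assms(1)] unfolding K_def
    by (intro ext) (auto simp: sp_unit_def mono_mat_def)
qed

lemma sp_unit_rotation_eq: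
  assumes ij: "i < 2*n" "j < 2*n" "j \<noteq> i" "j \<noteq> bar n i"
  defines "K \<equiv> \<lambda>\<omega>. mono_mat (2*n)
    (\<lambda>x. if x = i then j else if x = j then i else if x = bar n i then bar n j else if x = bar n j then bar n i else x)
    (\<lambda>x. if x = i then \<omega> else if x = j then - cnj \<omega> else if x = bar n i then bar_sgn n i * bar_sgn n j * cnj \<omega>
       else if x = bar n j then - (bar_sgn n i * bar_sgn n j * \<omega>) else 0)"
  shows "sp_unit n i j = (\<lambda>x y. 1/2 * K 1 x y + - \<i>/2 * K \<i> x y)"
proof (intro ext)
  fix x y
  have b: "bar n i \<noteq> i" "bar n j \<noteq> j" "bar n i < 2*n" "bar n j < 2*n" "bar n j \<noteq> i" "bar n i \<noteq> bar n j"
    using ij bar_neq bar_bar by (metis bar_less)+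
  have ii: "\<i> * (z * \<i>) = - z" for z
  proof -
    have "\<i> * (z * \<i>) = z * (\<i> * \<i>)" by (simp only: mult_ac)
    then show ?thesis by simp
  qed
  consider "x = i" | "x = j" | "x = bar n i" | "x = bar n j" | "x \<notin> {i, j, bar n i, bar n j}" by blast
  then show "sp_unit n i j x y = 1/2 * K 1 x y + - \<i>/2 * K \<i> x y"
  proof cases
    case 1
    then show ?thesis using ij b by (simp add: sp_unit_def K_def mono_mat_def ii)
  next
    case 2
    then show ?thesis using ij b by (simp add: sp_unit_def K_def mono_mat_def ii)
  next
    case 3
    then show ?thesis using ij b by (simp add: sp_unit_def K_def mono_mat_def ii)
  next
    case 4
    then show ?thesis using ij b by (simp add: sp_unit_def K_def mono_mat_def ii)
  next
    case 5
    then show ?thesis using ij by (simp add: sp_unit_def K_def mono_mat_def)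
  qed
qed

text \<open>Source and target have fixed degrees. Their maximum bounds the degree in the derivative
  formula, so the same combination of group elements represents a Lie algebra element on both
  sides.\<close>

locale sp_hom =
  fixes n p q p' q' :: nat and V :: "tensor set" and F :: "tensor \<Rightarrow> tensor"
  assumes V_add: "\<And>u v. u \<in> V \<Longrightarrow> v \<in> V \<Longrightarrow> (\<lambda>hs es. u hs es + v hs es) \<in> V"
    and V_scale: "\<And>c v. v \<in> V \<Longrightarrow> (\<lambda>hs es. c * v hs es) \<in> V"
    and V_act: "\<And>h g v. h \<in> cpt_sp 1 \<Longrightarrow> g \<in> cpt_sp n \<Longrightarrow> v \<in> V \<Longrightarrow> act n h g v \<in> V"
    and V_supp: "\<And>v. v \<in> V \<Longrightarrow> supp_in n p q v"
    and F_add: "\<And>u v. u \<in> V \<Longrightarrow> v \<in> V \<Longrightarrow> F (\<lambda>hs es. u hs es + v hs es) = (\<lambda>hs es. F u hs es + F v hs es)"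
    and F_scale: "\<And>c v. v \<in> V \<Longrightarrow> F (\<lambda>hs es. c * v hs es) = (\<lambda>hs es. c * F v hs es)"
    and F_act: "\<And>h g v. h \<in> cpt_sp 1 \<Longrightarrow> g \<in> cpt_sp n \<Longrightarrow> v \<in> V \<Longrightarrow> F (act n h g v) = act n h g (F v)"
    and F_supp: "\<And>v. v \<in> V \<Longrightarrow> supp_in n p' q' (F v)"
begin

text \<open>The operators with this property are closed under linear combinations and composition.
  From the group they extend to the Lie algebra, to the Casimir operators and to polynomials in the
  weights.\<close>

definition commutes :: "(tensor \<Rightarrow> tensor) \<Rightarrow> bool" where
  "commutes D \<longleftrightarrow> (\<forall>v\<in>V. D v \<in> V \<and> F (D v) = D (F v))"

lemma commutes_add:
  "commutes D \<Longrightarrow> commutes D' \<Longrightarrow> commutes (\<lambda>v hs es. D v hs es + D' v hs es)"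
  unfolding commutes_def using V_add F_add by simp

lemma commutes_scale: "commutes D \<Longrightarrow> commutes (\<lambda>v hs es. c * D v hs es)"
  unfolding commutes_def using V_scale F_scale by simp

lemma commutes_comp: "commutes D \<Longrightarrow> commutes D' \<Longrightarrow> commutes (\<lambda>v. D (D' v))"
  unfolding commutes_def by simp

lemma commutes_id: "commutes (\<lambda>v. v)"
  unfolding commutes_def by simp

lemma commutes_zero: "commutes (\<lambda>v hs es. 0)"
  using commutes_scale[OF commutes_id, of 0] by simp

lemma commutes_sum:
  "(\<And>i. i \<in> A \<Longrightarrow> commutes (D i)) \<Longrightarrow> commutes (\<lambda>v hs es. \<Sum>i\<in>A. D i v hs es)"
  by (induction A rule: infinite_finite_induct) (simp_all add: commutes_zero commutes_add)

lemma commutes_act: "h \<in> cpt_sp 1 \<Longrightarrow> g \<in> cpt_sp n \<Longrightarrow> commutes (act n h g)"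
  unfolding commutes_def using V_act F_act by simp

lemma commutes_cong:
  assumes "commutes D'" "\<And>v. v \<in> V \<Longrightarrow> D v = D' v" "\<And>v. v \<in> V \<Longrightarrow> D (F v) = D' (F v)"
  shows "commutes D"
  using assms unfolding commutes_def by simp

lemma commutes_E_generator:
  assumes "skew_monomial n \<tau> \<kappa>"
  shows "commutes (lieE n (mono_mat (2*n) \<tau> \<kappa>))"
proof -
  define M where "M = max q q'"
  obtain c g where g: "\<And>s. s \<le> 2*M \<Longrightarrow> g s \<in> cpt_sp n"
    and eq: "\<And>m f xs. m \<le> M \<Longrightarrow> supported (2*n) m f \<Longrightarrow> lact (2*n) (mono_mat (2*n) \<tau> \<kappa>) f xs
       = (\<Sum>s\<le>2*M. c s * gact (2*n) (g s) f xs) - \<i> * of_nat M * f xs"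
    using skew_monomial.lie_generator[OF assms, of M] by blast
  have D: "lieE n (mono_mat (2*n) \<tau> \<kappa>) v
      = (\<lambda>hs es. (\<Sum>s\<le>2*M. c s * act n (id_mat 2) (g s) v hs es) + (- \<i> * of_nat M) * v hs es)"
    if "supp_in n r m v" "m \<le> M" for v r m
    using that eq[OF that(2), of "v _"] unfolding lieE_def act_id_mat_left[OF that(1)]
    by (intro ext) (simp add: supp_in_iff)
  have "commutes (\<lambda>v hs es. (\<Sum>s\<le>2*M. c s * act n (id_mat 2) (g s) v hs es) + (- \<i> * of_nat M) * v hs es)"
    using id_mat_cpt_sp[of 1] g
    by (intro commutes_add commutes_sum commutes_scale commutes_act commutes_id) auto
  then show ?thesis
    by (rule commutes_cong) (rule D[OF V_supp], assumption, simp add: M_def, rule D[OF F_supp], assumption, simp add: M_def)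
qed

lemma commutes_H_generator:
  assumes "skew_monomial 1 \<tau> \<kappa>"
  shows "commutes (lieH (mono_mat 2 \<tau> \<kappa>))"
proof -
  define M where "M = max p p'"
  obtain c g where g: "\<And>s. s \<le> 2*M \<Longrightarrow> g s \<in> cpt_sp 1"
    and eq: "\<And>m f xs. m \<le> M \<Longrightarrow> supported 2 m f \<Longrightarrow> lact 2 (mono_mat 2 \<tau> \<kappa>) f xs
       = (\<Sum>s\<le>2*M. c s * gact 2 (g s) f xs) - \<i> * of_nat M * f xs"
    using skew_monomial.lie_generator[OF assms, of M] unfolding mult_1_right by blast
  have D: "lieH (mono_mat 2 \<tau> \<kappa>) v
      = (\<lambda>hs es. (\<Sum>s\<le>2*M. c s * act n (g s) (id_mat (2*n)) v hs es) + (- \<i> * of_nat M) * v hs es)"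
    if "supp_in n m r v" "m \<le> M" for v r m
    using that eq[OF that(2), of "\<lambda>hs. v hs _"] unfolding lieH_def act_id_mat_right[OF that(1)]
    by (intro ext) (simp add: supp_in_iff)
  have "commutes (\<lambda>v hs es. (\<Sum>s\<le>2*M. c s * act n (g s) (id_mat (2*n)) v hs es) + (- \<i> * of_nat M) * v hs es)"
    using id_mat_cpt_sp[of n] g
    by (intro commutes_add commutes_sum commutes_scale commutes_act commutes_id) auto
  then show ?thesis
    by (rule commutes_cong) (rule D[OF V_supp], assumption, simp add: M_def, rule D[OF F_supp], assumption, simp add: M_def)
qed

lemma lieE_lincomb: "lieE n (\<lambda>x y. c * A x y + d * B x y) = (\<lambda>v hs es. c * lieE n A v hs es + d * lieE n B v hs es)"
  by (simp add: lieE_def fun_eq_iff lact_add_mat lact_scale_mat)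

lemma lieH_lincomb: "lieH (\<lambda>x y. c * A x y + d * B x y) = (\<lambda>v hs es. c * lieH A v hs es + d * lieH B v hs es)"
  by (simp add: lieH_def fun_eq_iff lact_add_mat lact_scale_mat)

lemma sp_unit_from_generators:
  assumes i: "i < 2*m" "j < 2*m"
    and gen: "\<And>\<tau> \<kappa>. skew_monomial m \<tau> \<kappa> \<Longrightarrow> P (mono_mat (2*m) \<tau> \<kappa>)"
    and lin: "\<And>c d A B. P A \<Longrightarrow> P B \<Longrightarrow> P (\<lambda>x y. c * A x y + d * B x y)"
  shows "P (sp_unit m i j)"
proof -
  consider "j = i" | "j = bar m i" | "j \<noteq> i" "j \<noteq> bar m i" by blast
  then show ?thesis
  proof cases
    case 1
    note K = gen[OF skew_monomial_diag[OF i(1)]]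
    show ?thesis using lin[OF K K, of "- \<i>" 0] 1 sp_unit_diag_eq[OF i(1)] by simp
  next
    case 2
    note K = gen[OF skew_monomial_opposite[OF i(1)]]
    show ?thesis using lin[OF K[of 1] K[of \<i>], of 1 "- \<i>"] 2 sp_unit_opposite_eq[OF i(1)] by simp
  next
    case 3
    note K = gen[OF skew_monomial_rotation[OF i 3]]
    show ?thesis using lin[OF K[of 1] K[of \<i>], of "1/2" "- \<i>/2"] sp_unit_rotation_eq[OF i 3] by simp
  qed
qed

lemma commutes_E:
  assumes "i < 2*n" "j < 2*n"
  shows "commutes (lieE n (sp_unit n i j))"
  by (rule sp_unit_from_generators[OF assms, of "\<lambda>A. commutes (lieE n A)"])
    (simp_all add: commutes_E_generator lieE_lincomb commutes_add commutes_scale)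

lemma commutes_H:
  assumes "i < 2" "j < 2"
  shows "commutes (lieH (sp_unit 1 i j))"
  by (rule sp_unit_from_generators[of i 1 j "\<lambda>A. commutes (lieH A)"])
    (use assms commutes_H_generator in \<open>simp_all add: lieH_lincomb commutes_add commutes_scale\<close>)

lemma commutes_casimir_E: "commutes (\<lambda>v hs es. casimir n (v hs) es)"
proof -
  have *: "commutes (\<lambda>v. lieE n (sp_unit n i j) (lieE n (sp_unit n j i) v))" if "i < 2*n" "j < 2*n" for i j
    using that by (intro commutes_comp[OF commutes_E commutes_E])
  have "commutes (\<lambda>v hs es. 1/2 * (\<Sum>i<2*n. \<Sum>j<2*n. lieE n (sp_unit n i j) (lieE n (sp_unit n j i) v) hs es))"
    by (rule commutes_scale, rule commutes_sum, rule commutes_sum) (simp add: *)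
  then show ?thesis by (simp add: casimir_def lieE_def)
qed

lemma commutes_casimir_H: "commutes (\<lambda>v hs es. casimir 1 (\<lambda>hs'. v hs' es) hs)"
proof -
  have *: "commutes (\<lambda>v. lieH (sp_unit 1 i j) (lieH (sp_unit 1 j i) v))" if "i < 2" "j < 2" for i j
    using that by (intro commutes_comp[OF commutes_H commutes_H])
  have "commutes (\<lambda>v hs es. 1/2 * (\<Sum>i<2. \<Sum>j<2. lieH (sp_unit 1 i j) (lieH (sp_unit 1 j i) v) hs es))"
    by (rule commutes_scale, rule commutes_sum, rule commutes_sum) (use * in simp)
  then show ?thesis by (simp add: casimir_def lieH_def)
qed

lemma F_zero: "v \<in> V \<Longrightarrow> F (\<lambda>hs es. 0) = (\<lambda>hs es. 0)"
  using F_scale[of v 0] by simp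

text \<open>The \<open>n\<close> weights on \<open>E\<close> and, at index \<open>n\<close>, the
  weight on \<open>H\<close>, in one family, so that one product can separate all weights.\<close>

definition weights :: "nat \<Rightarrow> nat list \<Rightarrow> nat list \<Rightarrow> int" where
  "weights i hs es = (if i < n then weight n i es else weight 1 0 hs)"

lemma commutes_weights: "commutes (\<lambda>v hs es. of_int (weights i hs es) * v hs es)"
proof (cases "i < n")
  case True
  then have "lieE n (sp_unit n i i) = (\<lambda>v hs es. of_int (weights i hs es) * v hs es)"
    by (simp add: lieE_def weights_def lact_sp_unit_diag fun_eq_iff)
  then show ?thesis using commutes_E[of i i] True by simp
next
  case False
  then have "lieH (sp_unit 1 0 0) = (\<lambda>v hs es. of_int (weights i hs es) * v hs es)"
    using lact_sp_unit_diag[of 0 1] by (simp add: lieH_def weights_def fun_eq_iff)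
  then show ?thesis using commutes_H[of 0 0] by simp
qed

lemma commutes_weights_prod:
  "finite Q \<Longrightarrow> commutes (\<lambda>v hs es. (\<Prod>(i, m)\<in>Q. of_int (weights i hs es - m)) * v hs es)"
proof (induction Q rule: finite_induct)
  case (insert x Q)
  obtain i m where x: "x = (i, m)" by (cases x)
  have "commutes (\<lambda>v hs es. of_int (weights i hs es) * v hs es + (- of_int m) * v hs es)"
    by (intro commutes_add commutes_weights commutes_scale commutes_id)
  then have "commutes (\<lambda>v hs es. of_int (weights i hs es - m) * v hs es)"
    by (simp add: algebra_simps)
  from commutes_comp[OF this insert.IH]
  show ?case using insert.hyps by (simp add: x mult.assoc)
qed (simp add: commutes_id)

lemma abs_weight_le: "\<bar>weight m i xs\<bar> \<le> int (length xs)"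
proof -
  have "\<bar>weight m i xs\<bar> \<le> (\<Sum>r<length xs. \<bar>(if xs!r = i then 1 else 0) - (if xs!r = bar m i then 1 else 0)\<bar> :: int)"
    unfolding weight_def by (rule sum_abs)
  also have "\<dots> \<le> (\<Sum>r<length xs. 1)" by (intro sum_mono) auto
  finally show ?thesis by simp
qed

text \<open>Up to a scalar, the product of the operators \<open>weights i - m\<close> over all wrong
  values \<open>m\<close> projects onto the weight space of \<open>(hs0, es0)\<close>. It commutes
  with \<open>F\<close> and keeps the coefficient of \<open>F v\<close> at \<open>(hs0, es0)\<close>
  nonzero, so it cannot annihilate \<open>v\<close>.\<close>

lemma weight_transfer:
  assumes v: "v \<in> V" and nz: "F v hs0 es0 \<noteq> 0"
  shows "\<exists>hs es. v hs es \<noteq> 0 \<and> (\<forall>i<n. weight n i es = weight n i es0) \<and> weight 1 0 hs = weight 1 0 hs0"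
proof -
  define M where "M = int (p + q)"
  define Q where "Q = {(i, m). i \<le> n \<and> m \<in> {-M..M} \<and> m \<noteq> weights i hs0 es0}"
  have "Q \<subseteq> {..n} \<times> {-M..M}" by (auto simp: Q_def)
  then have fin: "finite Q" by (rule finite_subset) simp
  let ?c = "\<lambda>hs es. \<Prod>(i, m)\<in>Q. complex_of_int (weights i hs es - m)"
  let ?v = "\<lambda>hs es. ?c hs es * v hs es"
  have "F ?v = (\<lambda>hs es. ?c hs es * F v hs es)"
    using commutes_weights_prod[OF fin] v unfolding commutes_def by blast
  moreover have "?c hs0 es0 \<noteq> 0"
    using fin by (subst prod_zero_iff) (auto simp: Q_def)
  ultimately have "F ?v hs0 es0 \<noteq> 0" using nz by simp
  then have "?v \<noteq> (\<lambda>hs es. 0)" using F_zero[OF v] by metis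
  then obtain hs es where "?v hs es \<noteq> 0" by (auto simp: fun_eq_iff)
  then have vnz: "v hs es \<noteq> 0" and cnz: "?c hs es \<noteq> 0" by auto
  have ne: "weights i hs es \<noteq> m" if "(i, m) \<in> Q" for i m
  proof
    assume "weights i hs es = m"
    then have "?c hs es = 0" using that fin by (intro prod_zero) force+
    with cnz show False by simp
  qed
  have "length hs = p" "length es = q"
    using V_supp[OF v] vnz unfolding supp_in_def idx_def by auto
  then have "weights i hs es \<in> {-M..M}" for i
    using abs_weight_le[of n i es] abs_weight_le[of 1 0 hs] by (auto simp: weights_def M_def)
  then have "weights i hs es = weights i hs0 es0" if "i \<le> n" for i
    using ne[of i "weights i hs es"] that by (auto simp: Q_def)
  then have "weight n i es = weight n i es0" if "i < n" for i using that by (metis weights_def less_imp_le)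
  moreover have "weight 1 0 hs = weight 1 0 hs0"
    using \<open>\<And>i. i \<le> n \<Longrightarrow> weights i hs es = weights i hs0 es0\<close>[of n] by (simp add: weights_def)
  ultimately show ?thesis using vnz by blast
qed

end

section \<open>Heights and the existence of a highest weight vector\<close>

definition height :: "nat \<Rightarrow> nat list \<Rightarrow> nat" where
  "height n xs = (\<Sum>r<length xs. eta n (xs!r))"

lemma eta_le: "i < 2*n \<Longrightarrow> eta n i \<le> 2*n"
  by (auto simp: eta_def)

lemma eta_bar: "i < 2*n \<Longrightarrow> eta n (bar n i) = 2*n - eta n i"
  by (auto simp: eta_def bar_def)

lemma height_le: "xs \<in> idx (2*n) m \<Longrightarrow> height n xs \<le> m * (2*n)"
  using sum_bounded_above[of "{..<m}" "\<lambda>r. eta n (xs!r)" "2*n"] eta_le by (auto simp: height_def idx_iff)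

lemma height_update: "r < length xs \<Longrightarrow> height n (xs[r := y]) + eta n (xs!r) = height n xs + eta n y"
proof -
  assume r: "r < length xs"
  let ?m = "length xs"
  have "height n (xs[r := y]) = eta n y + (\<Sum>t\<in>{..<?m} - {r}. eta n (xs!t))"
    unfolding height_def using r by (subst sum.remove[of _ r]) (auto intro!: sum.cong)
  moreover have "height n xs = eta n (xs!r) + (\<Sum>t\<in>{..<?m} - {r}. eta n (xs!t))"
    unfolding height_def using r by (subst sum.remove[of _ r]) auto
  ultimately show ?thesis by simp
qed

text \<open>Both summands of \<open>sp_unit\<close> shift the height by the same amount, since
  \<open>eta n (bar n i) = 2*n - eta n i\<close>.\<close>

lemma lact_sp_unit_height:
  assumes ij: "i < 2*n" "j < 2*n" and nz: "lact (2*n) (sp_unit n i j) f xs \<noteq> 0"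
  shows "\<exists>ys. f ys \<noteq> 0 \<and> length ys = length xs \<and> height n ys + eta n i = height n xs + eta n j"
proof -
  obtain r where r: "r < length xs" "(if xs!r = i then f (xs[r := j]) else 0)
    - bar_sgn n i * bar_sgn n j * (if xs!r = bar n j then f (xs[r := bar n i]) else 0) \<noteq> 0"
    using nz unfolding lact_sp_unit[OF ij] by (meson sum.neutral lessThan_iff)
  then have "(if xs!r = i then f (xs[r := j]) else 0) \<noteq> 0 \<or> (if xs!r = bar n j then f (xs[r := bar n i]) else 0) \<noteq> 0"
    by (metis diff_zero mult_zero_right)
  then consider "xs!r = i" "f (xs[r := j]) \<noteq> 0" | "xs!r = bar n j" "f (xs[r := bar n i]) \<noteq> 0"
    by (auto split: if_splits)
  then show ?thesis
  proof cases
    case 1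
    then show ?thesis using height_update[OF r(1), of n j] by (intro exI[of _ "xs[r := j]"]) simp
  next
    case 2
    then have "height n (xs[r := bar n i]) + (2*n - eta n j) = height n xs + (2*n - eta n i)"
      using height_update[OF r(1), of n "bar n i"] ij by (simp add: eta_bar)
    then show ?thesis
      using 2 eta_le[OF ij(1)] eta_le[OF ij(2)] by (intro exI[of _ "xs[r := bar n i]"]) simp
  qed
qed

context sp_hom
begin

text \<open>Among the \<open>v\<close> with nonzero image choose one whose image is supported in
  heights at least \<open>h\<close>, with \<open>h\<close> as large as possible. A raising operator
  increases all heights, so it must kill the image. Adding the heights of both factors handles
  \<open>E\<close> and \<open>H\<close> at once.\<close>

lemma highest_weight_vector_exists:
  assumes ex: "\<exists>v\<in>V. F v \<noteq> (\<lambda>hs es. 0)"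
  shows "\<exists>v\<in>V. F v \<noteq> (\<lambda>hs es. 0) \<and> (\<forall>hs. highest_weight n (F v hs)) \<and> (\<forall>es. highest_weight 1 (\<lambda>hs. F v hs es))"
proof -
  define H where "H hs es = height 1 hs + height n es" for hs es
  define P where "P x \<longleftrightarrow> fst x \<in> V \<and> F (fst x) \<noteq> (\<lambda>hs es. 0) \<and> (\<forall>hs es. F (fst x) hs es \<noteq> 0 \<longrightarrow> snd x \<le> H hs es)"
    for x :: "tensor \<times> nat"
  have bound: "snd x < Suc (p' * 2 + q' * (2*n))" if Px: "P x" for x
  proof -
    have v: "fst x \<in> V" using Px by (simp add: P_def)
    obtain hs es where nz: "F (fst x) hs es \<noteq> 0" using Px by (auto simp: P_def fun_eq_iff)
    then have "snd x \<le> H hs es" using Px by (simp add: P_def)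
    moreover have "hs \<in> idx (2*1) p'" "es \<in> idx (2*n) q'"
      using F_supp[OF v] nz unfolding supp_in_def by auto
    ultimately show ?thesis using height_le[of hs 1 p'] height_le[of es n q'] by (simp add: H_def)
  qed
  obtain v0 where "v0 \<in> V" "F v0 \<noteq> (\<lambda>hs es. 0)" using ex by blast
  then have "P (v0, 0)" by (simp add: P_def)
  then obtain x where x: "P x" "\<And>y. P y \<Longrightarrow> snd y \<le> snd x"
    using ex_has_greatest_nat[of P "(v0, 0)" snd, OF _ allI, of "Suc (p' * 2 + q' * (2*n))"] bound by blast
  obtain v h where vh: "x = (v, h)" by (cases x)
  have v: "v \<in> V" "F v \<noteq> (\<lambda>hs es. 0)" "\<And>hs es. F v hs es \<noteq> 0 \<Longrightarrow> h \<le> H hs es"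
    using x(1) by (auto simp: P_def vh)
  have max: False if "u \<in> V" "F u hs0 es0 \<noteq> 0" "\<And>hs es. F u hs es \<noteq> 0 \<Longrightarrow> Suc h \<le> H hs es" for u hs0 es0
  proof -
    have "P (u, Suc h)" using that by (auto simp: P_def)
    from x(2)[OF this] show False by (simp add: vh)
  qed
  have "highest_weight n (F v hs)" for hs
    unfolding highest_weight_def
  proof (intro allI impI, rule ccontr)
    fix i j es assume ij: "i < 2*n" "j < 2*n" "eta n j < eta n i" and nz: "lact (2*n) (sp_unit n i j) (F v hs) es \<noteq> 0"
    let ?u = "lieE n (sp_unit n i j) v"
    have u: "?u \<in> V" "F ?u = lieE n (sp_unit n i j) (F v)"
      using commutes_E[OF ij(1,2)] v(1) unfolding commutes_def by blast+
    show False
    proof (rule max[OF u(1)])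
      show "F ?u hs es \<noteq> 0" unfolding u(2) using nz by (simp add: lieE_def)
      fix hs es assume "F ?u hs es \<noteq> 0"
      then have "lact (2*n) (sp_unit n i j) (F v hs) es \<noteq> 0" unfolding u(2) by (simp add: lieE_def)
      then obtain ys where "F v hs ys \<noteq> 0" "height n ys + eta n i = height n es + eta n j"
        using lact_sp_unit_height[OF ij(1,2), of "F v hs" es] by blast
      then show "Suc h \<le> H hs es" using v(3)[of hs ys] ij(3) by (simp add: H_def)
    qed
  qed
  moreover have "highest_weight 1 (\<lambda>hs. F v hs es)" for es
    unfolding highest_weight_def
  proof (intro allI impI, rule ccontr)
    fix i j hs assume ij: "i < 2*1" "j < 2*1" "eta 1 j < eta 1 i" and nz: "lact (2*1) (sp_unit 1 i j) (\<lambda>hs. F v hs es) hs \<noteq> 0"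
    let ?u = "lieH (sp_unit 1 i j) v"
    have u: "?u \<in> V" "F ?u = lieH (sp_unit 1 i j) (F v)"
      using commutes_H[of i j] ij v(1) unfolding commutes_def by auto
    show False
    proof (rule max[OF u(1)])
      show "F ?u hs es \<noteq> 0" unfolding u(2) using nz by (simp add: lieH_def)
      fix hs es assume "F ?u hs es \<noteq> 0"
      then have "lact (2*1) (sp_unit 1 i j) (\<lambda>hs. F v hs es) hs \<noteq> 0" unfolding u(2) by (simp add: lieH_def)
      then obtain ys where "F v ys es \<noteq> 0" "height 1 ys + eta 1 i = height 1 hs + eta 1 j"
        using lact_sp_unit_height[OF ij(1,2), of "\<lambda>hs. F v hs es" hs] by blast
      then show "Suc h \<le> H hs es" using v(3)[of ys es] ij(3) by (simp add: H_def)
    qed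
  qed
  ultimately show ?thesis using v by blast
qed

lemma highest_weight_casimir:
  assumes v: "v \<in> V" and hw: "\<And>hs. highest_weight n (F v hs)" "\<And>es. highest_weight 1 (\<lambda>hs. F v hs es)"
    and cE: "\<And>u hs es. u \<in> V \<Longrightarrow> casimir n (u hs) es = of_int CE * u hs es"
    and cH: "\<And>u hs es. u \<in> V \<Longrightarrow> casimir 1 (\<lambda>hs'. u hs' es) hs = of_int CH * u hs es"
    and nz: "F v hs es \<noteq> 0"
  shows "(\<Sum>i<n. (weight n i es)\<^sup>2 + 2 * (int n - int i) * weight n i es) = CE"
    and "(weight 1 0 hs)\<^sup>2 + 2 * weight 1 0 hs = CH"
proof -
  have "casimir n (F v hs) es = F (\<lambda>hs es. casimir n (v hs) es) hs es"
    using commutes_casimir_E v unfolding commutes_def by metis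
  also have "\<dots> = of_int CE * F v hs es"
    using cE[OF v] F_scale[OF v] by simp
  finally show "(\<Sum>i<n. (weight n i es)\<^sup>2 + 2 * (int n - int i) * weight n i es) = CE"
    unfolding casimir_highest_weight[OF hw(1)] using nz by (simp only: mult_cancel_right of_int_eq_iff simp_thms)
  have "casimir 1 (\<lambda>hs'. F v hs' es) hs = F (\<lambda>hs es. casimir 1 (\<lambda>hs'. v hs' es) hs) hs es"
    using commutes_casimir_H v unfolding commutes_def by metis
  also have "\<dots> = of_int CH * F v hs es"
    using cH[OF v] F_scale[OF v] by simp
  finally have "(\<Sum>i<1. (weight 1 i hs)\<^sup>2 + 2 * (int 1 - int i) * weight 1 i hs) = CH"
    unfolding casimir_highest_weight[OF hw(2)] using nz by (simp only: mult_cancel_right of_int_eq_iff simp_thms)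
  then show "(weight 1 0 hs)\<^sup>2 + 2 * weight 1 0 hs = CH" by simp
qed

end

section \<open>Highest weight vectors in one exterior power\<close>

definition subst_sum :: "tens \<Rightarrow> nat \<Rightarrow> nat \<Rightarrow> nat list \<Rightarrow> complex" where
  "subst_sum u x y xs = (\<Sum>r<length xs. if xs!r = x then u (xs[r := y]) else 0)"

lemma subst_sum_notin: "x \<notin> set xs \<Longrightarrow> subst_sum u x y xs = 0"
  unfolding subst_sum_def by (rule sum.neutral) (auto simp: in_set_conv_nth)

lemma subst_sum_distinct:
  assumes "distinct xs" "r < length xs" "xs!r = x"
  shows "subst_sum u x y xs = u (xs[r := y])"
proof -
  have "subst_sum u x y xs = (\<Sum>t<length xs. if t = r then u (xs[r := y]) else 0)"
    unfolding subst_sum_def using assms by (intro sum.cong) (auto simp: nth_eq_iff_index_eq)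
  then show ?thesis using assms by simp
qed

lemma lact_sp_unit_subst_sum:
  assumes "i < 2*n" "j < 2*n"
  shows "lact (2*n) (sp_unit n i j) f xs = subst_sum f i j xs - bar_sgn n i * bar_sgn n j * subst_sum f (bar n j) (bar n i) xs"
  unfolding lact_sp_unit[OF assms] subst_sum_def by (simp add: sum_subtractf sum_distrib_left)

lemma subst_sum_append: "subst_sum f x y (I @ J) = subst_sum (\<lambda>I'. f (I' @ J)) x y I + subst_sum (\<lambda>J'. f (I @ J')) x y J"
proof -
  let ?g = "\<lambda>r. if (I @ J)!r = x then f ((I @ J)[r := y]) else 0"
  have "subst_sum f x y (I @ J) = sum ?g {..<length I} + sum ?g {length I..<length I + length J}"
    unfolding subst_sum_def by (simp add: lessThan_atLeast0 sum.atLeastLessThan_concat)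
  also have "sum ?g {..<length I} = subst_sum (\<lambda>I'. f (I' @ J)) x y I"
    unfolding subst_sum_def by (intro sum.cong) (auto simp: nth_append list_update_append)
  also have "sum ?g {length I..<length I + length J} = (\<Sum>r<length J. ?g (r + length I))"
    using sum.shift_bounds_nat_ivl[of ?g 0 "length I" "length J"] by (simp add: lessThan_atLeast0 add.commute)
  also have "\<dots> = subst_sum (\<lambda>J'. f (I @ J')) x y J"
    unfolding subst_sum_def by (intro sum.cong) (auto simp: nth_append list_update_append)
  finally show ?thesis .
qed

lemma distinct_update: "distinct xs \<Longrightarrow> y \<notin> set xs \<Longrightarrow> distinct (xs[r := y])"
  by (simp add: distinct_list_update)

lemma alt1_nondistinct:
  assumes "alt1 0 c u" "length xs = c" "\<not> distinct xs"
  shows "u xs = 0"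
proof -
  obtain i j where ij: "i < c" "j < c" "i \<noteq> j" "xs!i = xs!j"
    using assms(2,3) by (auto simp: distinct_conv_nth)
  have "swp i j xs = xs"
    by (rule nth_equalityI) (use ij assms(2) in \<open>auto simp: nth_swp\<close>)
  then have "u xs = - u xs"
    using alt1_swap[OF assms(1), of i j xs] ij by simp
  then show ?thesis by simp
qed

lemma alt1_mset:
  assumes alt: "alt1 0 c u" and "length xs = c" and m: "mset ys = mset xs" and nz: "u xs \<noteq> 0"
  shows "u ys \<noteq> 0"
proof -
  obtain \<pi> where \<pi>: "\<pi> permutes {..<length xs}" "permute_list \<pi> xs = ys"
    using mset_eq_permutation[OF m] by auto
  have "u (permute_list \<pi> xs) \<noteq> 0" if "\<pi> permutes {..<c}" for \<pi>
    using finite_lessThan that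
  proof (induction rule: permutes_rev_induct)
    case id
    then show ?case using nz by simp
  next
    case (swap i j \<sigma>)
    have "permute_list (\<sigma> \<circ> transpose i j) xs = permute_list (transpose i j) (permute_list \<sigma> xs)"
      using permute_list_compose[of "transpose i j" xs \<sigma>] swap assms(2) by (simp add: permutes_swap_id)
    also have "\<dots> = swp i j (permute_list \<sigma> xs)"
      by (rule nth_equalityI)
        (use swap assms(2) in \<open>auto simp: nth_swp permute_list_def transpose_def\<close>)
    finally have eq: "permute_list (\<sigma> \<circ> transpose i j) xs = swp i j (permute_list \<sigma> xs)" .
    have "u (swp i j (permute_list \<sigma> xs)) \<noteq> 0"
      using swap alt1_swap[OF alt, of i j "permute_list \<sigma> xs"] by (cases "i = j") (auto simp: swp_def)
    then show ?case unfolding eq .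
  qed
  then show ?thesis using \<pi> assms(2) by blast
qed

text \<open>A primitive form killed by the raising operators of the Levi subgroup
  \<open>GL(d) x Sp(n - d)\<close>. This is what the highest weight condition leaves for the
  coefficient along \<open>[0..<d]\<close>; with \<open>0\<close> in place of \<open>d\<close> it
  describes a highest weight vector for all of \<open>Sp(n)\<close>.\<close>

locale block =
  fixes n c d :: nat and u :: tens
  assumes d_le: "d \<le> n"
    and supp: "supported (2*n) c u"
    and alt: "alt1 0 c u"
    and trace: "2 \<le> c \<Longrightarrow> traceless n c 0 1 u"
    and raise: "\<And>p q xs. p < q \<Longrightarrow> q < n \<Longrightarrow> q < d \<or> d \<le> p \<Longrightarrow> lact (2*n) (sp_unit n p q) u xs = 0"
    and raise_long: "\<And>q xs. d \<le> q \<Longrightarrow> q < n \<Longrightarrow> lact (2*n) (sp_unit n q (bar n q)) u xs = 0"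
begin

lemma nz: "u I \<noteq> 0 \<Longrightarrow> length I = c \<and> distinct I \<and> set I \<subseteq> {..<2*n}"
  using supp alt1_nondistinct[OF alt, of I] unfolding supported_def idx_def by blast

text \<open>Says that a root vector kills \<open>u\<close>, in a form that also covers the partner
  pair \<open>(bar n y, bar n x)\<close>, so that \<open>linked_zero\<close> serves for
  both.\<close>

definition linked :: "nat \<Rightarrow> nat \<Rightarrow> bool" where
  "linked x y \<longleftrightarrow> x < 2*n \<and> y < 2*n \<and> x \<noteq> y \<and> y \<noteq> bar n x \<and> (\<forall>xs. subst_sum u x y xs = subst_sum u (bar n y) (bar n x) xs)"

lemma linked_same:
  assumes "p < q" "q < n" "q < d \<or> d \<le> p"
  shows "linked p q" "linked (bar n q) (bar n p)"
proof -
  have pq: "p < 2*n" "q < 2*n" "p < n" using assms by auto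
  have "subst_sum u p q xs = subst_sum u (bar n q) (bar n p) xs" for xs
    using raise[OF assms, of xs] pq assms by (simp add: lact_sp_unit_subst_sum bar_sgn_def)
  then show "linked p q" "linked (bar n q) (bar n p)"
    using pq assms unfolding linked_def by (auto simp: bar_def)
qed

text \<open>Evaluate the relation at \<open>I\<close> with \<open>y\<close> replaced by
  \<open>x\<close>. The left side is \<open>u I\<close>; the right side vanishes because
  \<open>bar n y\<close> is absent or its replacement would repeat \<open>bar n x\<close>.\<close>

lemma linked_zero:
  assumes l: "linked x y" and I: "y \<in> set I" "x \<notin> set I" "bar n y \<notin> set I \<or> bar n x \<in> set I"
  shows "u I = 0"
proof (rule ccontr)
  assume nz0: "u I \<noteq> 0"
  note I' = nz[OF nz0]
  have xy: "x < 2*n" "y < 2*n" "x \<noteq> y" "y \<noteq> bar n x" and eq: "subst_sum u x y xs = subst_sum u (bar n y) (bar n x) xs" for xs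
    using l unfolding linked_def by auto
  have ne: "bar n y \<noteq> x" "bar n y \<noteq> y" "bar n x \<noteq> y" using xy bar_neq bar_bar by metis+
  obtain s where s: "s < length I" "I!s = y" using I(1) by (auto simp: in_set_conv_nth)
  let ?J = "I[s := x]"
  have dJ: "distinct ?J" using I' I(2) by (intro distinct_update) auto
  have "subst_sum u x y ?J = u (?J[s := y])" using s dJ by (intro subst_sum_distinct) auto
  also have "?J[s := y] = I" using s by (metis list_update_overwrite list_update_id)
  finally have 1: "subst_sum u x y ?J = u I" .
  have "subst_sum u (bar n y) (bar n x) ?J = 0"
  proof (cases "bar n y \<in> set I")
    case False
    then have "bar n y \<notin> set ?J" using ne set_update_subset_insert[of I s x] by auto
    then show ?thesis by (rule subst_sum_notin)
  next
    case True
    then have bx: "bar n x \<in> set I" using I(3) by simp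
    obtain t where t: "t < length I" "I!t = bar n y" using True by (auto simp: in_set_conv_nth)
    obtain r where r: "r < length I" "I!r = bar n x" using bx by (auto simp: in_set_conv_nth)
    have "bar n x \<noteq> bar n y" using xy bar_bar by metis
    then have neq: "t \<noteq> s" "r \<noteq> s" "r \<noteq> t" using s t r ne by auto
    have "subst_sum u (bar n y) (bar n x) ?J = u (?J[t := bar n x])"
      using t neq dJ by (intro subst_sum_distinct) auto
    also have "\<dots> = 0"
    proof (rule alt1_nondistinct[OF alt])
      have "?J[t := bar n x] ! t = ?J[t := bar n x] ! r" using t r neq by simp
      then show "\<not> distinct (?J[t := bar n x])"
        using t r neq by (metis distinct_conv_nth length_list_update)
    qed (use I' in simp)
    finally show ?thesis .
  qed
  then show False using 1 eq[of ?J] nz0 by simp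
qed

lemma mono_weight:
  assumes "u I \<noteq> 0" "p < q" "q < n" "q < d \<or> d \<le> p"
  shows "(of_bool (q \<in> set I) :: int) - of_bool (bar n q \<in> set I) \<le> of_bool (p \<in> set I) - of_bool (bar n p \<in> set I)"
proof -
  have "bar n (bar n p) = p" "bar n (bar n q) = q" using assms by simp_all
  then show ?thesis
    using linked_zero[OF linked_same(1)[OF assms(2-4)], of I] linked_zero[OF linked_same(2)[OF assms(2-4)], of I] assms(1)
    by (auto simp: of_bool_def)
qed

lemma nonneg_weight:
  assumes "u I \<noteq> 0" "d \<le> q" "q < n" "bar n q \<in> set I"
  shows "q \<in> set I"
proof (rule ccontr)
  assume q: "q \<notin> set I"
  note I' = nz[OF assms(1)]
  obtain s where s: "s < length I" "I!s = bar n q" using assms(4) by (auto simp: in_set_conv_nth)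
  have q2: "q < 2*n" "bar n q < 2*n" using assms(3) by simp_all
  let ?J = "I[s := q]"
  have "subst_sum u q (bar n q) ?J = u (?J[s := bar n q])"
    using s I' q by (intro subst_sum_distinct distinct_update) auto
  also have "?J[s := bar n q] = I" using s by (metis list_update_overwrite list_update_id)
  finally have "subst_sum u q (bar n q) ?J = u I" .
  moreover have "lact (2*n) (sp_unit n q (bar n q)) u ?J = 2 * subst_sum u q (bar n q) ?J"
    unfolding lact_sp_unit_subst_sum[OF q2] using q2 by (simp add: bar_sgn_bar)
  ultimately show False using raise_long[OF assms(2,3), of ?J] assms(1) by simp
qed

text \<open>In an element of the support with the fewest pairs \<open>p, bar n p\<close> inside \<open>G\<close>, exchanging one such pair
  for another inside \<open>G\<close> does not change the coefficient, and exchanging it for one outside \<open>G\<close> gives \<open>0\<close>;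
  so the vanishing trace would be a nonzero multiple of this coefficient.\<close>

lemma exists_pairless:
  assumes ex: "u I0 \<noteq> 0" and G: "G = {..<d} \<or> G = {d..<n}"
  shows "\<exists>I. u I \<noteq> 0 \<and> (\<forall>p\<in>G. \<not> (p \<in> set I \<and> bar n p \<in> set I))"
proof -
  define cnt where "cnt I = card {p\<in>G. p \<in> set I \<and> bar n p \<in> set I}" for I
  have finG: "finite G" and Gn: "\<And>p. p \<in> G \<Longrightarrow> p < n" using G d_le by auto
  obtain I where I: "u I \<noteq> 0" "\<And>J. u J \<noteq> 0 \<Longrightarrow> cnt I \<le> cnt J"
    using ex_has_least_nat[of "\<lambda>I. u I \<noteq> 0" I0 cnt] ex by blast
  have "\<not> (p \<in> set I \<and> bar n p \<in> set I)" if pG: "p \<in> G" for p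
  proof
    assume p: "p \<in> set I \<and> bar n p \<in> set I"
    note I' = nz[OF I(1)]
    have pn: "p < n" "p < 2*n" using Gn[OF pG] by auto
    have "bar n p \<noteq> p" using bar_neq[OF pn(2)] .
    define es where "es = remove1 (bar n p) (remove1 p I)"
    have m: "mset (p # bar n p # es) = mset I"
    proof -
      have b: "bar n p \<in># mset (remove1 p I)"
        using p \<open>bar n p \<noteq> p\<close> by (simp only: set_mset_mset) simp
      have "add_mset (bar n p) (mset es) = mset (remove1 p I)"
        unfolding es_def mset_remove1[of "bar n p"] by (rule insert_DiffM[OF b])
      then show ?thesis using p by simp
    qed
    define X where "X x = u (x # bar n x # es)" for x
    have Xp: "X p \<noteq> 0"
      unfolding X_def using alt1_mset[OF alt _ m I(1)] I' by simp
    have cntI: "cnt (p # bar n p # es) = cnt I"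
      using mset_eq_setD[OF m] by (simp add: cnt_def)
    have len: "length (p # bar n p # es) = c" using I' mset_eq_length[OF m] by simp
    have nzp: "distinct (p # bar n p # es)" using nz[of "p # bar n p # es"] Xp by (simp add: X_def)
    have "contraction n 0 1 u (p # bar n p # es) = 0"
      using trace len unfolding traceless_def by auto
    then have "(\<Sum>q<2*n. bar_sgn n q * X q) = 0"
      unfolding contraction_bar X_def by simp
    \<comment> \<open>Alternation makes the coefficient change sign when \<open>q\<close> is
      replaced by its partner. This cancels the sign of the form, so the trace counts each pair
      twice.\<close>
    moreover have "bar_sgn n q * X q = X (if q < n then q else q - n)" if "q < 2*n" for q
    proof (cases "q < n")
      case False
      then have "X q = u (swp 0 1 ((q - n) # q # es))" using that by (simp add: X_def bar_def swp_def)
      then have "X q = - u ((q - n) # q # es)"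
        using alt len unfolding alt1_def by simp
      moreover have "q - n < n" "q - n + n = q" using False that by simp_all
      ultimately show ?thesis using False by (simp add: bar_sgn_def X_def bar_def)
    qed (simp add: bar_sgn_def)
    ultimately have "(\<Sum>q<2*n. X (if q < n then q else q - n)) = 0" by simp
    moreover have "(\<Sum>q<2*n. X (if q < n then q else q - n)) = (\<Sum>q<n. X q) + (\<Sum>q<n. X q)"
    proof -
      let ?Y = "\<lambda>q. X (if q < n then q else q - n)"
      have "sum ?Y {0..<n} + sum ?Y {n..<n+n} = sum ?Y {0..<n+n}"
        by (rule sum.atLeastLessThan_concat) simp_all
      then have "sum ?Y {..<2*n} = sum ?Y {..<n} + sum ?Y {n..<n+n}"
        by (simp only: lessThan_atLeast0 mult_2)
      also have "sum ?Y {n..<n+n} = (\<Sum>q<n. ?Y (q + n))"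
        using sum.shift_bounds_nat_ivl[of ?Y 0 n n] by (simp add: lessThan_atLeast0)
      finally show ?thesis by simp
    qed
    ultimately have sum0: "(\<Sum>q<n. X q) = 0" by simp
    have Xq: "X q = (if q \<in> G \<and> q \<notin> set es \<and> bar n q \<notin> set es then X p else 0)" if q: "q < n" for q
    proof (cases "q \<notin> set es \<and> bar n q \<notin> set es")
      case False
      then have "\<not> distinct (q # bar n q # es)" by auto
      then have "X q = 0" using alt1_nondistinct[OF alt, of "q # bar n q # es"] len by (auto simp: X_def)
      then show ?thesis using False by auto
    next
      case free: True
      show ?thesis
      proof (cases "q \<in> G")
        case False
        have "X q = 0"
        proof (rule ccontr)
          assume "X q \<noteq> 0"
          then have "cnt I \<le> cnt (q # bar n q # es)" using I(2) by (simp add: X_def)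
          moreover have "cnt (q # bar n q # es) < cnt (p # bar n p # es)"
            unfolding cnt_def
          proof (rule psubset_card_mono)
            show "finite {x\<in>G. x \<in> set (p # bar n p # es) \<and> bar n x \<in> set (p # bar n p # es)}"
              using finG by simp
            have "x \<in> set es \<and> bar n x \<in> set es"
              if "x \<in> G" "x \<in> set (q # bar n q # es)" "bar n x \<in> set (q # bar n q # es)" for x
              using that False q Gn[OF that(1)] by (auto simp: bar_def)
            moreover have "p \<notin> set es" using nzp by auto
            ultimately show "{x\<in>G. x \<in> set (q # bar n q # es) \<and> bar n x \<in> set (q # bar n q # es)}
              \<subset> {x\<in>G. x \<in> set (p # bar n p # es) \<and> bar n x \<in> set (p # bar n p # es)}"
              using pG by auto
          qed
          ultimately show False using cntI by simp
        qed
        then show ?thesis using False by simp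
      next
        case True
        have "X q = X p"
        proof (cases "q = p")
          case False
          have sides: "q < d \<or> d \<le> p" "p < d \<or> d \<le> q" using G True pG by auto
          have ne: "bar n q \<noteq> p" "bar n p \<noteq> q" "bar n p \<noteq> bar n q" using pn q False by (auto simp: bar_def)
          have exchange: "X y = X x" if l: "linked x y" and d: "distinct (x # bar n y # es)" for x y
          proof -
            have "subst_sum u x y (x # bar n y # es) = X y" "subst_sum u (bar n y) (bar n x) (x # bar n y # es) = X x"
              using subst_sum_distinct[OF d, of 0 x u y] subst_sum_distinct[OF d, of 1 "bar n y" u "bar n x"] by (simp_all add: X_def)
            then show ?thesis using l unfolding linked_def by metis
          qed
          show ?thesis
          proof (cases "p < q")
            case True
            then show ?thesis
              using nzp free ne by (intro exchange linked_same(1)[OF _ q sides(1)]) auto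
          next
            case qp: False
            then show ?thesis
              using nzp free ne \<open>q \<noteq> p\<close> by (intro exchange[symmetric] linked_same(1)[OF _ pn(1) sides(2)]) auto
          qed
        qed simp
        then show ?thesis using True free by simp
      qed
    qed
    have "(\<Sum>q<n. X q) = of_nat (card {q. q < n \<and> q \<in> G \<and> q \<notin> set es \<and> bar n q \<notin> set es}) * X p"
      using Xq by (simp add: sum.If_cases Int_def conj_ac)
    moreover have "p \<in> {q. q < n \<and> q \<in> G \<and> q \<notin> set es \<and> bar n q \<notin> set es}"
      using pn pG nzp by auto
    then have "card {q. q < n \<and> q \<in> G \<and> q \<notin> set es \<and> bar n q \<notin> set es} \<noteq> 0"
      using card_eq_0_iff by fastforce
    ultimately show False using sum0 Xp by simp
  qed
  then show ?thesis using I(1) by blast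
qed

end

section \<open>Leading coefficients in a product of two exterior powers\<close>

lemma swp_append_left: "i < length I \<Longrightarrow> j < length I \<Longrightarrow> swp i j (I @ J) = swp i j I @ J"
  by (simp add: swp_def list_update_append nth_append)

lemma swp_append_right:
  "i < length J \<Longrightarrow> j < length J \<Longrightarrow> swp (length I + i) (length I + j) (I @ J) = I @ swp i j J"
  by (simp add: swp_def list_update_append nth_append)

lemma prim_blocks_first_block:
  assumes W: "prim_blocks n c d f" and len: "length D = d"
  shows "supported (2*n) c (\<lambda>I. f (I @ D))" "alt1 0 c (\<lambda>I. f (I @ D))"
    "2 \<le> c \<Longrightarrow> traceless n c 0 1 (\<lambda>I. f (I @ D))"
proof -
  have W': "supported (2*n) (c + d) f" "alt1 0 c f" "2 \<le> c \<Longrightarrow> traceless n (c + d) 0 1 f"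
    using W unfolding prim_blocks_def by auto
  show sup: "supported (2*n) c (\<lambda>I. f (I @ D))"
    using W'(1) len unfolding supported_def idx_def by fastforce
  show "alt1 0 c (\<lambda>I. f (I @ D))"
    unfolding alt1_def
  proof (intro allI impI)
    fix xs i j assume ij: "0 \<le> i" "i < j" "j < 0 + c"
    show "f (swp i j xs @ D) = - f (xs @ D)"
    proof (cases "length xs = c")
      case True
      then have "f (swp i j (xs @ D)) = - f (xs @ D)" using W'(2) ij unfolding alt1_def by simp
      then show ?thesis using True ij by (simp add: swp_append_left)
    next
      case False
      then show ?thesis using supported_zero[OF sup] by simp
    qed
  qed
  show "traceless n c 0 1 (\<lambda>I. f (I @ D))" if "2 \<le> c"
    unfolding traceless_def
  proof (intro allI impI)
    fix xs :: "nat list" assume l: "length xs = c"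
    have "contraction n 0 1 (\<lambda>I. f (I @ D)) xs = contraction n 0 1 f (xs @ D)"
      using that l unfolding contraction_def by (simp add: list_update_append)
    then show "contraction n 0 1 (\<lambda>I. f (I @ D)) xs = 0"
      using W'(3)[OF that] l len unfolding traceless_def by simp
  qed
qed

lemma prim_blocks_second_block:
  assumes W: "prim_blocks n c d f" and len: "length I = c"
  shows "supported (2*n) d (\<lambda>J. f (I @ J))" "alt1 0 d (\<lambda>J. f (I @ J))"
    "2 \<le> d \<Longrightarrow> traceless n d 0 1 (\<lambda>J. f (I @ J))"
proof -
  have W': "supported (2*n) (c + d) f" "alt1 c d f" "2 \<le> d \<Longrightarrow> traceless n (c + d) c (Suc c) f"
    using W unfolding prim_blocks_def by auto
  show sup: "supported (2*n) d (\<lambda>J. f (I @ J))"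
    using W'(1) len unfolding supported_def idx_def by fastforce
  show "alt1 0 d (\<lambda>J. f (I @ J))"
    unfolding alt1_def
  proof (intro allI impI)
    fix xs i j assume ij: "0 \<le> i" "i < j" "j < 0 + d"
    show "f (I @ swp i j xs) = - f (I @ xs)"
    proof (cases "length xs = d")
      case True
      then have "f (swp (c + i) (c + j) (I @ xs)) = - f (I @ xs)" using W'(2) ij unfolding alt1_def by simp
      then show ?thesis using True ij swp_append_right[of i xs j I] len by simp
    next
      case False
      then show ?thesis using supported_zero[OF sup] by simp
    qed
  qed
  show "traceless n d 0 1 (\<lambda>J. f (I @ J))" if "2 \<le> d"
    unfolding traceless_def
  proof (intro allI impI)
    fix xs :: "nat list" assume l: "length xs = d"
    have "contraction n 0 1 (\<lambda>J. f (I @ J)) xs = contraction n c (Suc c) f (I @ xs)"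
      using len unfolding contraction_def by (simp add: list_update_append)
    then show "contraction n 0 1 (\<lambda>J. f (I @ J)) xs = 0"
      using W'(3)[OF that] l len unfolding traceless_def by simp
  qed
qed

lemma lact_append:
  assumes "i < 2*n" "j < 2*n"
  shows "lact (2*n) (sp_unit n i j) f (I @ J)
    = lact (2*n) (sp_unit n i j) (\<lambda>I'. f (I' @ J)) I + lact (2*n) (sp_unit n i j) (\<lambda>J'. f (I @ J')) J"
  unfolding lact_sp_unit_subst_sum[OF assms] subst_sum_append by (simp add: algebra_simps)

lemma height_mset: "mset xs = mset ys \<Longrightarrow> height n xs = height n ys"
proof -
  have "height n xs = sum_mset (image_mset (eta n) (mset xs))" for xs
  proof -
    have "height n xs = sum_list (map (eta n) xs)"
      by (simp add: height_def sum_list_sum_nth lessThan_atLeast0)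
    then show ?thesis by (simp only: mset_map[symmetric] sum_mset_sum_list)
  qed
  then show "mset xs = mset ys \<Longrightarrow> height n xs = height n ys" by simp
qed

lemma down_closed_eq:
  fixes S :: "nat set"
  assumes "finite S" "\<And>p q. q \<in> S \<Longrightarrow> p < q \<Longrightarrow> p \<in> S"
  shows "S = {..<card S}"
proof -
  obtain m where "S = {..<m}"
  proof (cases "S = {}")
    case False
    have "S = {..<Suc (Max S)}"
    proof
      show "S \<subseteq> {..<Suc (Max S)}" using assms(1) by (auto simp: less_Suc_eq_le)
      have "Max S \<in> S" using assms(1) False by (rule Max_in)
      then show "{..<Suc (Max S)} \<subseteq> S" using assms(2) by (auto simp: less_Suc_eq)
    qed
    then show ?thesis using that by blast
  qed auto
  then show ?thesis by simp
qed

text \<open>The terms of maximal height in the second factor form a highest weight vector of that factor,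
  hence involve only the coefficient at \<open>[0..<d]\<close>.\<close>

lemma leading_coefficient:
  assumes W: "prim_blocks n c d f" and hw: "highest_weight n f" and nz: "f xs0 \<noteq> 0"
  shows "\<exists>I. length I = c \<and> f (I @ [0..<d]) \<noteq> 0"
proof -
  have sup: "supported (2*n) (c + d) f" using W unfolding prim_blocks_def by blast
  define P where "P x \<longleftrightarrow> length (fst x) = c \<and> f (fst x @ snd x) \<noteq> 0" for x
  have inidx: "J \<in> idx (2*n) d" if "P (I, J)" for I J
    using prim_blocks_second_block(1)[OF W, of I] that unfolding P_def supported_def by auto
  have "xs0 \<in> idx (2*n) (c + d)" using sup nz unfolding supported_def by blast
  then have "P (take c xs0, drop c xs0)" using nz by (simp add: P_def idx_def)
  moreover have "height n (snd x) < Suc (d * (2*n))" if "P x" for x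
    using height_le[OF inidx[of "fst x" "snd x"]] that by simp
  ultimately obtain x where x: "P x" "\<And>y. P y \<Longrightarrow> height n (snd y) \<le> height n (snd x)"
    using ex_has_greatest_nat[of P _ "\<lambda>x. height n (snd x)", OF _ allI, of _ "Suc (d * (2*n))"] by blast
  obtain I J0 where IJ: "x = (I, J0)" by (cases x)
  define h where "h = height n J0"
  have len: "length I = c" and nz0: "f (I @ J0) \<noteq> 0" using x(1) by (simp_all add: P_def IJ)
  have max: "f (I' @ J) = 0" if "length I' = c" "h < height n J" for I' J
    using x(2)[of "(I', J)"] that by (auto simp: P_def IJ h_def)
  define \<phi> where "\<phi> J = (if height n J = h then f (I @ J) else 0)" for J
  note S = prim_blocks_second_block[OF W len]
  have sup\<phi>: "supported (2*n) d \<phi>" using S(1) unfolding supported_def \<phi>_def by simp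
  have alt\<phi>: "alt1 0 d \<phi>"
    unfolding alt1_def
  proof (intro allI impI)
    fix xs i j assume ij: "0 \<le> i" "i < j" "j < 0 + d"
    show "\<phi> (swp i j xs) = - \<phi> xs"
    proof (cases "length xs = d")
      case True
      then have "height n (swp i j xs) = height n xs" using ij by (intro height_mset mset_swp) auto
      then show ?thesis using S(2) ij by (simp add: \<phi>_def alt1_def)
    qed (simp add: supported_zero[OF sup\<phi>])
  qed
  have tr\<phi>: "traceless n d 0 1 \<phi>" if d2: "2 \<le> d"
    unfolding traceless_def
  proof (intro allI impI)
    fix xs :: "nat list" assume l: "length xs = d"
    \<comment> \<open>The values \<open>eta\<close> of two partners add up to \<open>2*n\<close>, so
      all terms of one contraction have the same height: either all of them belong to
      \<open>\<phi>\<close> or none does.\<close>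
    have hts: "height n (xs[0 := q, 1 := bar n q]) + eta n (xs!1) + eta n (xs!0) = height n xs + 2*n" if "q < 2*n" for q
      using height_update[of 0 xs n q] height_update[of 1 "xs[0 := q]" n "bar n q"] l d2 that eta_bar[OF that] eta_le[OF that]
      by simp
    show "contraction n 0 1 \<phi> xs = 0"
    proof (cases "height n xs + 2*n = h + eta n (xs!1) + eta n (xs!0)")
      case True
      have "contraction n 0 1 \<phi> xs = contraction n 0 1 (\<lambda>J. f (I @ J)) xs"
        unfolding contraction_bar
      proof (intro sum.cong refl)
        fix q assume "q \<in> {..<2*n}"
        then have "height n (xs[0 := q, 1 := bar n q]) = h" using hts[of q] True by simp
        then show "bar_sgn n q * \<phi> (xs[0 := q, 1 := bar n q]) = bar_sgn n q * f (I @ xs[0 := q, 1 := bar n q])"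
          by (simp add: \<phi>_def)
      qed
      then show ?thesis using S(3)[OF d2] l unfolding traceless_def by simp
    next
      case False
      have "height n (xs[0 := q, 1 := bar n q]) \<noteq> h" if "q < 2*n" for q
        using hts[OF that] False by linarith
      then show ?thesis unfolding contraction_bar by (simp add: \<phi>_def)
    qed
  qed
  \<comment> \<open>Where the result could be nonzero, \<open>J\<close> has height above
    \<open>h\<close>. There the action on the first block vanishes by maximality, and the action on
    the second block involves only lists of height \<open>h\<close>, on which \<open>\<phi>\<close>
    is \<open>f\<close>.\<close>
  have raise: "lact (2*n) (sp_unit n i j) \<phi> J = 0" if ij: "i < 2*n" "j < 2*n" "eta n j < eta n i" for i j J
  proof (rule ccontr)
    assume "lact (2*n) (sp_unit n i j) \<phi> J \<noteq> 0"
    moreover obtain ys where "\<phi> ys \<noteq> 0" "height n ys + eta n i = height n J + eta n j"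
      using lact_sp_unit_height[OF ij(1,2) calculation] by blast
    then have hJ: "h + eta n i = height n J + eta n j" by (auto simp: \<phi>_def split: if_splits)
    then have hlt: "h < height n J" using ij(3) by simp
    have "lact (2*n) (sp_unit n i j) \<phi> J = lact (2*n) (sp_unit n i j) (\<lambda>J'. f (I @ J')) J"
      unfolding lact_sp_unit[OF ij(1,2)]
    proof (intro sum.cong refl)
      fix r assume "r \<in> {..<length J}"
      then have r: "r < length J" by simp
      have "height n (J[r := j]) = h" if "J!r = i"
        using height_update[OF r, of n j] hJ that by simp
      moreover have "height n (J[r := bar n i]) = h" if "J!r = bar n j"
        using height_update[OF r, of n "bar n i"] hJ that eta_bar[OF ij(1)] eta_bar[OF ij(2)] eta_le[OF ij(1)] eta_le[OF ij(2)]
        by simp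
      ultimately show "(if J!r = i then \<phi> (J[r := j]) else 0) - bar_sgn n i * bar_sgn n j * (if J!r = bar n j then \<phi> (J[r := bar n i]) else 0)
        = (if J!r = i then f (I @ J[r := j]) else 0) - bar_sgn n i * bar_sgn n j * (if J!r = bar n j then f (I @ J[r := bar n i]) else 0)"
        by (simp add: \<phi>_def)
    qed
    moreover have "lact (2*n) (sp_unit n i j) f (I @ J) = 0" using hw ij unfolding highest_weight_def by blast
    moreover have "lact (2*n) (sp_unit n i j) (\<lambda>I'. f (I' @ J)) I = 0"
      unfolding lact_sp_unit[OF ij(1,2)] using max[OF _ hlt] len by (intro sum.neutral) simp
    ultimately show False
      using lact_append[OF ij(1,2), of f I J] by simp
  qed
  \<comment> \<open>With Levi parameter \<open>0\<close> a list without pairs contains no barred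
    index by \<open>nonneg_weight\<close>, and its entries form an initial segment by
    \<open>mono_weight\<close>.\<close>
  interpret B: block n d 0 \<phi>
  proof
    show "lact (2*n) (sp_unit n p q) \<phi> xs = 0" if "p < q" "q < n" for p q xs
      using that by (intro raise) (auto simp: eta_def)
    show "lact (2*n) (sp_unit n q (bar n q)) \<phi> xs = 0" if "q < n" for q xs
      using that by (intro raise) (auto simp: eta_def bar_def)
  qed (use sup\<phi> alt\<phi> tr\<phi> in auto)
  have "\<phi> J0 \<noteq> 0" using nz0 by (simp add: \<phi>_def h_def)
  then obtain J where J: "\<phi> J \<noteq> 0" and np: "\<And>p. p < n \<Longrightarrow> \<not> (p \<in> set J \<and> bar n p \<in> set J)"
    using B.exists_pairless[of J0 "{0..<n}"] by auto
  have J': "length J = d" "distinct J" "set J \<subseteq> {..<2*n}" using B.nz[OF J] by auto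
  have nobar: "bar n q \<notin> set J" if "q < n" for q
    using B.nonneg_weight[OF J _ that] np[OF that] by auto
  have low: "x < n" if "x \<in> set J" for x
  proof (rule ccontr)
    assume "\<not> x < n"
    then have "x = bar n (x - n)" "x - n < n" using that J'(3) by (auto simp: bar_def)
    then show False using nobar that by metis
  qed
  have "p \<in> set J" if "q \<in> set J" "p < q" for p q
    using B.mono_weight[OF J that(2) low[OF that(1)]] nobar low[OF that(1)] that
    by (auto simp: of_bool_def split: if_splits)
  then have "set J = {..<card (set J)}" by (intro down_closed_eq) auto
  then have "set J = set [0..<d]" using J' by (simp add: distinct_card atLeast0LessThan)
  then have "mset [0..<d] = mset J" using J' set_eq_iff_mset_eq_distinct[of J "[0..<d]"] by (metis distinct_upt)
  then have "\<phi> [0..<d] \<noteq> 0" by (rule alt1_mset[OF alt\<phi> J'(1) _ J])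
  then have "f (I @ [0..<d]) \<noteq> 0" by (auto simp: \<phi>_def split: if_splits)
  then show ?thesis using len by blast
qed

text \<open>A raising operator of the Levi subgroup either replaces nothing in
  \<open>[0..<d]\<close> or creates a repetition there. Its action on \<open>f\<close> at such a
  list therefore reduces to the first block.\<close>

lemma leading_block:
  assumes W: "prim_blocks n c d f" and hw: "highest_weight n f" and d: "d \<le> n"
  shows "block n c d (\<lambda>I. f (I @ [0..<d]))"
proof
  let ?D = "[0..<d]"
  have lenD: "length ?D = d" by simp
  note S = prim_blocks_first_block[OF W lenD]
  show "d \<le> n" "supported (2*n) c (\<lambda>I. f (I @ ?D))" "alt1 0 c (\<lambda>I. f (I @ ?D))"
    "2 \<le> c \<Longrightarrow> traceless n c 0 1 (\<lambda>I. f (I @ ?D))" using d S by auto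
  have main: "lact (2*n) (sp_unit n i j) (\<lambda>I. f (I @ ?D)) I = 0"
    if ij: "i < 2*n" "j < 2*n" "eta n j < eta n i"
      and z1: "length I = c \<Longrightarrow> subst_sum (\<lambda>J. f (I @ J)) i j ?D = 0"
      and z2: "bar n j \<notin> set ?D" for i j I
  proof (cases "length I = c")
    case True
    have "lact (2*n) (sp_unit n i j) f (I @ ?D) = 0" using hw ij unfolding highest_weight_def by blast
    moreover have "lact (2*n) (sp_unit n i j) (\<lambda>J. f (I @ J)) ?D = 0"
      unfolding lact_sp_unit_subst_sum[OF ij(1,2)] using z1[OF True] subst_sum_notin[OF z2] by simp
    ultimately show ?thesis using lact_append[OF ij(1,2), of f I ?D] by simp
  next
    case False
    have "supported (2*n) c (lact (2*n) (sp_unit n i j) (\<lambda>I. f (I @ ?D)))"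
      using ij by (intro supported_lact S) (auto intro: sp_unit_zero)
    then show ?thesis using False supported_zero by blast
  qed
  show "lact (2*n) (sp_unit n p q) (\<lambda>I. f (I @ ?D)) I = 0" if pq: "p < q" "q < n" "q < d \<or> d \<le> p" for p q I
  proof (rule main)
    show "p < 2*n" "q < 2*n" "eta n q < eta n p" using pq by (auto simp: eta_def)
    show "bar n q \<notin> set ?D" using pq d by (auto simp: bar_def)
    assume len: "length I = c"
    show "subst_sum (\<lambda>J. f (I @ J)) p q ?D = 0"
    proof (cases "p < d")
      case True
      then have "subst_sum (\<lambda>J. f (I @ J)) p q ?D = f (I @ ?D[p := q])"
        by (intro subst_sum_distinct) auto
      also have "\<dots> = 0"
      proof (rule alt1_nondistinct[OF prim_blocks_second_block(2)[OF W len]])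
        have eq: "?D[p := q] ! p = ?D[p := q] ! q" using True pq by simp
        show "\<not> distinct (?D[p := q])"
        proof
          assume "distinct (?D[p := q])"
          then show False using nth_eq_iff_index_eq[of "?D[p := q]" p q] eq True pq by simp
        qed
      qed simp
      finally show ?thesis .
    qed (auto intro: subst_sum_notin)
  qed
  show "lact (2*n) (sp_unit n q (bar n q)) (\<lambda>I. f (I @ ?D)) I = 0" if q: "d \<le> q" "q < n" for q I
  proof (rule main)
    show "q < 2*n" "bar n q < 2*n" "eta n (bar n q) < eta n q" using q by (auto simp: eta_def bar_def)
    show "bar n (bar n q) \<notin> set ?D" using q by simp
    show "subst_sum (\<lambda>J. f (I @ J)) q (bar n q) ?D = 0" using q by (intro subst_sum_notin) auto
  qed
qed

text \<open>The raising operator from \<open>q\<close> to \<open>p\<close> lies outside the Levi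
  subgroup and also changes the second block. Evaluating it at three lists gives \<open>E1\<close>,
  \<open>E2\<close> and \<open>E3\<close>, which combine to
  \<open>f (I @ [0..<d]) = - f (I @ [0..<d])\<close>. The excluded configuration is the only one in
  which the total weight would increase from \<open>p < d\<close> to \<open>q >= d\<close>.\<close>

lemma leading_cross:
  assumes W: "prim_blocks n c d f" and hw: "highest_weight n f" and pq: "p < d" "d \<le> q" "q < n" and nz: "f (I @ [0..<d]) \<noteq> 0"
    and I: "length I = c" "distinct I" "bar n p \<in> set I" "p \<notin> set I" "q \<in> set I" "bar n q \<notin> set I"
  shows False
proof -
  let ?D = "[0..<d]"
  let ?D1 = "?D[p := q]"
  have lt: "p < 2*n" "q < 2*n" "eta n q < eta n p" using pq by (auto simp: eta_def)
  have key: "subst_sum f p q xs = subst_sum f (bar n q) (bar n p) xs" for xs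
  proof -
    have "lact (2*n) (sp_unit n p q) f xs = 0" using hw lt unfolding highest_weight_def by blast
    then show ?thesis using pq unfolding lact_sp_unit_subst_sum[OF lt(1,2)] by (simp add: bar_sgn_def)
  qed
  have ne: "bar n p \<noteq> p" "bar n q \<noteq> p" "bar n q \<noteq> q" "bar n p \<noteq> q" "bar n p \<noteq> bar n q" "p \<noteq> q"
    using pq by (auto simp: bar_def)
  obtain r where r: "r < length I" "I!r = bar n p" using I(3) by (auto simp: in_set_conv_nth)
  obtain s where s: "s < length I" "I!s = q" using I(5) by (auto simp: in_set_conv_nth)
  have rs: "r \<noteq> s" using r s ne by auto
  have Dp: "?D!p = p" "p < length ?D" using pq by simp_all
  have bqD: "bar n q \<notin> set ?D" "bar n q \<notin> set ?D1" and pD1: "p \<notin> set ?D1"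
  proof -
    show "bar n q \<notin> set ?D" using pq by (auto simp: bar_def)
    then show "bar n q \<notin> set ?D1" using ne set_update_subset_insert[of ?D p q] by auto
    show "p \<notin> set ?D1" using pq by (auto simp: in_set_conv_nth nth_list_update split: if_splits)
  qed
  have dD: "distinct ?D" by simp
  let ?I1 = "I[s := p]" and ?I2 = "I[r := bar n q]" and ?I3 = "I[s := p, r := bar n q]"
  have d1: "distinct ?I1" and d2: "distinct ?I2" using I by (auto intro: distinct_update)
  have d3: "distinct ?I3"
    by (rule distinct_update[OF d1]) (use I(6) ne set_update_subset_insert[of I s p] in auto)
  have restore: "?I1[s := q] = I" "?I2[r := bar n p] = I" "?I3[s := q] = ?I2" "?I3[r := bar n p] = ?I1"
    using r s rs by (auto simp: list_update_swap nth_list_update intro!: nth_equalityI)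
  have E1: "f (I @ ?D) + f (?I1 @ ?D1) = 0"
  proof -
    have "subst_sum (\<lambda>I'. f (I' @ ?D)) p q ?I1 = f (I @ ?D)"
      using subst_sum_distinct[OF d1, of s p "\<lambda>I'. f (I' @ ?D)" q] s restore by simp
    moreover have "subst_sum (\<lambda>J. f (?I1 @ J)) p q ?D = f (?I1 @ ?D1)"
      using subst_sum_distinct[OF dD Dp(2,1), of "\<lambda>J. f (?I1 @ J)" q] by simp
    moreover have "bar n q \<notin> set ?I1" using I(6) ne set_update_subset_insert[of I s p] by auto
    ultimately show ?thesis
      using key[of "?I1 @ ?D"] bqD unfolding subst_sum_append by (simp add: subst_sum_notin)
  qed
  have E2: "f (?I2 @ ?D1) = f (?I1 @ ?D1)"
  proof -
    have "subst_sum (\<lambda>I'. f (I' @ ?D1)) p q ?I3 = f (?I2 @ ?D1)"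
      using subst_sum_distinct[OF d3, of s p "\<lambda>I'. f (I' @ ?D1)" q] s rs restore by simp
    moreover have "subst_sum (\<lambda>I'. f (I' @ ?D1)) (bar n q) (bar n p) ?I3 = f (?I1 @ ?D1)"
      using subst_sum_distinct[OF d3, of r "bar n q" "\<lambda>I'. f (I' @ ?D1)" "bar n p"] r restore by simp
    ultimately show ?thesis
      using key[of "?I3 @ ?D1"] bqD pD1 unfolding subst_sum_append by (simp add: subst_sum_notin)
  qed
  have E3: "f (?I2 @ ?D1) = f (I @ ?D)"
  proof -
    have "p \<notin> set ?I2" using I(4) ne set_update_subset_insert[of I r "bar n q"] by auto
    moreover have "subst_sum (\<lambda>J. f (?I2 @ J)) p q ?D = f (?I2 @ ?D1)"
      using subst_sum_distinct[OF dD Dp(2,1), of "\<lambda>J. f (?I2 @ J)" q] by simp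
    moreover have "subst_sum (\<lambda>I'. f (I' @ ?D)) (bar n q) (bar n p) ?I2 = f (I @ ?D)"
      using subst_sum_distinct[OF d2, of r "bar n q" "\<lambda>I'. f (I' @ ?D)" "bar n p"] r restore by simp
    ultimately show ?thesis
      using key[of "?I2 @ ?D"] bqD unfolding subst_sum_append by (simp add: subst_sum_notin)
  qed
  from E1 E2 E3 nz show False by simp
qed

section \<open>Weights and the necessary conditions\<close>

lemma weight_append: "weight n p (A @ B) = weight n p A + weight n p B"
proof -
  let ?g = "\<lambda>xs r. (if xs!r = p then 1 else 0) - (if xs!r = bar n p then 1 else 0) :: int"
  have "weight n p (A @ B) = sum (?g (A @ B)) {0..<length A} + sum (?g (A @ B)) {length A..<length A + length B}"
    unfolding weight_def lessThan_atLeast0 length_append by (rule sum.atLeastLessThan_concat[symmetric]) simp_all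
  also have "sum (?g (A @ B)) {0..<length A} = weight n p A"
    unfolding weight_def lessThan_atLeast0 by (intro sum.cong) (auto simp: nth_append)
  also have "sum (?g (A @ B)) {length A..<length A + length B} = (\<Sum>r=0..<length B. ?g (A @ B) (r + length A))"
    using sum.shift_bounds_nat_ivl[of "?g (A @ B)" 0 "length A" "length B"] by (simp add: add.commute)
  also have "\<dots> = weight n p B"
    unfolding weight_def lessThan_atLeast0 by (intro sum.cong) (auto simp: nth_append)
  finally show ?thesis .
qed

lemma weight_distinct:
  assumes "distinct xs"
  shows "weight n p xs = of_bool (p \<in> set xs) - of_bool (bar n p \<in> set xs)"
proof -
  have "(\<Sum>r<length xs. if xs!r = x then 1 else (0::int)) = of_bool (x \<in> set xs)" for x
  proof (cases "x \<in> set xs")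
    case True
    then obtain s where s: "s < length xs" "xs!s = x" by (auto simp: in_set_conv_nth)
    then have "(\<Sum>r<length xs. if xs!r = x then 1 else (0::int)) = (\<Sum>r<length xs. if r = s then 1 else 0)"
      using assms by (intro sum.cong) (auto simp: nth_eq_iff_index_eq)
    then show ?thesis using s True by simp
  next
    case False
    then have "(\<Sum>r<length xs. if xs!r = x then 1 else (0::int)) = 0"
      by (intro sum.neutral) (auto simp: in_set_conv_nth)
    then show ?thesis using False by simp
  qed
  then show ?thesis unfolding weight_def by (simp add: sum_subtractf)
qed

lemma length_distinct_sum:
  assumes "distinct I" "set I \<subseteq> {..<2*n}"
  shows "int (length I) = (\<Sum>p<n. of_bool (p \<in> set I) + of_bool (bar n p \<in> set I))"
proof -
  have "int (length I) = int (card ({..<2*n} \<inter> set I))"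
    using assms by (simp add: distinct_card Int_absorb1)
  also have "\<dots> = (\<Sum>i<2*n. of_bool (i \<in> set I))"
    by (simp add: of_bool_def sum.If_cases)
  also have "\<dots> = (\<Sum>p<n. of_bool (p \<in> set I) + of_bool (p + n \<in> set I))"
    by (rule sum_double)
  finally show ?thesis by (simp add: bar_def)
qed

lemma sum_of_bool_less: "m \<le> n \<Longrightarrow> (\<Sum>p<n. of_bool (p < m)) = int m"
proof -
  assume "m \<le> n"
  then have "{..<n} \<inter> {p. p < m} = {..<m}" by auto
  then show ?thesis by (simp add: of_bool_def sum.If_cases)
qed

definition shape :: "nat \<Rightarrow> nat \<Rightarrow> nat \<Rightarrow> (nat \<Rightarrow> int) \<Rightarrow> bool" where
  "shape n a b lam \<longleftrightarrow> b \<le> a \<and> a \<le> n \<and> (\<forall>p<n. lam p = of_bool (p < a) + of_bool (p < b))"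

lemma shape_exists:
  assumes mono: "\<And>p q. p < q \<Longrightarrow> q < n \<Longrightarrow> lam q \<le> (lam p :: int)"
    and range: "\<And>p. p < n \<Longrightarrow> 0 \<le> lam p \<and> lam p \<le> 2"
  shows "\<exists>a b. shape n a b lam"
proof -
  define S where "S t = {p. p < n \<and> t \<le> lam p}" for t
  have S: "S t = {..<card (S t)}" for t
    using mono by (intro down_closed_eq) (auto simp: S_def intro: order_trans)
  have mem: "p < card (S t) \<longleftrightarrow> p < n \<and> t \<le> lam p" for p t
    using S[of t] by (auto simp: S_def)
  have "S 2 \<subseteq> S 1" "S 1 \<subseteq> {..<n}" by (auto simp: S_def)
  then have "card (S 2) \<le> card (S 1)" "card (S 1) \<le> n"
    using card_mono[of "S 1" "S 2"] card_mono[of "{..<n}" "S 1"] finite_subset[of "S 1" "{..<n}"] by auto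
  moreover have "lam p = of_bool (p < card (S 1)) + of_bool (p < card (S 2))" if "p < n" for p
    using range[OF that] that mem[of p 1] mem[of p 2] by (auto simp: of_bool_def)
  ultimately show ?thesis unfolding shape_def by blast
qed

lemma sum_casimir: "a \<le> n \<Longrightarrow> (\<Sum>p<a. x + 2 * (int n - int p)) = int a * (x + 2 * int n + 1 - int a)"
  by (induction a) (auto simp: algebra_simps)

lemma shape_casimir:
  assumes "shape n a b lam"
  shows "(\<Sum>p<n. (lam p)\<^sup>2 + 2 * (int n - int p) * lam p) = int a * (2 * int n + 2 - int a) + int b * (2 * int n + 4 - int b)"
proof -
  have ab: "b \<le> a" "a \<le> n" using assms by (auto simp: shape_def)
  have cut: "(\<Sum>p<n. if p < m then g p else 0) = (\<Sum>p<m. g p)" if "m \<le> n" for m and g :: "nat \<Rightarrow> int"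
    using that by (intro sum.mono_neutral_cong_right) auto
  have "(\<Sum>p<n. (lam p)\<^sup>2 + 2 * (int n - int p) * lam p)
    = (\<Sum>p<n. (if p < a then 1 + 2 * (int n - int p) else 0) + (if p < b then 3 + 2 * (int n - int p) else 0))"
    using assms ab by (intro sum.cong) (auto simp: shape_def of_bool_def)
  also have "\<dots> = (\<Sum>p<a. 1 + 2 * (int n - int p)) + (\<Sum>p<b. 3 + 2 * (int n - int p))"
    by (subst sum.distrib) (simp only: cut[OF ab(2)] cut[OF order_trans[OF ab]])
  also have "\<dots> = int a * (1 + 2 * int n + 1 - int a) + int b * (3 + 2 * int n + 1 - int b)"
    by (simp only: sum_casimir[OF ab(2)] sum_casimir[OF order_trans[OF ab]])
  finally show ?thesis by (simp add: algebra_simps)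
qed

text \<open>With \<open>x = a' - a\<close> and \<open>y = b - b'\<close> the hypothesis becomes
  \<open>e\<close>. If \<open>x > 0\<close>, then \<open>x <= y\<close> and the second factor on the
  left is smaller than the one on the right because \<open>b <= a\<close>, so the left side is
  strictly smaller. If \<open>x <= 0\<close>, the left side is nonpositive and the right side
  nonnegative, so both vanish.\<close>

lemma casimir_injective:
  fixes a b a' b' n :: nat
  assumes "b \<le> a" "a \<le> n" "b' \<le> a'" "a' \<le> n" "b' \<le> b" "a' + b' \<le> a + b"
    and eq: "int a' * (2 * int n + 2 - int a') + int b' * (2 * int n + 4 - int b')
      = int a * (2 * int n + 2 - int a) + int b * (2 * int n + 4 - int b)"
  shows "a' = a \<and> b' = b"
proof -
  define y where "y = int b - int b'"
  define x where "x = int a' - int a"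
  have y0: "0 \<le> y" and xy: "x \<le> y" using assms by (auto simp: x_def y_def)
  have a': "int a' = int a + x" and b': "int b' = int b - y" by (simp_all add: x_def y_def)
  have e: "x * (2 * int n + 2 - 2 * int a - x) = y * (2 * int n + 4 - 2 * int b + y)"
    using eq unfolding a' b' by (simp add: algebra_simps)
  have pos: "0 < 2 * int n + 4 - 2 * int b + y" using assms y0 by simp
  show ?thesis
  proof (cases "0 < x")
    case True
    then have "0 < y" using xy by simp
    have "2 * int n + 2 - 2 * int a - x < 2 * int n + 4 - 2 * int b + y" using assms(1) True \<open>0 < y\<close> by simp
    then have "x * (2 * int n + 2 - 2 * int a - x) < x * (2 * int n + 4 - 2 * int b + y)" using True by simp
    also have "\<dots> \<le> y * (2 * int n + 4 - 2 * int b + y)" using xy pos by (intro mult_right_mono) auto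
    finally show ?thesis using e by simp
  next
    case False
    have "0 < 2 * int n + 2 - 2 * int a - x" using False assms(2) by simp
    then have "x * (2 * int n + 2 - 2 * int a - x) \<le> 0" using False by (intro mult_nonpos_nonneg) auto
    moreover have "0 \<le> y * (2 * int n + 4 - 2 * int b + y)" using y0 pos by simp
    ultimately have "x * (2 * int n + 2 - 2 * int a - x) = 0" "y * (2 * int n + 4 - 2 * int b + y) = 0" using e by linarith+
    then have "x = 0" "y = 0" using pos \<open>0 < 2 * int n + 2 - 2 * int a - x\<close> by auto
    then show ?thesis by (simp add: x_def y_def)
  qed
qed

text \<open>Inside each part of the Levi subgroup the weights decrease by
  \<open>mono_weight\<close>, and across the boundary by \<open>leading_cross\<close>. They are
  nonnegative for \<open>p < d\<close> because \<open>[0..<d]\<close> contributes \<open>1\<close>,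
  and for \<open>p >= d\<close> by \<open>nonneg_weight\<close>.\<close>

lemma leading_shape:
  assumes W: "prim_blocks n c d f" and hw: "highest_weight n f" and d: "d \<le> n" and nz: "f (I @ [0..<d]) \<noteq> 0"
  defines "lam \<equiv> \<lambda>p. weight n p (I @ [0..<d])"
  shows "\<And>p. p < n \<Longrightarrow> lam p = of_bool (p \<in> set I) - of_bool (bar n p \<in> set I) + of_bool (p < d)"
    and "\<exists>a b. shape n a b lam"
    and "\<And>q. d \<le> q \<Longrightarrow> q < n \<Longrightarrow> bar n q \<in> set I \<Longrightarrow> q \<in> set I"
    and "int c = (\<Sum>p<n. of_bool (p \<in> set I) + of_bool (bar n p \<in> set I))"
proof -
  interpret B: block n c d "\<lambda>I. f (I @ [0..<d])" by (rule leading_block[OF W hw d])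
  have I: "length I = c" "distinct I" "set I \<subseteq> {..<2*n}" using B.nz[OF nz] by auto
  show weight: "lam p = of_bool (p \<in> set I) - of_bool (bar n p \<in> set I) + of_bool (p < d)" if "p < n" for p
    using that d I unfolding lam_def weight_append by (auto simp: weight_distinct bar_def)
  show nn: "q \<in> set I" if "d \<le> q" "q < n" "bar n q \<in> set I" for q
    by (rule B.nonneg_weight[OF nz that])
  show "int c = (\<Sum>p<n. of_bool (p \<in> set I) + of_bool (bar n p \<in> set I))"
    using length_distinct_sum[OF I(2,3)] I(1) by simp
  show "\<exists>a b. shape n a b lam"
  proof (rule shape_exists)
    fix p assume p: "p < n"
    show "0 \<le> lam p \<and> lam p \<le> 2"
      using nn[of p] weight[OF p] p by (cases "p < d") (auto simp: of_bool_def)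
  next
    fix p q assume pq: "p < q" "q < n"
    show "lam q \<le> lam p"
    proof (cases "q < d \<or> d \<le> p")
      case True
      then show ?thesis
        using B.mono_weight[OF nz pq True] weight[of p] weight[of q] pq by (auto simp: of_bool_def)
    next
      case False
      then have pd: "p < d" "d \<le> q" by auto
      have "\<not> (bar n p \<in> set I \<and> p \<notin> set I \<and> q \<in> set I \<and> bar n q \<notin> set I)"
        using leading_cross[OF W hw pd pq(2) nz I(1,2)] by blast
      then show ?thesis using nn[OF pd(2) pq(2)] weight[of p] weight[of q] pq pd by (auto simp: of_bool_def)
    qed
  qed
qed

text \<open>For every \<open>p\<close> the shape ties the occurrences of \<open>p\<close> and
  \<open>bar n p\<close> in \<open>I\<close> to \<open>a\<close>, \<open>b\<close> and
  \<open>d\<close>; each numerical condition is a sum of such relations over \<open>p\<close>. An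
  index list without pairs below \<open>d\<close> (\<open>I1\<close>) gives
  \<open>c + d + a <= 2*n + b\<close>, one without pairs from \<open>d\<close> on
  (\<open>I2\<close>) gives \<open>c + b <= a + d\<close>, and the others hold for any list.\<close>

lemma tensor_product_constraints:
  assumes W: "prim_blocks n c d f" and hw: "highest_weight n f" and d: "d \<le> n" and nz: "f xs0 \<noteq> 0" and ab: "b \<le> a" "a \<le> n"
    and good: "\<And>xs a' b'. f xs \<noteq> 0 \<Longrightarrow> shape n a' b' (\<lambda>p. weight n p xs) \<Longrightarrow> a' = a \<and> b' = b"
  shows "b \<le> d" "(c + d) mod 2 = (a + b) mod 2" "a + b \<le> c + d" "d + b \<le> a + c" "c + b \<le> a + d" "c + d + a \<le> 2*n + b"
proof -
  interpret B: block n c d "\<lambda>I. f (I @ [0..<d])" by (rule leading_block[OF W hw d])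
  obtain I0 where I0: "f (I0 @ [0..<d]) \<noteq> 0" using leading_coefficient[OF W hw nz] by blast
  have sums: "int a = (\<Sum>p<n. of_bool (p < a))" "int b = (\<Sum>p<n. of_bool (p < b))" "int d = (\<Sum>p<n. of_bool (p < d))"
    "2 * int n = (\<Sum>p<n. 2)"
    using sum_of_bool_less ab d by auto
  have shape: "of_bool (p \<in> set I) - of_bool (bar n p \<in> set I) + of_bool (p < d) = (of_bool (p < a) + of_bool (p < b) :: int)"
    if I: "f (I @ [0..<d]) \<noteq> 0" and p: "p < n" for I p
  proof -
    obtain a' b' where s: "shape n a' b' (\<lambda>p. weight n p (I @ [0..<d]))" using leading_shape(2)[OF W hw d I] by blast
    then have "a' = a" "b' = b" using good[OF I] by auto
    then have "weight n p (I @ [0..<d]) = of_bool (p < a) + of_bool (p < b)" using s p unfolding shape_def by simp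
    then show ?thesis using leading_shape(1)[OF W hw d I p] by simp
  qed
  note c0 = leading_shape(4)[OF W hw d I0]
  define S :: int where "S = (\<Sum>p<n. of_bool (bar n p \<in> set I0))"
  have S: "int c + int d = int a + int b + 2 * S"
    unfolding S_def c0 sums sum_distrib_left sum.distrib[symmetric]
  proof (intro sum.cong refl)
    fix p assume "p \<in> {..<n}"
    then show "of_bool (p \<in> set I0) + of_bool (bar n p \<in> set I0) + of_bool (p < d)
        = of_bool (p < a) + of_bool (p < b) + 2 * (of_bool (bar n p \<in> set I0) :: int)"
      using shape[OF I0, of p] by simp
  qed
  have "0 \<le> S" unfolding S_def by (intro sum_nonneg) auto
  then show "a + b \<le> c + d" using S by linarith
  have "even (int (c + d)) \<longleftrightarrow> even (int (a + b))" using S by simp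
  then have "even (c + d) \<longleftrightarrow> even (a + b)" by (simp only: even_of_nat)
  then show "(c + d) mod 2 = (a + b) mod 2" by (auto simp: mod2_eq_if)
  have "int b \<le> int d"
    unfolding sums
  proof (intro sum_mono)
    fix p assume "p \<in> {..<n}"
    then show "of_bool (p < b) \<le> (of_bool (p < d) :: int)"
      using shape[OF I0, of p] ab by (auto simp: of_bool_def split: if_splits)
  qed
  then show "b \<le> d" by simp
  have "int d + int b \<le> int a + int c"
    unfolding c0 unfolding sums sum.distrib[symmetric]
  proof (intro sum_mono)
    fix p assume "p \<in> {..<n}"
    then show "of_bool (p < d) + of_bool (p < b)
        \<le> of_bool (p < a) + (of_bool (p \<in> set I0) + of_bool (bar n p \<in> set I0) :: int)"
      using shape[OF I0, of p] ab by (auto simp: of_bool_def split: if_splits)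
  qed
  then show "d + b \<le> a + c" by simp
  obtain I1 where I1: "f (I1 @ [0..<d]) \<noteq> 0" "\<And>p. p < d \<Longrightarrow> \<not> (p \<in> set I1 \<and> bar n p \<in> set I1)"
    using B.exists_pairless[OF I0, of "{..<d}"] by auto
  have "int c + int d + int a \<le> 2 * int n + int b"
    unfolding leading_shape(4)[OF W hw d I1(1)] unfolding sums sum.distrib[symmetric]
  proof (intro sum_mono)
    fix p assume "p \<in> {..<n}"
    then have p: "p < n" by simp
    show "of_bool (p \<in> set I1) + of_bool (bar n p \<in> set I1) + of_bool (p < d) + of_bool (p < a) \<le> 2 + (of_bool (p < b) :: int)"
      using shape[OF I1(1) p] I1(2)[of p] leading_shape(3)[OF W hw d I1(1), of p] p ab
      by (auto simp: of_bool_def split: if_splits)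
  qed
  then show "c + d + a \<le> 2*n + b" by simp
  obtain I2 where I2: "f (I2 @ [0..<d]) \<noteq> 0" "\<And>p. d \<le> p \<Longrightarrow> p < n \<Longrightarrow> \<not> (p \<in> set I2 \<and> bar n p \<in> set I2)"
    using B.exists_pairless[OF I0, of "{d..<n}"] by auto
  have "int c + int b \<le> int a + int d"
    unfolding leading_shape(4)[OF W hw d I2(1)] unfolding sums sum.distrib[symmetric]
  proof (intro sum_mono)
    fix p assume "p \<in> {..<n}"
    then have p: "p < n" by simp
    show "of_bool (p \<in> set I2) + of_bool (bar n p \<in> set I2) + of_bool (p < b) \<le> (of_bool (p < a) + of_bool (p < d) :: int)"
      using shape[OF I2(1) p] I2(2)[of p] leading_shape(3)[OF W hw d I2(1), of p] p ab
      by (auto simp: of_bool_def split: if_splits)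
  qed
  then show "c + b \<le> a + d" by simp
qed

text \<open>Each block has distinct entries, so weight \<open>2\<close> at \<open>p\<close> requires
  \<open>p\<close> in both blocks, and the second block has room for only \<open>b\<close> of them.
  The sum of the weights is at most the number of slots.\<close>

lemma top_blocks_weight_bounds:
  assumes V: "top_blocks n a b f" and nz: "f es \<noteq> 0" and sh: "shape n a' b' (\<lambda>p. weight n p es)"
  shows "b' \<le> b" "a' + b' \<le> a + b"
proof -
  have W: "prim_blocks n a b f" using V unfolding top_blocks_def by blast
  then have len: "length es = a + b" using nz unfolding prim_blocks_def supported_def idx_def by blast
  define A B where "A = take a es" and "B = drop a es"
  have es: "es = A @ B" "length A = a" "length B = b" using len by (auto simp: A_def B_def)
  have dist: "distinct A" "distinct B"
    using alt1_nondistinct[OF prim_blocks_first_block(2)[OF W es(3)] es(2)] alt1_nondistinct[OF prim_blocks_second_block(2)[OF W es(2)] es(3)]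
      nz es(1) by auto
  have weight: "weight n p es = of_bool (p \<in> set A) - of_bool (bar n p \<in> set A) + (of_bool (p \<in> set B) - of_bool (bar n p \<in> set B))" for p
    unfolding es(1) weight_append by (simp add: weight_distinct dist)
  have ab: "b' \<le> a'" "a' \<le> n" and sh': "\<And>p. p < n \<Longrightarrow> weight n p es = of_bool (p < a') + of_bool (p < b')"
    using sh by (auto simp: shape_def)
  have "{..<b'} \<subseteq> set B"
  proof
    fix p assume "p \<in> {..<b'}"
    then have "weight n p es = 2" using sh'[of p] ab by simp
    then show "p \<in> set B" using weight[of p] by (auto simp: of_bool_def split: if_splits)
  qed
  then show "b' \<le> b" using card_mono[of "set B" "{..<b'}"] es(3) dist by (simp add: distinct_card)
  have idx: "set A \<subseteq> {..<2*n}" "set B \<subseteq> {..<2*n}"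
    using W nz es(1) unfolding prim_blocks_def supported_def idx_def by auto
  have "int a' + int b' = (\<Sum>p<n. weight n p es)"
    using sum_of_bool_less[of a' n] sum_of_bool_less[of b' n] ab sh' by (simp add: sum.distrib)
  also have "\<dots> \<le> (\<Sum>p<n. (of_bool (p \<in> set A) + of_bool (bar n p \<in> set A)) + (of_bool (p \<in> set B) + of_bool (bar n p \<in> set B)))"
    unfolding weight by (intro sum_mono) auto
  also have "\<dots> = int a + int b"
    unfolding sum.distrib[of "\<lambda>p. of_bool (p \<in> set A) + of_bool (bar n p \<in> set A)"]
    using length_distinct_sum[OF dist(1) idx(1)] length_distinct_sum[OF dist(2) idx(2)] es by simp
  finally show "a' + b' \<le> a + b" by simp
qed

text \<open>Take a list in the support with the fewest ones inside \<open>B\<close>. If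
  \<open>t\<close> in \<open>B\<close> carries a one, apply the raising operator at the list with
  this one replaced by \<open>0\<close>: each zero inside \<open>B\<close> contributes
  \<open>f xs\<close> by symmetry, each zero outside leads to a list with fewer ones in
  \<open>B\<close> and contributes nothing. So a positive multiple of \<open>f xs\<close>
  vanishes.\<close>

lemma symmetric_leading:
  assumes sup: "supported 2 m f" and hw: "highest_weight 1 f" and nz: "f xs0 \<noteq> 0"
    and B: "B \<subseteq> {..<m}" and sym: "\<And>xs s t. s \<in> B \<Longrightarrow> t \<in> B \<Longrightarrow> f (swp s t xs) = f xs"
  shows "\<exists>xs. f xs \<noteq> 0 \<and> (\<forall>t\<in>B. xs!t = 0)"
proof -
  define cnt where "cnt xs = card {t\<in>B. xs!t = 1}" for xs :: "nat list"
  have finB: "finite B" using B finite_subset by blast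
  obtain xs where xs: "f xs \<noteq> 0" "\<And>ys. f ys \<noteq> 0 \<Longrightarrow> cnt xs \<le> cnt ys"
    using ex_has_least_nat[of "\<lambda>xs. f xs \<noteq> 0" xs0 cnt] nz by blast
  have mem: "xs \<in> idx 2 m" using sup xs(1) unfolding supported_def by blast
  then have len: "length xs = m" by (rule length_idx)
  have "xs!t = 0" if t: "t \<in> B" for t
  proof (rule ccontr)
    assume "xs!t \<noteq> 0"
    have tm': "t < m" using t B by auto
    then have "xs!t < 2" using mem by (simp add: idx_iff)
    then have t1: "xs!t = 1" using \<open>xs!t \<noteq> 0\<close> by linarith
    define ys where "ys = xs[t := 0]"
    have lenys: "length ys = m" by (simp add: ys_def len)
    have summand: "(if ys!r = 0 then f (ys[r := 1]) else 0) = (if r \<in> B \<and> ys!r = 0 then f xs else 0)" if r: "r < m" for r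
    proof (cases "ys!r = 0")
      case y0: True
      show ?thesis
      proof (cases "r \<in> B")
        case True
        have "ys[r := 1] = swp t r xs"
          by (rule nth_equalityI) (use r tm' len t1 y0 in \<open>auto simp: ys_def nth_swp nth_list_update split: if_splits\<close>)
        then show ?thesis using sym[OF t True] True y0 by simp
      next
        case False
        have "cnt (ys[r := 1]) < cnt xs"
          unfolding cnt_def
        proof (rule psubset_card_mono)
          show "finite {t\<in>B. xs!t = 1}" using finB by simp
          have "xs!s = 1" if "s \<in> B" "ys[r := 1]!s = 1" for s
          proof -
            have "s \<noteq> r" "s < m" using that False B by auto
            then show ?thesis using that(2) len by (cases "s = t") (auto simp: ys_def)
          qed
          then have "{s\<in>B. ys[r := 1]!s = 1} \<subseteq> {s\<in>B. xs!s = 1}" by blast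
          moreover have "t \<notin> {s\<in>B. ys[r := 1]!s = 1}"
          proof -
            have "t \<noteq> r" using False t by auto
            then show ?thesis using tm' len by (simp add: ys_def)
          qed
          moreover have "t \<in> {s\<in>B. xs!s = 1}" using t t1 by simp
          ultimately show "{s\<in>B. ys[r := 1]!s = 1} \<subset> {s\<in>B. xs!s = 1}" by blast
        qed
        then have "f (ys[r := 1]) = 0" using xs(2)[of "ys[r := 1]"] by auto
        then show ?thesis using False by simp
      qed
    qed simp
    have "lact (2*1) (sp_unit 1 0 1) f ys = 0"
      using hw unfolding highest_weight_def by (simp add: eta_def)
    moreover have "lact (2*1) (sp_unit 1 0 1) f ys = subst_sum f 0 1 ys - bar_sgn 1 0 * bar_sgn 1 1 * subst_sum f (bar 1 1) (bar 1 0) ys"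
      by (rule lact_sp_unit_subst_sum) simp_all
    ultimately have "subst_sum f 0 1 ys = 0" by (simp add: bar_def bar_sgn_def)
    moreover have "subst_sum f 0 1 ys = (\<Sum>r<m. if r \<in> B \<and> ys!r = 0 then f xs else 0)"
      unfolding subst_sum_def lenys using summand by (intro sum.cong) auto
    moreover have "\<dots> = of_nat (card {r. r < m \<and> r \<in> B \<and> ys!r = 0}) * f xs"
      by (simp add: sum.If_cases Int_def)
    moreover have "t \<in> {r. r < m \<and> r \<in> B \<and> ys!r = 0}" using t tm' len by (simp add: ys_def)
    then have "card {r. r < m \<and> r \<in> B \<and> ys!r = 0} \<noteq> 0" using card_eq_0_iff by fastforce
    ultimately show False using xs(1) by simp
  qed
  then show ?thesis using xs(1) by blast
qed

text \<open>If one block consists of zeros, the weight \<open>k\<close> differs from the size of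
  this block by at most the size of the other block. Applying this to either block gives the two
  inequalities.\<close>

lemma clebsch_gordan_constraints:
  assumes S: "sym_blocks r l f" and hw: "highest_weight 1 f" and nz: "f xs0 \<noteq> 0"
    and good: "\<And>xs. f xs \<noteq> 0 \<Longrightarrow> weight 1 0 xs = int k"
  shows "\<bar>int k - int l\<bar> \<le> int r" "\<bar>int k - int r\<bar> \<le> int l"
proof -
  have sup: "supported 2 (r + l) f" and sym: "sym1 0 r f" "sym1 r l f" using S unfolding sym_blocks_def by auto
  have swap: "f (swp s t xs) = f xs" if "sym1 o' m f" "s \<in> {o'..<o'+m}" "t \<in> {o'..<o'+m}" for o' m s t xs
  proof -
    consider "s < t" | "s = t" | "t < s" by linarith
    then show ?thesis
    proof cases
      case 3
      then have "f (swp t s xs) = f xs" using that unfolding sym1_def by simp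
      then show ?thesis by (simp add: swp_commute[of s t])
    qed (use that in \<open>auto simp: sym1_def swp_def\<close>)
  qed
  have bound: "\<bar>weight 1 0 xs - int (card B)\<bar> \<le> int (r + l) - int (card B)"
    if "length xs = r + l" "B \<subseteq> {..<r + l}" "\<forall>t\<in>B. xs!t = 0" for xs B
  proof -
    let ?g = "\<lambda>t. (if xs!t = 0 then 1 else 0) - (if xs!t = bar 1 0 then 1 else 0) :: int"
    have "weight 1 0 xs = sum ?g B + sum ?g ({..<r + l} - B)"
      unfolding weight_def that(1) using that(2) by (simp add: sum.subset_diff add.commute)
    also have "sum ?g B = (\<Sum>t\<in>B. 1)" using that(3) by (intro sum.cong) (auto simp: bar_def)
    finally have "weight 1 0 xs - int (card B) = sum ?g ({..<r + l} - B)" by simp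
    also have "\<bar>\<dots>\<bar> \<le> (\<Sum>t\<in>{..<r + l} - B. \<bar>?g t\<bar>)" by (rule sum_abs)
    also have "\<dots> \<le> (\<Sum>t\<in>{..<r + l} - B. 1)" by (intro sum_mono) auto
    also have "\<dots> = int (r + l) - int (card B)"
      using card_mono[OF finite_lessThan that(2)] that(2)
      by (simp add: card_Diff_subset finite_subset[OF that(2)] of_nat_diff)
    finally show ?thesis .
  qed
  have "\<exists>xs. f xs \<noteq> 0 \<and> (\<forall>t\<in>{r..<r+l}. xs!t = 0)"
    by (rule symmetric_leading[OF sup hw nz _ swap[OF sym(2)]]) auto
  then obtain xs where xs: "f xs \<noteq> 0" "\<forall>t\<in>{r..<r+l}. xs!t = 0" by blast
  have "length xs = r + l" "{r..<r+l} \<subseteq> {..<r + l}" using sup xs(1) unfolding supported_def idx_def by auto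
  from bound[OF this xs(2)] show "\<bar>int k - int l\<bar> \<le> int r" using good[OF xs(1)] by simp
  have "\<exists>ys. f ys \<noteq> 0 \<and> (\<forall>t\<in>{0..<0+r}. ys!t = 0)"
    by (rule symmetric_leading[OF sup hw nz _ swap[OF sym(1)]]) auto
  then obtain ys where ys: "f ys \<noteq> 0" "\<forall>t\<in>{0..<0+r}. ys!t = 0" by blast
  have "length ys = r + l" "{0..<0+r} \<subseteq> {..<r + l}" using sup ys(1) unfolding supported_def idx_def by auto
  from bound[OF this ys(2)] show "\<bar>int k - int r\<bar> \<le> int l" using good[OF ys(1)] by simp
qed

theorem hom_nonzero_necessary:
  assumes ab: "b \<le> a" "a \<le> n" and d: "d \<le> n" and hom: "hom_nonzero n (Vsp n k a b) (Wsp n l d)"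
  shows "\<exists>r c. r + c = n \<and> \<bar>int k - int l\<bar> \<le> int r \<and> \<bar>int k - int r\<bar> \<le> int l \<and> (k + r + l) mod 2 = 0
    \<and> b \<le> d \<and> (c + d) mod 2 = (a + b) mod 2 \<and> a + b \<le> c + d \<and> d + b \<le> a + c \<and> c + b \<le> a + d \<and> c + d + a \<le> 2*n + b"
proof -
  let ?V = "Vsp n k a b"
  from hom[unfolded hom_nonzero_def] obtain F where
    F0: "\<forall>x\<in>?V. \<forall>y\<in>?V. F (\<lambda>hs es. x hs es + y hs es) = (\<lambda>hs es. F x hs es + F y hs es)"
      "\<forall>c. \<forall>x\<in>?V. F (\<lambda>hs es. c * x hs es) = (\<lambda>hs es. c * F x hs es)"
      "F ` ?V \<subseteq> Wsp n l d"
      "\<forall>h\<in>cpt_sp 1. \<forall>g\<in>cpt_sp n. \<forall>v\<in>?V. F (act n h g v) = act n h g (F v)"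
      "\<exists>v\<in>?V. F v \<noteq> (\<lambda>hs es. 0)"
    by (elim exE conjE) (rule that; assumption)
  note F = F0(1)[rule_format] F0(2)[rule_format] F0(3)[THEN subsetD, OF imageI] F0(4)[rule_format] F0(5)
  have W: "\<exists>w. (\<forall>s\<le>n. w s \<in> Wsummand n s l d) \<and> F v = (\<lambda>hs es. \<Sum>s\<le>n. w s hs es)" if "v \<in> ?V" for v
    using F(3)[OF that] unfolding Wsp_def by blast
  obtain v1 hs1 es1 where v1: "v1 \<in> ?V" "F v1 hs1 es1 \<noteq> 0" using F(5) by (auto simp: fun_eq_iff)
  have lens: "length hs = s + l" if "w \<in> Wsummand n s l d" "w hs es \<noteq> 0" for w s hs es
    using that unfolding Wsummand_def supp_in_def idx_def by auto
  obtain r where r: "r \<le> n" "length hs1 = r + l"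
  proof -
    obtain w where w: "\<And>s. s \<le> n \<Longrightarrow> w s \<in> Wsummand n s l d" "F v1 = (\<lambda>hs es. \<Sum>s\<le>n. w s hs es)"
      using W[OF v1(1)] by blast
    then have "(\<Sum>s\<le>n. w s hs1 es1) \<noteq> 0" using v1(2) by simp
    then obtain s where "s \<le> n" "w s hs1 es1 \<noteq> 0" by (meson sum.neutral atMost_iff)
    then show thesis using that lens[OF w(1)] by blast
  qed
  \<comment> \<open>The summands of the target differ in the number of H-slots, so restricting to
    \<open>length hs = r + l\<close> projects onto summand \<open>r\<close>.\<close>
  define G where "G v = (\<lambda>hs es. if length hs = r + l then F v hs es else 0)" for v
  define c where "c = n - r"
  have GW: "G v \<in> tensor_space (sym_blocks r l) (prim_blocks n c d)" if v: "v \<in> ?V" for v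
  proof -
    obtain w where w: "\<And>s. s \<le> n \<Longrightarrow> w s \<in> Wsummand n s l d" "F v = (\<lambda>hs es. \<Sum>s\<le>n. w s hs es)"
      using W[OF v] by blast
    have "G v = w r"
    proof (intro ext)
      fix hs es
      have "w s hs es = 0" if "s \<le> n" "s \<noteq> r" "length hs = r + l" for s
        using lens[OF w(1)[OF that(1)], of hs es] that by auto
      then have "(\<Sum>s\<le>n. w s hs es) = (\<Sum>s\<le>n. if s = r then w r hs es else 0)" if "length hs = r + l"
        using that by (intro sum.cong) auto
      moreover have "w r hs es = 0" if "length hs \<noteq> r + l"
        using lens[OF w(1)[OF r(1)], of hs es] that by auto
      ultimately show "G v hs es = w r hs es" using r(1) by (auto simp: G_def w(2))
    qed
    then show ?thesis using w(1)[OF r(1)] Wsummand_eq[OF r(1)] by (simp add: c_def)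
  qed
  have Gact: "act n h g (G v) = (\<lambda>hs es. if length hs = r + l then act n h g (F v) hs es else 0)" for h g v
    unfolding G_def act_def by (intro ext) (auto simp: length_idx intro!: sum.cong sum.neutral)
  interpret sp_hom n k "a + b" "r + l" "c + d" ?V G
  proof
    show "(\<lambda>hs es. u hs es + v hs es) \<in> ?V" if "u \<in> ?V" "v \<in> ?V" for u v
      using that unfolding Vsp_eq by (rule tensor_space_add[OF lin_closed_sym_blocks lin_closed_top_blocks])
    show "(\<lambda>hs es. c * v hs es) \<in> ?V" if "v \<in> ?V" for c v
      using that unfolding Vsp_eq by (rule tensor_space_scale[OF lin_closed_sym_blocks lin_closed_top_blocks])
    show "supp_in n k (a + b) v" if "v \<in> ?V" for v using that by (simp add: Vsp_def)
    show "supp_in n (r + l) (c + d) (G v)" if "v \<in> ?V" for v by (rule sym_blocks_prim_blocks_supp[OF GW[OF that]])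
    show "G (act n h g v) = act n h g (G v)" if "h \<in> cpt_sp 1" "g \<in> cpt_sp n" "v \<in> ?V" for h g v
      unfolding Gact unfolding G_def F(4)[OF that] ..
  qed (auto simp: act_Vsp G_def F(1,2) fun_eq_iff)
  have "\<exists>v\<in>?V. G v \<noteq> (\<lambda>hs es. 0)"
    using v1 r(2) by (intro bexI[of _ v1]) (auto simp: G_def fun_eq_iff)
  then obtain v where v: "v \<in> ?V" "G v \<noteq> (\<lambda>hs es. 0)" and hw: "\<And>hs. highest_weight n (G v hs)" "\<And>es. highest_weight 1 (\<lambda>hs. G v hs es)"
    using highest_weight_vector_exists by blast
  obtain hs0 es0 where nz: "G v hs0 es0 \<noteq> 0" using v(2) by (auto simp: fun_eq_iff)
  define CE where "CE = int a * (2 * int n + 2 - int a) + int b * (2 * int n + 4 - int b)"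
  define CH where "CH = int k * (int k + 2)"
  have top_blocks: "top_blocks n a b (u hs)" and sym_blocks: "sym_blocks k 0 (\<lambda>hs. u hs es)" if "u \<in> ?V" for u hs es
    using that unfolding Vsp_eq tensor_space_def by auto
  have cE: "casimir n (u hs) es = of_int CE * u hs es" and cH: "casimir 1 (\<lambda>hs'. u hs' es) hs = of_int CH * u hs es" if "u \<in> ?V" for u hs es
    using casimir_top_blocks[OF top_blocks[OF that], of hs es] casimir_sym_blocks[OF sym_blocks[OF that], of es hs] by (auto simp: CE_def CH_def)
  have casimir: "(\<Sum>i<n. (weight n i es)\<^sup>2 + 2 * (int n - int i) * weight n i es) = CE" "(weight 1 0 hs)\<^sup>2 + 2 * weight 1 0 hs = CH"
    if "G v hs es \<noteq> 0" for hs es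
    using highest_weight_casimir[where v = v and CE = CE and CH = CH and hs = hs and es = es] v(1) hw cE cH that
    by blast+
  have goodE: "a' = a \<and> b' = b" if nzG: "G v hs es \<noteq> 0" and sh: "shape n a' b' (\<lambda>p. weight n p es)" for hs es a' b'
  proof -
    obtain hs' es' where e: "v hs' es' \<noteq> 0" "\<And>i. i < n \<Longrightarrow> weight n i es' = weight n i es"
      using weight_transfer[OF v(1) nzG] by blast
    have "shape n a' b' (\<lambda>p. weight n p es')" using sh e(2) by (simp add: shape_def)
    note bounds = top_blocks_weight_bounds[OF top_blocks[OF v(1)] e(1) this]
    have "int a' * (2 * int n + 2 - int a') + int b' * (2 * int n + 4 - int b') = CE"
      using shape_casimir[OF sh] casimir(1)[OF nzG] by simp
    then show ?thesis
      using sh by (intro casimir_injective[OF ab _ _ bounds]) (auto simp: shape_def CE_def)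
  qed
  have goodH: "weight 1 0 hs = int k" if nzG: "G v hs es \<noteq> 0" for hs es
  proof -
    obtain hs' es' where e: "v hs' es' \<noteq> 0" "weight 1 0 hs' = weight 1 0 hs"
      using weight_transfer[OF v(1) nzG] by blast
    have "length hs' = k" using V_supp[OF v(1)] e(1) unfolding supp_in_def idx_def by auto
    then have "- int k \<le> weight 1 0 hs" using abs_weight_le[of 1 0 hs'] e(2) by simp
    \<comment> \<open>The root \<open>- k - 2\<close> is excluded because weights of the source are
      at least \<open>- k\<close>.\<close>
    moreover have "(weight 1 0 hs - int k) * (weight 1 0 hs + int k + 2) = 0"
      using casimir(2)[OF nzG] by (simp add: CH_def power2_eq_square algebra_simps)
    ultimately show ?thesis by auto
  qed
  have prim_blocks: "prim_blocks n c d (G v hs0)" and SHW: "sym_blocks r l (\<lambda>hs. G v hs es0)"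
    using GW[OF v(1)] unfolding tensor_space_def by auto
  have goodE': "a' = a \<and> b' = b" if "G v hs0 xs \<noteq> 0" "shape n a' b' (\<lambda>p. weight n p xs)" for xs a' b'
    using that by (rule goodE)
  have goodH': "weight 1 0 xs = int k" if "G v xs es0 \<noteq> 0" for xs
    using that by (rule goodH)
  note E = tensor_product_constraints[OF prim_blocks hw(1) d nz ab goodE']
  note H = clebsch_gordan_constraints[OF SHW hw(2) nz goodH']
  have "(k + r + l) mod 2 = 0"
  proof -
    have mem: "hs0 \<in> idx 2 (r + l)" using F_supp[OF v(1)] nz unfolding supp_in_def by blast
    \<comment> \<open>The weight \<open>k\<close> is a sum of \<open>r + l\<close> signs, hence
      congruent to \<open>r + l\<close> mod 2.\<close>
    have "weight 1 0 hs0 = (\<Sum>t<r + l. 1 - 2 * int (hs0!t))"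
      unfolding weight_def length_idx[OF mem]
    proof (intro sum.cong refl)
      fix t assume "t \<in> {..<r + l}"
      then have "hs0!t < 2" using mem by (simp add: idx_iff)
      then have "hs0!t = 0 \<or> hs0!t = 1" by linarith
      then show "(if hs0!t = 0 then 1 else 0) - (if hs0!t = bar 1 0 then 1 else 0) = 1 - 2 * int (hs0!t)"
        by (auto simp: bar_def)
    qed
    then have "int (k + r + l) = 2 * (int (r + l) - (\<Sum>t<r + l. int (hs0!t)))"
      using goodH[OF nz] by (simp add: sum_subtractf sum_distrib_left)
    then have "even (int (k + r + l))" by (metis dvd_triv_left)
    then have "even (k + r + l)" by (simp only: even_of_nat)
    then show ?thesis by (simp only: even_iff_mod_2_eq_zero)
  qed
  moreover have "r + c = n" using r(1) by (simp add: c_def)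
  ultimately show ?thesis
    using E H by (intro exI[of _ r] exI[of _ c] conjI)
qed

theorem theorem3p1:
  fixes n k a b l d :: nat
  assumes "2 \<le> n" and "b \<le> a" and "a \<le> n" and "d \<le> n"
  shows "hom_nonzero n (Vsp n k a b) (Wsp n l d) \<longleftrightarrow>
    ((k + a + b) mod 2 = (n + l + d) mod 2
     \<and> b \<le> d
     \<and> \<bar>int k - int l\<bar> + \<bar>int a - int d\<bar> \<le> int n - int b
     \<and> \<bar>int n - int a + int b - int d\<bar> \<le> int k + int l)"
    (is "?L \<longleftrightarrow> ?R")
proof
  assume ?L
  from hom_nonzero_necessary[OF assms(2-4) this] obtain r c where rc:
    "r + c = n \<and> \<bar>int k - int l\<bar> \<le> int r \<and> \<bar>int k - int r\<bar> \<le> int l \<and> (k + r + l) mod 2 = 0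
    \<and> b \<le> d \<and> (c + d) mod 2 = (a + b) mod 2 \<and> a + b \<le> c + d \<and> d + b \<le> a + c \<and> c + b \<le> a + d \<and> c + d + a \<le> 2*n + b"
    by (elim exE)
  have parity: "x mod 2 = y mod 2 \<longleftrightarrow> (even x \<longleftrightarrow> even y)" for x y :: nat
    by (auto simp: mod2_eq_if)
  have n: "n = r + c" and "even (k + r + l)" "even (c + d) \<longleftrightarrow> even (a + b)"
    using rc by (auto simp: parity)
  then have 1: "(k + a + b) mod 2 = (n + l + d) mod 2"
    unfolding parity n by auto
  have "\<bar>int k - int l\<bar> + \<bar>int a - int d\<bar> \<le> int n - int b" "\<bar>int n - int a + int b - int d\<bar> \<le> int k + int l"
    using rc by linarith+
  with 1 rc show ?R by blast
next
  assume R: ?R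
  define r where "r = nat (max \<bar>int n - int a + int b - int d\<bar> \<bar>int k - int l\<bar>)"
  have r: "int r = max \<bar>int n - int a + int b - int d\<bar> \<bar>int k - int l\<bar>"
    unfolding r_def by (rule nat_0_le) (simp add: le_max_iff_disj)
  have rn: "r \<le> n" using R assms r by auto
  define c where "c = n - r"
  have c: "int c = int n - int r" using rn by (simp add: c_def)
  have par: "even (int c + int d - int a - int b)" "even (int r + int l - int k)"
  proof -
    let ?X = "int n - int a + int b - int d" and ?Y = "int k - int l"
    have cases: "int r = ?X \<or> int r = - ?X \<or> int r = ?Y \<or> int r = - ?Y"
      using r by (auto simp: max_def abs_if)
    have "(k + a + b) mod 2 = (n + l + d) mod 2" using R by blast
    then have "even (k + a + b) \<longleftrightarrow> even (n + l + d)" by (metis even_iff_mod_2_eq_zero)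
    then have XY: "even ?X \<longleftrightarrow> even ?Y" by auto
    have "even (int r) \<longleftrightarrow> even ?X" using cases XY by (metis even_minus)
    with XY show "even (int c + int d - int a - int b)" "even (int r + int l - int k)" unfolding c by auto
  qed
  \<comment> \<open>The numbers of inserted forms are dictated by the degrees:
    \<open>a + b + 2 * j = c + d\<close> and \<open>k + 2 * j' = r + l\<close>.\<close>
  define j where "j = nat ((int c + int d - int a - int b) div 2)"
  define j' where "j' = nat ((int r + int l - int k) div 2)"
  have low: "\<bar>int n - int a + int b - int d\<bar> \<le> int r" "\<bar>int k - int l\<bar> \<le> int r"
    using r by linarith+
  \<comment> \<open>The E-interval for \<open>r\<close> is nonempty: this amounts to
    \<open>b <= min a d\<close> and \<open>max a d <= n\<close>.\<close>
  have "\<bar>int n - int a + int b - int d\<bar> \<le> int n - int b - \<bar>int a - int d\<bar>"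
    using R assms by linarith
  then have up: "int r \<le> int n - int b - \<bar>int a - int d\<bar>" "int r \<le> int k + int l"
    unfolding r using R by auto
  have le: "int a + int b \<le> int c + int d" "int k \<le> int r + int l" "int c + int b \<le> int a + int d"
    "int d + int b \<le> int a + int c" "int c + int d + int a \<le> 2 * int n + int b"
    "int r \<le> int k + int l" "int l \<le> int r + int k"
    using low up c by linarith+
  have j: "2 * int j = int c + int d - int a - int b" using par(1) le(1) by (simp add: j_def)
  have j': "2 * int j' = int r + int l - int k" using par(2) le(2) by (simp add: j'_def)
  define i where "i = d - b - j"
  define p where "p = c - j"
  define x where "x = r - j'"
  define y where "y = l - j'"
  have "int j \<le> int d - int b" "int j \<le> int c" "int j' \<le> int r" "int j' \<le> int l"
    using j j' le by linarith+
  then have ints: "int i = int d - int b - int j" "int p = int c - int j" "int x = int r - int j'" "int y = int l - int j'"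
    unfolding i_def p_def x_def y_def by linarith+
  have "b \<le> p" "p + i + j \<le> n" "n = x + j' + p + j"
    using ints j j' le c by linarith+
  then have "hom_nonzero n (Vsp n (x + y) (p + i) b) (Wsp n (y + j') (b + i + j))"
    by (rule hom_nonzero_sufficient)
  moreover have "x + y = k" "p + i = a" "y + j' = l" "b + i + j = d"
    using ints j j' by linarith+
  ultimately show ?L by simp
qed

end
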